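(* Let $J\subset S$ be a bigraded ideal, $R=S/J$, and $\tilde\Delta=(s,t)\in\mathbb N^2$ with $(s,t)\ne(0,0)$. If $s>0$, then $$\mathrm{reg}_x^{S_{\tilde\Delta}}(R_{\tilde\Delta})\le\max\{c : c=\lceil a/s\rceil-i,\ \beta^S_{i,(a,b)}(R)\ne0\text{ for some }i,b\in\mathbb N\},$$ and if $t>0$, then $$\mathrm{reg}_y^{S_{\tilde\Delta}}(R_{\tilde\Delta})\le\max\{c : c=\lceil b/t\rceil-i,\ \beta^S_{i,(a,b)}(R)\ne0\text{ for some }i,a\in\mathbb N\}.$$
   Context: $K$ is an infinite field, $\mathbb N=\{0,1,2,\dots\}$, and $S=K[x_1,\dots,x_n,y_1,\dots,y_m]$ is the standard bigraded polynomial ring with $\deg x_i=(1,0)$, $\deg y_j=(0,1)$. For a bigraded algebra $R$ (a quotient of $S$ by a bigraded ideal) and $\tilde\Delta=(s,t)$, the bigraded Veronese algebra is $R_{\tilde\Delta}=\bigoplus_{(a,b)\in\mathbb N^2}R_{(as,bt)}$, a bigraded algebra whose component of bidegree $(a,b)$ is $R_{(as,bt)}$; $R_{\tilde\Delta}$ is a module over $S_{\tilde\Delta}$ via the natural map $S_{\tilde\Delta}\to R_{\tilde\Delta}$. For a bigraded algebra $A$ and a finitely generated bigraded $A$-module $M$, $\beta^A_{i,(a,b)}(M)=\dim_K\mathrm{Tor}^A_i(M,K)_{(a,b)}$, and $\mathrm{reg}_x^A(M)=\sup\{a\in\mathbb Z:\beta^A_{i,(a+i,b)}(M)\ne0\text{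 for some }i,b\in\mathbb Z\}$, $\mathrm{reg}_y^A(M)=\sup\{b\in\mathbb Z:\beta^A_{i,(a,b+i)}(M)\ne0\text{ for some }i,a\in\mathbb Z\}$. Suprema and maxima of empty sets are $-\infty$. *)

theory Defs
  imports
    "HOL-Algebra.Module"
    "HOL-Algebra.QuotRing"
    "HOL-Algebra.Generated_Groups"
    "HOL-Library.Product_Plus"
    "HOL-Library.Poly_Mapping"
    "HOL-Library.Extended_Real"
begin

section \<open>Bigraded algebras and bigraded modules\<close>

type_synonym bideg = "int \<times> int"

text \<open>
  A bigraded object is given by the family of its homogeneous components, all of them subgroups
  of one ambient ring (or module), from which the operations are taken.  The object meant is the
  \<^emph>\<open>external\<close> direct sum of the family: the components may overlap inside the ambient structure,
  and an element only has a bidegree as a member of a specified component.  This matters for the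
  Veronese algebra with \<open>s = 0\<close> or \<open>t = 0\<close>, where infinitely many components are equal as sets.
  Consequently homogeneous maps are families of maps, one for each bidegree, and all of the
  homological algebra below is done one bidegree at a time.
\<close>

record 'a bigraded_algebra = "'a ring" +
  acomp :: "bideg \<Rightarrow> 'a set"

text \<open>The ring fields \<open>mult\<close> and \<open>one\<close> that a module record inherits play no role.\<close>

record ('a, 'b) bigraded_module = "('a, 'b) module" +
  mcomp :: "bideg \<Rightarrow> 'b set"

text \<open>The bigraded algebra \<open>B\<close> as a module over the source of a ring homomorphism \<open>\<phi>\<close> to \<open>B\<close>.\<close>

definition module_via ::
    "('a \<Rightarrow> 'b) \<Rightarrow> ('b, 'z) bigraded_algebra_scheme \<Rightarrow> ('a, 'b) bigraded_module" where
  "module_via \<phi> B =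
     \<lparr>carrier = carrier B, monoid.mult = monoid.mult B, one = one B, zero = zero B, add = add B,
      smult = (\<lambda>a x. \<phi> a \<otimes>\<^bsub>B\<^esub> x), mcomp = acomp B\<rparr>"

definition bigraded_hom ::
    "('a, 'z) bigraded_algebra_scheme \<Rightarrow> ('a, 'b, 'y) bigraded_module_scheme \<Rightarrow>
     ('a, 'c, 'x) bigraded_module_scheme \<Rightarrow> (bideg \<Rightarrow> 'b \<Rightarrow> 'c) \<Rightarrow> bool" where
  "bigraded_hom A M N \<phi> \<longleftrightarrow>
     (\<forall>p. \<forall>x\<in>mcomp M p. \<phi> p x \<in> mcomp N p) \<and>
     (\<forall>p. \<forall>x\<in>mcomp M p. \<forall>y\<in>mcomp M p. \<phi> p (x \<oplus>\<^bsub>M\<^esub> y) = \<phi> p x \<oplus>\<^bsub>N\<^esub> \<phi> p y) \<and>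
     (\<forall>p q. \<forall>a\<in>acomp A p. \<forall>x\<in>mcomp M q. \<phi> (p + q) (a \<odot>\<^bsub>M\<^esub> x) = a \<odot>\<^bsub>N\<^esub> \<phi> q x)"

text \<open>
  The free bigraded module with a homogeneous basis indexed by \<open>B\<close>, the basis element \<open>j\<close>
  having bidegree \<open>d j\<close>: the direct sum over \<open>j \<in> B\<close> of the shifted modules \<open>A(- d j)\<close>.
\<close>

definition free_bigraded_module ::
    "('a, 'z) bigraded_algebra_scheme \<Rightarrow> nat set \<Rightarrow> (nat \<Rightarrow> bideg) \<Rightarrow>
     ('a, nat \<Rightarrow> 'a) bigraded_module" where
  "free_bigraded_module A B d =
     (let C = {f. (\<forall>j. f j \<in> carrier A) \<and> finite {j. f j \<noteq> \<zero>\<^bsub>A\<^esub>} \<and> (\<forall>j. j \<notin> B \<longrightarrow> f j = \<zero>\<^bsub>A\<^esub>)}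
      in \<lparr>carrier = C, monoid.mult = undefined, one = undefined,
          zero = (\<lambda>j. \<zero>\<^bsub>A\<^esub>), add = (\<lambda>f g j. f j \<oplus>\<^bsub>A\<^esub> g j),
          smult = (\<lambda>a f j. a \<otimes>\<^bsub>A\<^esub> f j),
          mcomp = (\<lambda>p. {f \<in> C. \<forall>j\<in>B. f j \<in> acomp A (p - d j)})\<rparr>)"


section \<open>Tor and bigraded Betti numbers\<close>

record ('a, 'b) free_complex =
  basis :: "nat \<Rightarrow> nat set"
  bdeg :: "nat \<Rightarrow> nat \<Rightarrow> bideg"
  bdry :: "nat \<Rightarrow> bideg \<Rightarrow> (nat \<Rightarrow> 'a) \<Rightarrow> (nat \<Rightarrow> 'a)"
    \<comment> \<open>\<open>bdry F i\<close> goes from homological degree \<open>i + 1\<close> to homological degree \<open>i\<close>\<close>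
  augm :: "bideg \<Rightarrow> (nat \<Rightarrow> 'a) \<Rightarrow> 'b"

definition chain_module ::
    "('a, 'z) bigraded_algebra_scheme \<Rightarrow> ('a, 'b) free_complex \<Rightarrow> nat \<Rightarrow>
     ('a, nat \<Rightarrow> 'a) bigraded_module" where
  "chain_module A F i = free_bigraded_module A (basis F i) (bdeg F i)"

definition free_resolution ::
    "('a, 'z) bigraded_algebra_scheme \<Rightarrow> ('a, 'b, 'y) bigraded_module_scheme \<Rightarrow>
     ('a, 'b) free_complex \<Rightarrow> bool" where
  "free_resolution A M F \<longleftrightarrow>
     bigraded_hom A (chain_module A F 0) M (augm F) \<and>
     (\<forall>i. bigraded_hom A (chain_module A F (Suc i)) (chain_module A F i) (bdry F i)) \<and>
     (\<forall>p. augm F p ` mcomp (chain_module A F 0) p = mcomp M p) \<and>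
     (\<forall>p. bdry F 0 p ` mcomp (chain_module A F 1) p
        = {x \<in> mcomp (chain_module A F 0) p. augm F p x = \<zero>\<^bsub>M\<^esub>}) \<and>
     (\<forall>i p. bdry F (Suc i) p ` mcomp (chain_module A F (Suc (Suc i))) p
        = {x \<in> mcomp (chain_module A F (Suc i)) p. bdry F i p x = \<zero>\<^bsub>chain_module A F i\<^esub>})"

text \<open>
  The component of bidegree \<open>p\<close> of \<open>A\<^sub>+ M\<close>, where \<open>A\<^sub>+\<close> is the sum of the components of \<open>A\<close> of
  bidegree different from \<open>(0, 0)\<close>.  With \<open>K = A / A\<^sub>+\<close>, the tensor product of \<open>M\<close> and \<open>K\<close>
  over \<open>A\<close> is \<open>M / A\<^sub>+ M\<close>.
\<close>

definition irrelevant_part ::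
    "('a, 'z) bigraded_algebra_scheme \<Rightarrow> ('a, 'b, 'y) bigraded_module_scheme \<Rightarrow> bideg \<Rightarrow> 'b set" where
  "irrelevant_part A M p =
     generate (add_monoid M)
       {a \<odot>\<^bsub>M\<^esub> x | a x q. q \<noteq> 0 \<and> a \<in> acomp A q \<and> x \<in> mcomp M (p - q)}"

text \<open>
  Cycles and boundaries of the complex \<open>F / A\<^sub>+ F\<close> in homological degree \<open>i\<close> and bidegree \<open>p\<close>, as
  subgroups of the component \<open>p\<close> of \<open>F\<^sub>i\<close> which contain the component \<open>p\<close> of \<open>A\<^sub>+ F\<^sub>i\<close>.
\<close>

definition tor_cycles ::
    "('a, 'z) bigraded_algebra_scheme \<Rightarrow> ('a, 'b) free_complex \<Rightarrow> nat \<Rightarrow> bideg \<Rightarrow> (nat \<Rightarrow> 'a) set" where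
  "tor_cycles A F i p =
     {x \<in> mcomp (chain_module A F i) p.
        \<forall>k. i = Suc k \<longrightarrow> bdry F k p x \<in> irrelevant_part A (chain_module A F k) p}"

definition tor_boundaries ::
    "('a, 'z) bigraded_algebra_scheme \<Rightarrow> ('a, 'b) free_complex \<Rightarrow> nat \<Rightarrow> bideg \<Rightarrow> (nat \<Rightarrow> 'a) set" where
  "tor_boundaries A F i p =
     (bdry F i p ` mcomp (chain_module A F (Suc i)) p)
       <+>\<^bsub>chain_module A F i\<^esub> irrelevant_part A (chain_module A F i) p"

text \<open>
  The dimension of \<open>Z / Y\<close> over the field \<open>K\<close>, for \<open>K\<close>-subspaces \<open>Y \<subseteq> Z\<close> of \<open>M\<close>: the supremum of the
  sizes of the finite subsets of \<open>Z\<close> that are linearly independent modulo \<open>Y\<close>.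
\<close>

definition quotient_dim :: "'a ring \<Rightarrow> ('a, 'b, 'y) module_scheme \<Rightarrow> 'b set \<Rightarrow> 'b set \<Rightarrow> enat" where
  "quotient_dim K M Z Y =
     (SUP X \<in> {X. finite X \<and> X \<subseteq> Z \<and>
        (\<forall>c \<in> X \<rightarrow> carrier K. (\<Oplus>\<^bsub>M\<^esub>x\<in>X. c x \<odot>\<^bsub>M\<^esub> x) \<in> Y \<longrightarrow> (\<forall>x\<in>X. c x = \<zero>\<^bsub>K\<^esub>))}.
      enat (card X))"

text \<open>For the algebras considered here the base field is the component of bidegree \<open>(0, 0)\<close>.\<close>

definition base_field :: "('a, 'z) bigraded_algebra_scheme \<Rightarrow> 'a ring" where
  "base_field A = (ring.truncate A)\<lparr>carrier := acomp A (0, 0)\<rparr>"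

text \<open>
  \<open>betti A M i p\<close> is the \<open>K\<close>-dimension of the component of bidegree \<open>p\<close> of the \<open>i\<close>-th Tor of \<open>M\<close> and
  \<open>K\<close> over \<open>A\<close>.  As usual Tor is computed from a chosen bigraded free resolution of \<open>M\<close>; bases
  indexed by sets of natural numbers suffice for finitely generated \<open>M\<close> over Noetherian \<open>A\<close>.
\<close>

definition betti ::
    "('a, 'z) bigraded_algebra_scheme \<Rightarrow> ('a, 'b, 'y) bigraded_module_scheme \<Rightarrow>
     nat \<Rightarrow> bideg \<Rightarrow> enat" where
  "betti A M i p =
     (let F = (SOME F. free_resolution A M F)
      in quotient_dim (base_field A) (chain_module A F i) (tor_cycles A F i p) (tor_boundaries A F i p))"

text \<open>The supremum of the empty set is \<open>-\<infinity>\<close> in \<^typ>\<open>ereal\<close>.\<close>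

definition reg_x ::
    "('a, 'z) bigraded_algebra_scheme \<Rightarrow> ('a, 'b, 'y) bigraded_module_scheme \<Rightarrow> ereal" where
  "reg_x A M = (SUP a \<in> {a :: int. \<exists>(i :: nat) (b :: int). betti A M i (a + int i, b) \<noteq> 0}.
                 ereal (of_int a))"

definition reg_y ::
    "('a, 'z) bigraded_algebra_scheme \<Rightarrow> ('a, 'b, 'y) bigraded_module_scheme \<Rightarrow> ereal" where
  "reg_y A M = (SUP b \<in> {b :: int. \<exists>(i :: nat) (a :: int). betti A M i (a, b + int i) \<noteq> 0}.
                 ereal (of_int b))"


section \<open>The bigraded polynomial ring, its quotients, and Veronese algebras\<close>

text \<open>\<open>Inl i\<close> stands for the variable \<open>x\<^sub>i\<^sub>+\<^sub>1\<close>, and \<open>Inr j\<close> for the variable \<open>y\<^sub>j\<^sub>+\<^sub>1\<close>.\<close>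

type_synonym monomial = "(nat + nat) \<Rightarrow>\<^sub>0 nat"
type_synonym 'k polynomial = "monomial \<Rightarrow>\<^sub>0 'k"

definition vars :: "nat \<Rightarrow> nat \<Rightarrow> (nat + nat) set" where
  "vars n m = Inl ` {..<n} \<union> Inr ` {..<m}"

definition bidegree :: "nat \<Rightarrow> nat \<Rightarrow> monomial \<Rightarrow> bideg" where
  "bidegree n m \<mu> = (int (\<Sum>i<n. Poly_Mapping.lookup \<mu> (Inl i)),
                     int (\<Sum>j<m. Poly_Mapping.lookup \<mu> (Inr j)))"

definition poly_carrier :: "nat \<Rightarrow> nat \<Rightarrow> 'k::field polynomial set" where
  "poly_carrier n m = {f. \<forall>\<mu>\<in>Poly_Mapping.keys f. Poly_Mapping.keys \<mu> \<subseteq> vars n m}"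

definition S_alg :: "nat \<Rightarrow> nat \<Rightarrow> 'k::field polynomial bigraded_algebra" where
  "S_alg n m =
     \<lparr>carrier = poly_carrier n m, monoid.mult = (*), one = 1, zero = 0, add = (+),
      acomp = (\<lambda>p. {f \<in> poly_carrier n m. \<forall>\<mu>\<in>Poly_Mapping.keys f. bidegree n m \<mu> = p})\<rparr>"

definition homogeneous_part :: "nat \<Rightarrow> nat \<Rightarrow> bideg \<Rightarrow> 'k::field polynomial \<Rightarrow> 'k polynomial" where
  "homogeneous_part n m p f = Poly_Mapping.mapp (\<lambda>\<mu> c. c when bidegree n m \<mu> = p) f"

definition bigraded_ideal :: "nat \<Rightarrow> nat \<Rightarrow> 'k::field polynomial set \<Rightarrow> bool" where
  "bigraded_ideal n m J \<longleftrightarrow>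
     ideal J (S_alg n m) \<and> (\<forall>f\<in>J. \<forall>p. homogeneous_part n m p f \<in> J)"

definition quotient_algebra ::
    "('a, 'z) bigraded_algebra_scheme \<Rightarrow> 'a set \<Rightarrow> 'a set bigraded_algebra" where
  "quotient_algebra A J =
     ring.extend (A Quot J) (bigraded_algebra.fields (\<lambda>p. (\<lambda>f. J +>\<^bsub>A\<^esub> f) ` acomp A p))"

text \<open>
  The components in negative bidegrees have to be put to zero explicitly, since for \<open>s = 0\<close> the
  set \<open>acomp R (a * s, b * t)\<close> does not depend on \<open>a\<close>.
\<close>

definition veronese :: "nat \<Rightarrow> nat \<Rightarrow> 'a bigraded_algebra \<Rightarrow> 'a bigraded_algebra" where
  "veronese s t R =
     R\<lparr>acomp := (\<lambda>(a, b). if 0 \<le> a \<and> 0 \<le> b then acomp R (a * int s, b * int t) else {\<zero>\<^bsub>R\<^esub>})\<rparr>"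

end

theory Submission
  imports Defs "HOL-Library.Function_Algebras" "HOL-Library.Countable_Set"
begin

text \<open>
  Write \<open>A\<close> for the Veronese ring \<open>S\<^sub>\<Delta>\<close>.  Let \<open>F\<close> be the minimal free resolution of \<open>R\<close> over \<open>S\<close>.
  Taking the Veronese subfamily is exact, so \<open>F\<^sub>\<Delta>\<close> is an exact complex of \<open>A\<close>-modules over \<open>R\<^sub>\<Delta>\<close>;
  its \<open>l\<close>-th module is a direct sum of modules \<open>S(-c)\<^sub>\<Delta>\<close>, one for each basis element of \<open>F\<^sub>l\<close> of
  bidegree \<open>c\<close>.  Cutting the complex into short exact sequences shows that \<open>Tor\<^sub>i(R\<^sub>\<Delta>)\<close> vanishes in
  a bidegree as soon as \<open>Tor\<^sub>i\<^sub>-\<^sub>l\<close> of the \<open>l\<close>-th module vanishes there for all \<open>l \<le> i\<close>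
  (\<open>tor_vanishes_veronese\<close>).  By minimality, a basis element of \<open>F\<^sub>l\<close> of bidegree \<open>c\<close> makes the Betti
  number \<open>\<beta>\<^sub>l\<^sub>,\<^sub>c(R)\<close> nonzero.  Hence everything follows from the bound
  \<open>reg\<^sub>x(S(-c)\<^sub>\<Delta>) \<le> \<lceil>c\<^sub>1 / s\<rceil>\<close> and its analogue for \<open>y\<close> (\<open>vtor_excess\<close>).

  That bound comes from short exact sequences of monomial modules.  For a set \<open>U\<close> of variables put
  \<open>Q\<^sub>U = S/(U)\<close>.  Multiplication by a variable \<open>v\<close> outside \<open>U\<close> gives
  \<open>0 \<rightarrow> Q\<^sub>U(-c - deg v) \<rightarrow> Q\<^sub>U(-c) \<rightarrow> Q\<^sub>U\<^sub>\<union>\<^sub>{\<^sub>v\<^sub>}(-c) \<rightarrow> 0\<close>, and this stays exact after passing to \<open>\<Delta>\<close>.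
  If \<open>s > 0\<close> does not divide \<open>c\<^sub>1\<close>, killing all the \<open>x\<^sub>i\<close> makes the Veronese module zero, so \<open>S(-c)\<^sub>\<Delta>\<close> is
  controlled by modules with \<open>c\<^sub>1\<close> replaced by \<open>c\<^sub>1 + 1\<close>, for which \<open>\<lceil>c\<^sub>1 / s\<rceil>\<close> is the same; the
  process stops when \<open>c\<close> lies in the lattice generated by \<open>(s, 0)\<close> and \<open>(0, t)\<close>, where \<open>S(-c)\<^sub>\<Delta>\<close> is free
  over \<open>A\<close>.  (For \<open>s = 0 < c\<^sub>1\<close> the module \<open>S(-c)\<^sub>\<Delta>\<close> is zero.)  The modules \<open>Q\<^sub>U\<close> with \<open>U\<close> nonempty are handled by the same sequences and induction on
  the homological degree.

  Tor is treated by balancing.  Fix a free resolution \<open>P\<close> of \<open>K\<close> over \<open>A\<close>.  Then \<open>Tor\<^sub>i(M, K)\<close> is the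
  homology of \<open>P \<otimes> M\<close>, which is exact in \<open>M\<close> and commutes with direct sums; the long exact sequence is
  an elementary diagram chase.  Dimension shifting along an arbitrary free resolution of \<open>M\<close>
  (\<open>tor_vanishes_iff_tor_zero_via\<close>) shows that the vanishing of \<open>Tor\<^sub>i(M, K)\<close> in a given bidegree can be
  read off from any resolution, in particular from the one chosen in the definition of the Betti
  numbers.  All modules that occur are subquotients \<open>L/N\<close> of modules with operations from a type
  class, so that quotients never have to be formed.
\<close>

(* Bidegrees are pairs; quantifiers over them are more useful unsplit. *)
declare split_paired_All [simp del] split_paired_Ex [simp del]

section \<open>Matrices with finitely supported columns\<close>

text \<open>
  The matrix with columns \<open>D j\<close> over a ring, applied to a vector with entries in a module with scalar
  multiplication \<open>sm\<close>.  With ring entries this is a map of free modules, with entries in \<open>M\<close> it is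
  the induced map after tensoring with \<open>M\<close>.  Summing over the support makes the map independent of
  the bidegree in which the vector is considered.
\<close>

definition mat_apply :: "('a \<Rightarrow> 'b \<Rightarrow> 'b) \<Rightarrow> (nat \<Rightarrow> nat \<Rightarrow> 'a) \<Rightarrow> (nat \<Rightarrow> 'b) \<Rightarrow> nat \<Rightarrow> 'b::ab_group_add" where
  "mat_apply sm D f = (\<lambda>k. \<Sum>j | f j \<noteq> 0. sm (D j k) (f j))"

definition pointwise :: "('a \<Rightarrow> 'b \<Rightarrow> 'b) \<Rightarrow> 'a \<Rightarrow> (nat \<Rightarrow> 'b) \<Rightarrow> nat \<Rightarrow> 'b" where
  "pointwise sm a f = (\<lambda>k. sm a (f k))"

lemma module_mult: "Modules.module ((*) :: 'a::comm_ring_1 \<Rightarrow> 'a \<Rightarrow> 'a)"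
  by standard (simp_all add: algebra_simps)

lemma module_pointwise:
  assumes "Modules.module sm"
  shows "Modules.module (pointwise sm)"
proof -
  interpret Modules.module sm by fact
  show ?thesis
    by standard (simp_all add: pointwise_def fun_eq_iff scale_right_distrib scale_left_distrib)
qed

lemma mat_apply_eq_sum:
  assumes "Modules.module sm" "finite T" "{j. f j \<noteq> 0} \<subseteq> T"
  shows "mat_apply sm D f k = (\<Sum>j\<in>T. sm (D j k) (f j))"
proof -
  interpret Modules.module sm by fact
  show ?thesis unfolding mat_apply_def
    by (rule sum.mono_neutral_left) (use assms in auto)
qed

lemma mat_apply_zero [simp]: "mat_apply sm D 0 = 0" "mat_apply sm D (\<lambda>_. 0) = 0"
  by (simp_all add: mat_apply_def fun_eq_iff)

lemma mat_apply_add: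
  assumes "Modules.module sm" "finite {j. f j \<noteq> 0}" "finite {j. g j \<noteq> 0}"
  shows "mat_apply sm D (f + g) = mat_apply sm D f + mat_apply sm D g"
proof
  fix k
  interpret Modules.module sm by fact
  let ?T = "{j. f j \<noteq> 0} \<union> {j. g j \<noteq> 0}"
  have "{j. (f + g) j \<noteq> 0} \<subseteq> ?T" by auto
  then show "mat_apply sm D (f + g) k = (mat_apply sm D f + mat_apply sm D g) k"
    using assms by (simp add: mat_apply_eq_sum[where T = ?T] scale_right_distrib sum.distrib)
qed

lemma mat_apply_diff:
  assumes "Modules.module sm" "finite {j. f j \<noteq> 0}" "finite {j. g j \<noteq> 0}"
  shows "mat_apply sm D (f - g) = mat_apply sm D f - mat_apply sm D g"
proof
  fix k
  interpret Modules.module sm by fact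
  let ?T = "{j. f j \<noteq> 0} \<union> {j. g j \<noteq> 0}"
  have "{j. (f - g) j \<noteq> 0} \<subseteq> ?T" by auto
  then show "mat_apply sm D (f - g) k = (mat_apply sm D f - mat_apply sm D g) k"
    using assms by (simp add: mat_apply_eq_sum[where T = ?T] scale_right_diff_distrib sum_subtractf)
qed

lemma mat_apply_scale:
  assumes "Modules.module sm" "finite {j. f j \<noteq> 0}"
  shows "mat_apply sm D (pointwise sm a f) = pointwise sm a (mat_apply sm D f)"
proof
  fix k
  interpret Modules.module sm by fact
  let ?T = "{j. f j \<noteq> 0}"
  have "{j. (pointwise sm a f) j \<noteq> 0} \<subseteq> ?T" by (auto simp: pointwise_def)
  then show "mat_apply sm D (pointwise sm a f) k = (pointwise sm a (mat_apply sm D f)) k"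
    using assms
    by (simp add: mat_apply_eq_sum[where T = ?T] pointwise_def scale_sum_right mult.commute)
qed

lemma finite_mat_apply:
  assumes "Modules.module sm" "finite {j. f j \<noteq> 0}" "\<And>j. f j \<noteq> 0 \<Longrightarrow> finite {k. D j k \<noteq> 0}"
  shows "finite {k. mat_apply sm D f k \<noteq> 0}"
proof -
  interpret Modules.module sm by fact
  have "{k. mat_apply sm D f k \<noteq> 0} \<subseteq> (\<Union>j\<in>{j. f j \<noteq> 0}. {k. D j k \<noteq> 0})"
  proof
    fix k assume "k \<in> {k. mat_apply sm D f k \<noteq> 0}"
    then obtain j where "f j \<noteq> 0" "sm (D j k) (f j) \<noteq> 0"
      unfolding mat_apply_def by (auto elim: sum.not_neutral_contains_not_neutral)
    then show "k \<in> (\<Union>j\<in>{j. f j \<noteq> 0}. {k. D j k \<noteq> 0})" by auto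
  qed
  then show ?thesis using assms by (auto intro: finite_subset)
qed

lemma mat_apply_mat_apply:
  assumes "Modules.module sm" "finite {j. f j \<noteq> 0}" "\<And>j. f j \<noteq> 0 \<Longrightarrow> finite {k. E j k \<noteq> 0}"
  shows "mat_apply sm D (mat_apply sm E f) = mat_apply sm (\<lambda>j. mat_apply (*) D (E j)) f"
proof
  fix k
  interpret Modules.module sm by fact
  let ?F = "{j. f j \<noteq> 0}"
  let ?T = "\<Union>j\<in>?F. {k. E j k \<noteq> 0}"
  have T: "finite ?T" using assms by auto
  have sub: "{k. mat_apply sm E f k \<noteq> 0} \<subseteq> ?T"
  proof
    fix k assume "k \<in> {k. mat_apply sm E f k \<noteq> 0}"
    then obtain j where "f j \<noteq> 0" "sm (E j k) (f j) \<noteq> 0"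
      unfolding mat_apply_def by (auto elim: sum.not_neutral_contains_not_neutral)
    then show "k \<in> ?T" by auto
  qed
  have "mat_apply sm D (mat_apply sm E f) k = (\<Sum>l\<in>?T. sm (D l k) (\<Sum>j\<in>?F. sm (E j l) (f j)))"
    by (subst mat_apply_eq_sum[OF assms(1) T sub]) (simp add: mat_apply_def)
  also have "\<dots> = (\<Sum>j\<in>?F. \<Sum>l\<in>?T. sm (D l k * E j l) (f j))"
    by (simp add: scale_sum_right sum.swap[of _ ?F])
  also have "\<dots> = (\<Sum>j\<in>?F. sm (mat_apply (*) D (E j) k) (f j))"
  proof (rule sum.cong[OF refl])
    fix j assume j: "j \<in> ?F"
    have "mat_apply (*) D (E j) k = (\<Sum>l\<in>?T. D l k * E j l)"
      by (rule mat_apply_eq_sum[OF module_mult T]) (use j in auto)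
    then show "(\<Sum>l\<in>?T. sm (D l k * E j l) (f j)) = sm (mat_apply (*) D (E j) k) (f j)"
      by (simp add: scale_sum_left)
  qed
  finally show "mat_apply sm D (mat_apply sm E f) k = mat_apply sm (\<lambda>j. mat_apply (*) D (E j)) f k"
    by (simp add: mat_apply_def)
qed

text \<open>
  A matrix with a single row \<open>r\<close>, encoded by constant columns; the single entry of the result is read off
  at \<open>0\<close>.
\<close>

abbreviation aug :: "(nat \<Rightarrow> 'a::comm_ring_1) \<Rightarrow> (nat \<Rightarrow> 'a) \<Rightarrow> 'a" where
  "aug r x \<equiv> mat_apply (*) (\<lambda>j _. r j) x 0"

lemma sum_fun_apply: "(\<Sum>j\<in>T. f j) k = (\<Sum>j\<in>T. f j k)" for f :: "'c \<Rightarrow> nat \<Rightarrow> 'd::ab_group_add"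
  by (induct T rule: infinite_finite_induct) auto

lemma mat_apply_pointwise: "mat_apply (pointwise sm) D f k = (\<lambda>l. (\<Sum>j | f j \<noteq> 0. sm (D j k) (f j l)))"
  by (rule ext) (simp add: mat_apply_def sum_fun_apply pointwise_def)

lemma mat_apply_pointwise_component:
  assumes "Modules.module sm" "finite {j. f j \<noteq> 0}"
  shows "mat_apply (pointwise sm) D f k l = mat_apply sm D (\<lambda>j. f j l) k"
proof -
  have "{j. f j l \<noteq> 0} \<subseteq> {j. f j \<noteq> 0}" by auto
  from mat_apply_eq_sum[OF assms(1,2) this]
  show ?thesis by (simp add: mat_apply_pointwise)
qed

section \<open>Graded families and direct sums\<close>

text \<open>
  In the direct sum of the families \<open>L j\<close>, \<open>j \<in> B\<close>, vectors are indexed by all natural numbers and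
  vanish outside \<open>B\<close>.
\<close>

definition dirsum :: "nat set \<Rightarrow> (nat \<Rightarrow> bideg \<Rightarrow> 'b::zero set) \<Rightarrow> bideg \<Rightarrow> (nat \<Rightarrow> 'b) set" where
  "dirsum B L p = {f. finite {j. f j \<noteq> 0} \<and> (\<forall>j. j \<notin> B \<longrightarrow> f j = 0) \<and> (\<forall>j\<in>B. f j \<in> L j p)}"

text \<open>
  The direct sum of the shifted families \<open>L(- \<delta> j)\<close>.  For a ring family this is the free module with basis
  elements of bidegree \<open>\<delta> j\<close>; for a module family it is the tensor product with that free module.
\<close>

definition shift_sum :: "nat set \<Rightarrow> (nat \<Rightarrow> bideg) \<Rightarrow> (bideg \<Rightarrow> 'b::zero set) \<Rightarrow> bideg \<Rightarrow> (nat \<Rightarrow> 'b) set" where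
  "shift_sum B \<delta> L = dirsum B (\<lambda>j p. L (p - \<delta> j))"

lemma shift_sumI:
  "finite {j. f j \<noteq> 0} \<Longrightarrow> (\<And>j. j \<notin> B \<Longrightarrow> f j = 0) \<Longrightarrow> (\<And>j. j \<in> B \<Longrightarrow> f j \<in> L (p - \<delta> j)) \<Longrightarrow> f \<in> shift_sum B \<delta> L p"
  by (simp add: shift_sum_def dirsum_def)

lemma shift_sumD:
  assumes "f \<in> shift_sum B \<delta> L p"
  shows "finite {j. f j \<noteq> 0}" "j \<notin> B \<Longrightarrow> f j = 0" "j \<in> B \<Longrightarrow> f j \<in> L (p - \<delta> j)"
    "f j \<noteq> 0 \<Longrightarrow> j \<in> B"
  using assms by (auto simp: shift_sum_def dirsum_def)

lemma dirsumD:
  assumes "f \<in> dirsum B L p"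
  shows "finite {j. f j \<noteq> 0}" "j \<notin> B \<Longrightarrow> f j = 0" "j \<in> B \<Longrightarrow> f j \<in> L j p"
    "f j \<noteq> 0 \<Longrightarrow> j \<in> B"
  using assms by (auto simp: dirsum_def)

text \<open>
  The components may overlap, as they do in a Veronese algebra with \<open>s = 0\<close>, so an element has a
  bidegree only as a member of a chosen component.  Vanishing in negative bidegrees is what makes
  arguments in the style of Nakayama possible.
\<close>

locale graded_ring =
  fixes A :: "bideg \<Rightarrow> 'a::comm_ring_1 set"
  assumes A_zero: "0 \<in> A p"
    and A_diff: "x \<in> A p \<Longrightarrow> y \<in> A p \<Longrightarrow> x - y \<in> A p"
    and A_one: "1 \<in> A 0"
    and A_mult: "x \<in> A p \<Longrightarrow> y \<in> A q \<Longrightarrow> x * y \<in> A (p + q)"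
    and A_neg: "\<not> (0 \<le> fst p \<and> 0 \<le> snd p) \<Longrightarrow> A p = {0}"
begin

definition graded_module :: "('a \<Rightarrow> 'b \<Rightarrow> 'b) \<Rightarrow> (bideg \<Rightarrow> 'b::ab_group_add set) \<Rightarrow> bool" where
  "graded_module sm L \<longleftrightarrow> Modules.module sm \<and> (\<forall>p. 0 \<in> L p) \<and> (\<forall>p. \<forall>x\<in>L p. \<forall>y\<in>L p. x - y \<in> L p) \<and>
     (\<forall>p q. \<forall>a\<in>A p. \<forall>x\<in>L q. sm a x \<in> L (p + q))"

lemma graded_moduleD:
  assumes "graded_module sm L"
  shows "Modules.module sm" "0 \<in> L p" "x \<in> L p \<Longrightarrow> y \<in> L p \<Longrightarrow> x - y \<in> L p"
    "a \<in> A q \<Longrightarrow> x \<in> L p \<Longrightarrow> sm a x \<in> L (q + p)"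
  using assms by (auto simp: graded_module_def)

lemma graded_module_scale:
  assumes "graded_module sm L" "a \<in> A q" "x \<in> L p" "r = q + p"
  shows "sm a x \<in> L r"
  using assms by (auto simp: graded_module_def)

lemma graded_module_add:
  assumes "graded_module sm L" "x \<in> L p" "y \<in> L p"
  shows "x + y \<in> L p"
proof -
  have "x - (0 - y) \<in> L p" using assms by (intro graded_moduleD(3)[OF assms(1)]) (auto intro: graded_moduleD)
  then show ?thesis by simp
qed

lemma graded_module_sum:
  assumes "graded_module sm L" "\<And>j. j \<in> T \<Longrightarrow> f j \<in> L p"
  shows "sum f T \<in> L p"
  using assms(2)
  by (induct T rule: infinite_finite_induct) (auto intro: graded_moduleD[OF assms(1)] graded_module_add[OF assms(1)])

lemma graded_module_A: "graded_module (*) A"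
  by (simp add: graded_module_def module_mult A_zero A_diff A_mult)

lemma graded_module_A_shift: "graded_module (*) (\<lambda>p. A (p - e))"
proof -
  have "a * x \<in> A (p + q - e)" if "a \<in> A p" "x \<in> A (q - e)" for a x p q
    using A_mult[OF that] by (simp add: algebra_simps)
  then show ?thesis
    by (auto simp: graded_module_def module_mult A_zero A_diff)
qed

lemma graded_module_zero: "Modules.module sm \<Longrightarrow> graded_module sm (\<lambda>_. {0})"
proof -
  assume "Modules.module sm"
  then interpret Modules.module sm .
  show ?thesis unfolding graded_module_def by (auto intro: module_axioms)
qed

lemma graded_module_dirsum:
  assumes "\<And>j. j \<in> B \<Longrightarrow> graded_module sm (L j)" and m: "Modules.module sm"
  shows "graded_module (pointwise sm) (dirsum B L)"
proof -
  interpret Modules.module sm by fact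
  have 1: "0 \<in> dirsum B L p" for p
    using assms by (auto simp: dirsum_def graded_module_def)
  have 2: "x - y \<in> dirsum B L p" if "x \<in> dirsum B L p" "y \<in> dirsum B L p" for x y p
  proof -
    have "{j. (x - y) j \<noteq> 0} \<subseteq> {j. x j \<noteq> 0} \<union> {j. y j \<noteq> 0}" by auto
    then show ?thesis using that assms by (auto simp: dirsum_def graded_module_def intro: finite_subset)
  qed
  have 3: "pointwise sm a x \<in> dirsum B L (p + q)" if "a \<in> A p" "x \<in> dirsum B L q" for a x p q
  proof -
    have "{j. pointwise sm a x j \<noteq> 0} \<subseteq> {j. x j \<noteq> 0}" by (auto simp: pointwise_def)
    then show ?thesis using that assms by (auto simp: dirsum_def graded_module_def pointwise_def intro: finite_subset)
  qed
  show ?thesis unfolding graded_module_def using 1 2 3 module_pointwise[OF m] by auto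
qed

lemma graded_module_shift_sum:
  assumes "graded_module sm L"
  shows "graded_module (pointwise sm) (shift_sum B \<delta> L)"
  unfolding shift_sum_def
proof (rule graded_module_dirsum)
  show "graded_module sm (\<lambda>p. L (p - \<delta> j))" for j
  proof -
    have "sm a x \<in> L (p + q - \<delta> j)" if "a \<in> A p" "x \<in> L (q - \<delta> j)" for a x p q
      by (rule graded_module_scale[OF assms that]) (simp add: algebra_simps)
    then show ?thesis using assms by (auto simp: graded_module_def)
  qed
qed (rule graded_moduleD(1)[OF assms])

lemma shift_sum_diff:
  assumes "graded_module sm L" "x \<in> shift_sum B \<delta> L p" "y \<in> shift_sum B \<delta> L p"
  shows "x - y \<in> shift_sum B \<delta> L p"
  by (rule graded_moduleD(3)[OF graded_module_shift_sum[OF assms(1)] assms(2,3)])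

lemma shift_sum_add:
  assumes "graded_module sm L" "x \<in> shift_sum B \<delta> L p" "y \<in> shift_sum B \<delta> L p"
  shows "x + y \<in> shift_sum B \<delta> L p"
  by (rule graded_module_add[OF graded_module_shift_sum[OF assms(1)] assms(2,3)])

lemma shift_sum_mono: "(\<And>p. N p \<subseteq> L p) \<Longrightarrow> x \<in> shift_sum B \<delta> N p \<Longrightarrow> x \<in> shift_sum B \<delta> L p"
  unfolding shift_sum_def dirsum_def by blast

definition columns :: "nat set \<Rightarrow> (nat \<Rightarrow> bideg) \<Rightarrow> nat set \<Rightarrow> (nat \<Rightarrow> bideg) \<Rightarrow> (nat \<Rightarrow> nat \<Rightarrow> 'a) \<Rightarrow> bool" where
  "columns B' \<delta>' B \<delta> D \<longleftrightarrow> (\<forall>j\<in>B'. D j \<in> shift_sum B \<delta> A (\<delta>' j))"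

lemma mat_apply_mem:
  assumes c: "columns B' \<delta>' B \<delta> D" and L: "graded_module sm L" and f: "f \<in> shift_sum B' \<delta>' L p"
  shows "mat_apply sm D f \<in> shift_sum B \<delta> L p"
proof (rule shift_sumI)
  interpret Modules.module sm by (rule graded_moduleD(1)[OF L])
  have D: "D j \<in> shift_sum B \<delta> A (\<delta>' j)" if "f j \<noteq> 0" for j
    using c shift_sumD(4)[OF f that] by (auto simp: columns_def)
  show "finite {k. mat_apply sm D f k \<noteq> 0}"
    by (rule finite_mat_apply[OF module_axioms shift_sumD(1)[OF f]]) (rule shift_sumD(1)[OF D])
  show "mat_apply sm D f k = 0" if "k \<notin> B" for k
    unfolding mat_apply_def by (rule sum.neutral) (use shift_sumD(2)[OF D that] in auto)
  show "mat_apply sm D f k \<in> L (p - \<delta> k)" if "k \<in> B" for k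
    unfolding mat_apply_def
  proof (rule graded_module_sum[OF L])
    fix j assume "j \<in> {j. f j \<noteq> 0}"
    then have j: "f j \<noteq> 0" by simp
    show "sm (D j k) (f j) \<in> L (p - \<delta> k)"
      by (rule graded_module_scale[OF L shift_sumD(3)[OF D[OF j] that] shift_sumD(3)[OF f shift_sumD(4)[OF f j]]]) simp
  qed
qed

definition unit_vec :: "nat \<Rightarrow> nat \<Rightarrow> 'a" where
  "unit_vec j = (\<lambda>k. if k = j then 1 else 0)"

lemma unit_vec_mem: "j \<in> B \<Longrightarrow> unit_vec j \<in> shift_sum B \<delta> A (\<delta> j)"
proof (rule shift_sumI)
  show "finite {k. unit_vec j k \<noteq> 0}"
    by (rule finite_subset[of _ "{j}"]) (auto simp: unit_vec_def split: if_splits)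
qed (auto simp: unit_vec_def A_zero A_one)

lemma mat_apply_unit_vec [simp]: "mat_apply (*) D (unit_vec j) = D j"
proof -
  have "{k. unit_vec j k \<noteq> 0} \<subseteq> {j}" by (auto simp: unit_vec_def split: if_splits)
  from mat_apply_eq_sum[OF module_mult _ this] show ?thesis
    by (auto simp: fun_eq_iff unit_vec_def)
qed

text \<open>
  One map serves for all bidegrees, although in general a homogeneous map is a family: all maps that
  are needed are given by matrices.
\<close>

definition graded_hom :: "('a \<Rightarrow> 'b \<Rightarrow> 'b) \<Rightarrow> ('a \<Rightarrow> 'c \<Rightarrow> 'c) \<Rightarrow> (bideg \<Rightarrow> 'b::ab_group_add set) \<Rightarrow>
    (bideg \<Rightarrow> 'c::ab_group_add set) \<Rightarrow> ('b \<Rightarrow> 'c) \<Rightarrow> bool" where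
  "graded_hom sm1 sm2 L M \<phi> \<longleftrightarrow> (\<forall>p. \<forall>x\<in>L p. \<phi> x \<in> M p) \<and> (\<forall>p. \<forall>x\<in>L p. \<forall>y\<in>L p. \<phi> (x + y) = \<phi> x + \<phi> y) \<and>
     (\<forall>p q. \<forall>a\<in>A p. \<forall>x\<in>L q. \<phi> (sm1 a x) = sm2 a (\<phi> x))"

lemma graded_homD:
  assumes "graded_hom sm1 sm2 L M \<phi>"
  shows "x \<in> L p \<Longrightarrow> \<phi> x \<in> M p" "x \<in> L p \<Longrightarrow> y \<in> L p \<Longrightarrow> \<phi> (x + y) = \<phi> x + \<phi> y"
    "a \<in> A q \<Longrightarrow> x \<in> L p \<Longrightarrow> \<phi> (sm1 a x) = sm2 a (\<phi> x)"
  using assms by (auto simp: graded_hom_def)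

lemma graded_hom_zero:
  assumes "graded_hom sm1 sm2 L M \<phi>" "graded_module sm1 L"
  shows "\<phi> 0 = 0"
  using graded_homD(2)[OF assms(1) graded_moduleD(2)[OF assms(2)] graded_moduleD(2)[OF assms(2)]] by simp

lemma graded_hom_diff:
  assumes h: "graded_hom sm1 sm2 L M \<phi>" and L: "graded_module sm1 L" and "x \<in> L p" "y \<in> L p"
  shows "\<phi> (x - y) = \<phi> x - \<phi> y"
  using graded_homD(2)[OF h graded_moduleD(3)[OF L assms(3,4)] assms(4)] by simp

lemma graded_hom_sum:
  assumes h: "graded_hom sm1 sm2 L M \<phi>" and L: "graded_module sm1 L" and "\<And>j. j \<in> T \<Longrightarrow> f j \<in> L p"
  shows "\<phi> (sum f T) = (\<Sum>j\<in>T. \<phi> (f j))"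
  using assms(3)
proof (induct T rule: infinite_finite_induct)
  case (insert a T)
  then show ?case
    by (simp, subst graded_homD(2)[OF h]) (auto intro: graded_module_sum[OF L])
qed (auto simp: graded_hom_zero[OF h L])

text \<open>
  Naturality of \<open>P \<otimes> M\<close> in \<open>M\<close>: the map is linear over the entries of the matrix.
\<close>

lemma graded_hom_mat_apply:
  assumes c: "columns B' \<delta>' B \<delta> D" and h: "graded_hom sm1 sm2 L M \<phi>" and L: "graded_module sm1 L" and M: "graded_module sm2 M"
    and f: "f \<in> shift_sum B' \<delta>' L p"
  shows "mat_apply sm2 D (\<lambda>j. \<phi> (f j)) k = \<phi> (mat_apply sm1 D f k)"
proof -
  interpret L: Modules.module sm1 by (rule graded_moduleD(1)[OF L])
  have D: "D j \<in> shift_sum B \<delta> A (\<delta>' j)" if "f j \<noteq> 0" for j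
    using c shift_sumD(4)[OF f that] by (auto simp: columns_def)
  have fin: "finite {j. f j \<noteq> 0}" by (rule shift_sumD(1)[OF f])
  have sub: "{j. \<phi> (f j) \<noteq> 0} \<subseteq> {j. f j \<noteq> 0}" using graded_hom_zero[OF h L] by auto
  have fj: "f j \<in> L (p - \<delta>' j)" if "f j \<noteq> 0" for j
    using shift_sumD(3)[OF f shift_sumD(4)[OF f that]] .
  show ?thesis
  proof (cases "k \<in> B")
    case True
    have Dk: "D j k \<in> A (\<delta>' j - \<delta> k)" if "f j \<noteq> 0" for j
      using shift_sumD(3)[OF D[OF that] True] .
    have "\<phi> (mat_apply sm1 D f k) = (\<Sum>j | f j \<noteq> 0. \<phi> (sm1 (D j k) (f j)))"
      unfolding mat_apply_def
      by (rule graded_hom_sum[OF h L, where p = "p - \<delta> k"])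
         (auto intro: graded_module_scale[OF L Dk fj])
    also have "\<dots> = (\<Sum>j | f j \<noteq> 0. sm2 (D j k) (\<phi> (f j)))"
      by (rule sum.cong) (auto intro: graded_homD(3)[OF h Dk fj])
    also have "\<dots> = mat_apply sm2 D (\<lambda>j. \<phi> (f j)) k"
      by (rule mat_apply_eq_sum[OF graded_moduleD(1)[OF M] fin sub, symmetric])
    finally show ?thesis by simp
  next
    case False
    have "mat_apply sm1 D f \<in> shift_sum B \<delta> L p" by (rule mat_apply_mem[OF c L f])
    then have 1: "mat_apply sm1 D f k = 0" using shift_sumD(2) False by fast
    have "(\<lambda>j. \<phi> (f j)) \<in> shift_sum B' \<delta>' M p"
      using sub by (auto intro!: shift_sumI graded_homD(1)[OF h] finite_subset[OF sub fin]
          simp: shift_sumD[OF f] graded_hom_zero[OF h L])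
    then have "mat_apply sm2 D (\<lambda>j. \<phi> (f j)) \<in> shift_sum B \<delta> M p" by (rule mat_apply_mem[OF c M])
    then have "mat_apply sm2 D (\<lambda>j. \<phi> (f j)) k = 0" using shift_sumD(2) False by fast
    with 1 show ?thesis by (simp add: graded_hom_zero[OF h L])
  qed
qed

lemma graded_hom_push:
  assumes h: "graded_hom sm1 sm2 L M \<phi>" and L: "graded_module sm1 L" and f: "f \<in> shift_sum B \<delta> L p"
  shows "(\<lambda>j. \<phi> (f j)) \<in> shift_sum B \<delta> M p"
proof -
  have sub: "{j. \<phi> (f j) \<noteq> 0} \<subseteq> {j. f j \<noteq> 0}" using graded_hom_zero[OF h L] by auto
  show ?thesis by (auto intro!: shift_sumI graded_homD(1)[OF h] finite_subset[OF sub shift_sumD(1)[OF f]]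
          simp: shift_sumD[OF f] graded_hom_zero[OF h L])
qed

lemma graded_hom_mat_apply_mult:
  assumes "columns B' \<delta>' B \<delta> D"
  shows "graded_hom (pointwise (*)) (pointwise (*)) (shift_sum B' \<delta>' A) (shift_sum B \<delta> A) (mat_apply (*) D)"
  unfolding graded_hom_def
  by (auto intro: mat_apply_mem[OF assms graded_module_A] mat_apply_add[OF module_mult] mat_apply_scale[OF module_mult] shift_sumD)

section \<open>Free resolutions\<close>

text \<open>
  A free resolution of \<open>A / I\<close>.  The augmentation is given by the row \<open>r\<close>, hence by representatives
  in \<open>A\<close>.
\<close>

definition resolution :: "(bideg \<Rightarrow> 'a set) \<Rightarrow> (nat \<Rightarrow> nat set) \<Rightarrow> (nat \<Rightarrow> nat \<Rightarrow> bideg) \<Rightarrow> (nat \<Rightarrow> 'a) \<Rightarrow>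
    (nat \<Rightarrow> nat \<Rightarrow> nat \<Rightarrow> 'a) \<Rightarrow> bool" where
  "resolution I B \<delta> r D \<longleftrightarrow>
     (\<forall>j\<in>B 0. r j \<in> A (\<delta> 0 j)) \<and>
     (\<forall>i. columns (B (Suc i)) (\<delta> (Suc i)) (B i) (\<delta> i) (D i)) \<and>
     (\<forall>p. \<forall>a\<in>A p. \<exists>x\<in>shift_sum (B 0) (\<delta> 0) A p. a - aug r x \<in> I p) \<and>
     (\<forall>p. mat_apply (*) (D 0) ` shift_sum (B 1) (\<delta> 1) A p
          = {x \<in> shift_sum (B 0) (\<delta> 0) A p. aug r x \<in> I p}) \<and>
     (\<forall>i p. mat_apply (*) (D (Suc i)) ` shift_sum (B (Suc (Suc i))) (\<delta> (Suc (Suc i))) A p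
          = {x \<in> shift_sum (B (Suc i)) (\<delta> (Suc i)) A p. mat_apply (*) (D i) x = 0})"

text \<open>
  The kernel in the free module \<open>F\<^sub>i\<close>, hence the \<open>(i + 1)\<close>-st syzygy module of \<open>A / I\<close>.
\<close>

definition syz :: "(bideg \<Rightarrow> 'a set) \<Rightarrow> (nat \<Rightarrow> nat set) \<Rightarrow> (nat \<Rightarrow> nat \<Rightarrow> bideg) \<Rightarrow> (nat \<Rightarrow> 'a) \<Rightarrow>
    (nat \<Rightarrow> nat \<Rightarrow> nat \<Rightarrow> 'a) \<Rightarrow> nat \<Rightarrow> bideg \<Rightarrow> (nat \<Rightarrow> 'a) set" where
  "syz I B \<delta> r D i p = (case i of
      0 \<Rightarrow> {x \<in> shift_sum (B 0) (\<delta> 0) A p. aug r x \<in> I p}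
    | Suc k \<Rightarrow> {x \<in> shift_sum (B (Suc k)) (\<delta> (Suc k)) A p. mat_apply (*) (D k) x = 0})"

lemma resolution_columns: "resolution I B \<delta> r D \<Longrightarrow> columns (B (Suc i)) (\<delta> (Suc i)) (B i) (\<delta> i) (D i)"
  by (auto simp: resolution_def)

lemma resolution_cover:
  "resolution I B \<delta> r D \<Longrightarrow> a \<in> A p \<Longrightarrow> \<exists>x\<in>shift_sum (B 0) (\<delta> 0) A p. a - aug r x \<in> I p"
  by (simp add: resolution_def)

lemma resolution_image:
  "resolution I B \<delta> r D \<Longrightarrow> mat_apply (*) (D i) ` shift_sum (B (Suc i)) (\<delta> (Suc i)) A p = syz I B \<delta> r D i p"
  by (cases i) (simp_all add: resolution_def syz_def)

text \<open>
  The row \<open>r\<close> is a matrix into the free module of rank one, which makes this a special case of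
  \<open>graded_hom_mat_apply_mult\<close>.
\<close>

lemma augmentation_hom:
  assumes "\<And>j. j \<in> B \<Longrightarrow> r j \<in> A (\<delta> j)"
  shows "graded_hom (pointwise (*)) (*) (shift_sum B \<delta> A) A (\<lambda>x. aug r x)"
proof -
  have "columns B \<delta> {0} (\<lambda>_. 0) (\<lambda>j k. if k = 0 then r j else 0)"
    using assms
    by (auto simp: columns_def A_zero intro!: shift_sumI finite_subset[of _ "{0}"] split: if_splits)
  from graded_hom_mat_apply_mult[OF this]
  have h: "graded_hom (pointwise (*)) (pointwise (*)) (shift_sum B \<delta> A) (shift_sum {0} (\<lambda>_. 0) A) (mat_apply (*) (\<lambda>j k. if k = 0 then r j else 0))" .
  have eq: "mat_apply (*) (\<lambda>j k. if k = 0 then r j else 0) x 0 = aug r x" for x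
    by (simp add: mat_apply_def)
  show ?thesis
    unfolding graded_hom_def eq[symmetric]
  proof (intro conjI allI ballI)
    fix p x assume "x \<in> shift_sum B \<delta> A p"
    from shift_sumD(3)[OF graded_homD(1)[OF h this], of 0]
    show "mat_apply (*) (\<lambda>j k. if k = 0 then r j else 0) x 0 \<in> A p" by simp
  next
    fix p x y assume "x \<in> shift_sum B \<delta> A p" "y \<in> shift_sum B \<delta> A p"
    from graded_homD(2)[OF h this]
    show "mat_apply (*) (\<lambda>j k. if k = 0 then r j else 0) (x + y) 0 = mat_apply (*) (\<lambda>j k. if k = 0 then r j else 0) x 0 + mat_apply (*) (\<lambda>j k. if k = 0 then r j else 0) y 0"
      by simp
  next
    fix p q a x assume "a \<in> A p" "x \<in> shift_sum B \<delta> A q"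
    from graded_homD(3)[OF h this]
    show "mat_apply (*) (\<lambda>j k. if k = 0 then r j else 0) (pointwise (*) a x) 0 = a * mat_apply (*) (\<lambda>j k. if k = 0 then r j else 0) x 0"
      by (simp add: pointwise_def)
  qed
qed

lemma graded_module_syz:
  assumes R: "resolution I B \<delta> r D" and I: "graded_module (*) I" "\<And>p. I p \<subseteq> A p"
  shows "graded_module (pointwise (*)) (syz I B \<delta> r D i)"
proof -
  have F: "graded_module (pointwise (*)) (shift_sum (B i) (\<delta> i) A)" by (rule graded_module_shift_sum[OF graded_module_A])
  have ker: "graded_module (pointwise (*)) (\<lambda>p. {x \<in> shift_sum (B i) (\<delta> i) A p. \<phi> x \<in> N p})"
    if h: "graded_hom (pointwise (*)) sm (shift_sum (B i) (\<delta> i) A) M \<phi>" and N: "graded_module sm N" for \<phi> sm M and N :: "bideg \<Rightarrow> 'c::ab_group_add set"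
    unfolding graded_module_def
    using graded_moduleD[OF F] graded_moduleD[OF N] graded_homD[OF h] graded_hom_diff[OF h F] graded_hom_zero[OF h F]
    by (auto)
  show ?thesis
  proof (cases i)
    case 0
    have "graded_hom (pointwise (*)) (*) (shift_sum (B 0) (\<delta> 0) A) A (\<lambda>x. aug r x)"
      by (rule augmentation_hom) (use R in \<open>auto simp: resolution_def\<close>)
    from ker[OF this[folded 0] I(1)] show ?thesis unfolding syz_def 0 by simp
  next
    case (Suc k)
    have "graded_hom (pointwise (*)) (pointwise (*)) (shift_sum (B (Suc k)) (\<delta> (Suc k)) A) (shift_sum (B k) (\<delta> k) A) (mat_apply (*) (D k))"
      by (rule graded_hom_mat_apply_mult[OF resolution_columns[OF R]])
    from ker[OF this[folded Suc] graded_module_zero[OF module_pointwise[OF module_mult]]] show ?thesis unfolding syz_def Suc by simp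
  qed
qed

lemma syz_subset: "syz I B \<delta> r D i p \<subseteq> shift_sum (B i) (\<delta> i) A p"
  by (cases i) (auto simp: syz_def)

end

definition at_zero :: "'b::zero \<Rightarrow> nat \<Rightarrow> 'b" where
  "at_zero x = (\<lambda>k. if k = 0 then x else 0)"

text \<open>
  Finitely many chains \<open>y k\<close> with coefficients in the summands \<open>L k\<close> form one chain with coefficients
  in the direct sum, after exchanging the two indices.
\<close>

lemma transpose_mem:
  assumes "finite T" "T \<subseteq> B" "\<And>k. k \<in> T \<Longrightarrow> y k \<in> shift_sum B' \<delta>' (L k) p"
    and "\<And>k q. k \<in> B \<Longrightarrow> 0 \<in> L k q"
  shows "(\<lambda>j k. if k \<in> T then y k j else 0) \<in> shift_sum B' \<delta>' (dirsum B L) p"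
proof (rule shift_sumI)
  have "{j. (\<lambda>k. if k \<in> T then y k j else 0) \<noteq> 0} \<subseteq> (\<Union>k\<in>T. {j. y k j \<noteq> 0})"
    by (auto simp: fun_eq_iff split: if_splits)
  then show "finite {j. (\<lambda>k. if k \<in> T then y k j else 0) \<noteq> 0}"
    by (rule finite_subset) (use assms(1) shift_sumD(1)[OF assms(3)] in auto)
next
  fix j assume "j \<notin> B'"
  then show "(\<lambda>k. if k \<in> T then y k j else 0) = 0"
    using shift_sumD(2)[OF assms(3)] by (auto simp: fun_eq_iff)
next
  fix j assume j: "j \<in> B'"
  have "finite {k. (if k \<in> T then y k j else 0) \<noteq> 0}"
    by (rule finite_subset[OF _ assms(1)]) (auto split: if_splits)
  then show "(\<lambda>k. if k \<in> T then y k j else 0) \<in> dirsum B L (p - \<delta>' j)"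
    using assms(2,4) shift_sumD(3)[OF assms(3) j] by (auto simp: dirsum_def)
qed

lemma component_mem:
  assumes f: "f \<in> shift_sum B' \<delta>' (dirsum B L) p" and k: "k \<in> B"
  shows "(\<lambda>j. f j k) \<in> shift_sum B' \<delta>' (L k) p"
proof (rule shift_sumI)
  show "finite {j. f j k \<noteq> 0}"
    by (rule finite_subset[OF _ shift_sumD(1)[OF f]]) auto
  show "f j k = 0" if "j \<notin> B'" for j using shift_sumD(2)[OF f that] by simp
  show "f j k \<in> L k (p - \<delta>' j)" if "j \<in> B'" for j
    using shift_sumD(3)[OF f that] k by (simp add: dirsum_def)
qed

context graded_ring
begin

lemma shift_sum_A_shift: "shift_sum B \<delta> (\<lambda>q. A (q - e)) p = shift_sum B \<delta> A (p - e)"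
  by (simp add: shift_sum_def dirsum_def diff_diff_eq add.commute)

text \<open>
  The component of \<open>A\<^sub>+ F\<close>: when \<open>A\<close> is positively graded, the coefficient of a basis element is
  automatically in \<open>A\<^sub>+\<close> unless the bidegrees agree.
\<close>

definition irr_part :: "nat set \<Rightarrow> (nat \<Rightarrow> bideg) \<Rightarrow> bideg \<Rightarrow> (nat \<Rightarrow> 'a) set" where
  "irr_part B \<delta> p = {z \<in> shift_sum B \<delta> A p. \<forall>j. \<delta> j = p \<longrightarrow> z j = 0}"

text \<open>
  Entrywise lifting along a map that is surjective modulo \<open>N\<close>.  Zero entries are lifted to zero, so
  the support stays finite.
\<close>

lemma shift_sum_lift:
  fixes N :: "bideg \<Rightarrow> 'b::ab_group_add set" and L :: "bideg \<Rightarrow> 'c::zero set"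
  assumes "\<And>q y. y \<in> M q \<Longrightarrow> \<exists>x\<in>L q. y - \<phi> x \<in> N q" and "\<phi> 0 = 0"
    and f: "f \<in> shift_sum B \<delta> M p" and z: "\<And>q. 0 \<in> L q" "\<And>q. 0 \<in> N q"
  shows "\<exists>g\<in>shift_sum B \<delta> L p. f - (\<lambda>j. \<phi> (g j)) \<in> shift_sum B \<delta> N p"
proof -
  define g where "g j = (if f j = 0 then 0 else SOME x. x \<in> L (p - \<delta> j) \<and> f j - \<phi> x \<in> N (p - \<delta> j))" for j
  have g: "g j \<in> L (p - \<delta> j) \<and> f j - \<phi> (g j) \<in> N (p - \<delta> j)" if "j \<in> B" for j
  proof (cases "f j = 0")
    case False
    have "\<exists>x. x \<in> L (p - \<delta> j) \<and> f j - \<phi> x \<in> N (p - \<delta> j)"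
      using assms(1)[OF shift_sumD(3)[OF f that]] by blast
    from someI_ex[OF this] show ?thesis using False by (simp add: g_def)
  qed (simp add: g_def z assms(2))
  have sub: "{j. g j \<noteq> 0} \<subseteq> {j. f j \<noteq> 0}" by (auto simp: g_def)
  have off: "g j = 0" if "j \<notin> B" for j using shift_sumD(2)[OF f that] by (simp add: g_def)
  have "g \<in> shift_sum B \<delta> L p"
    by (rule shift_sumI) (use g off finite_subset[OF sub shift_sumD(1)[OF f]] in auto)
  moreover have "f - (\<lambda>j. \<phi> (g j)) \<in> shift_sum B \<delta> N p"
  proof (rule shift_sumI)
    show "finite {j. (f - (\<lambda>j. \<phi> (g j))) j \<noteq> 0}"
      by (rule finite_subset[OF _ shift_sumD(1)[OF f]]) (auto simp: g_def assms(2))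
  qed (use g off shift_sumD(2)[OF f] assms(2) in auto)
  ultimately show ?thesis by blast
qed

end

section \<open>Tor by a resolution of the residue field\<close>

text \<open>
  The data \<open>Bp\<close>, \<open>\<delta>p\<close>, \<open>Dp\<close> are a free resolution \<open>P\<close> of \<open>K = A / A\<^sub>+\<close> with \<open>P\<^sub>0 = A\<close>.
\<close>

locale tor_ring = graded_ring A for A :: "bideg \<Rightarrow> 'a::comm_ring_1 set" +
  fixes Bp \<delta>p Dp
  assumes Pres: "resolution (\<lambda>p. if p = 0 then {0} else A p) Bp \<delta>p (\<lambda>_. 1) Dp"
    and Bp0: "Bp 0 = {0}" and \<delta>p0: "\<delta>p 0 0 = 0"
begin

abbreviation C where "C i \<equiv> shift_sum (Bp i) (\<delta>p i)"
abbreviation d where "d sm i \<equiv> mat_apply sm (Dp i)"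

text \<open>
  The vanishing of \<open>Tor\<^sub>i(L/N, K)\<close> in bidegree \<open>p\<close>, computed as homology of \<open>P \<otimes> (L/N)\<close>: chains with
  coefficients in \<open>L\<close> whose boundary has coefficients in \<open>N\<close> are boundaries modulo \<open>N\<close>.
\<close>

definition tor_vanishes :: "('a \<Rightarrow> 'b \<Rightarrow> 'b) \<Rightarrow> (bideg \<Rightarrow> 'b::ab_group_add set) \<Rightarrow> (bideg \<Rightarrow> 'b set) \<Rightarrow> nat \<Rightarrow> bideg \<Rightarrow> bool" where
  "tor_vanishes sm L N i p \<longleftrightarrow> (\<forall>x\<in>C i L p. (\<forall>k. i = Suc k \<longrightarrow> d sm k x \<in> C k N p) \<longrightarrow>
      (\<exists>y\<in>C (Suc i) L p. x - d sm i y \<in> C i N p))"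

lemma tor_vanishesD:
  assumes "tor_vanishes sm L N i p" "x \<in> C i L p" "\<And>k. i = Suc k \<Longrightarrow> d sm k x \<in> C k N p"
  obtains y where "y \<in> C (Suc i) L p" "x - d sm i y \<in> C i N p"
  using assms unfolding tor_vanishes_def by blast

lemma tor_vanishes_trivial:
  assumes "graded_module sm L" "\<And>q. L q \<subseteq> N q"
  shows "tor_vanishes sm L N i p"
  unfolding tor_vanishes_def
proof (intro ballI impI)
  fix x assume "x \<in> C i L p"
  then have "x - d sm i 0 \<in> C i N p" using shift_sum_mono[OF assms(2)] by simp
  moreover have "0 \<in> C (Suc i) L p" by (rule graded_moduleD(2)[OF graded_module_shift_sum[OF assms(1)]])
  ultimately show "\<exists>y\<in>C (Suc i) L p. x - d sm i y \<in> C i N p" by blast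
qed

lemma colsP: "columns (Bp (Suc i)) (\<delta>p (Suc i)) (Bp i) (\<delta>p i) (Dp i)"
  by (rule resolution_columns[OF Pres])

lemma d_mem: "graded_module sm L \<Longrightarrow> f \<in> C (Suc i) L p \<Longrightarrow> d sm i f \<in> C i L p"
  by (rule mat_apply_mem[OF colsP])

lemma d_diff: "graded_module sm L \<Longrightarrow> f \<in> C i L p \<Longrightarrow> g \<in> C i L p \<Longrightarrow> d sm k (f - g) = d sm k f - d sm k g"
  by (rule mat_apply_diff[OF graded_moduleD(1)]) (auto intro: shift_sumD)

lemma d_add: "graded_module sm L \<Longrightarrow> f \<in> C i L p \<Longrightarrow> g \<in> C i L p \<Longrightarrow> d sm k (f + g) = d sm k f + d sm k g"
  by (rule mat_apply_add[OF graded_moduleD(1)]) (auto intro: shift_sumD)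

lemma C_zero: "x \<in> C i (\<lambda>_. {0}) p \<longleftrightarrow> x = 0"
proof
  assume "x \<in> C i (\<lambda>_. {0}) p"
  from shift_sumD(2,3)[OF this] show "x = 0" by (auto simp: fun_eq_iff)
qed (auto intro: shift_sumI)

text \<open>
  The composite of two consecutive matrices vanishes because each column is the image of a basis
  vector, hence lies in the kernel of the next matrix.
\<close>

lemma dd:
  assumes "graded_module sm L" "f \<in> C (Suc (Suc i)) L p"
  shows "d sm i (d sm (Suc i) f) = 0"
proof -
  interpret Modules.module sm by (rule graded_moduleD(1)[OF assms(1)])
  have col: "Dp (Suc i) j \<in> C (Suc i) A (\<delta>p (Suc (Suc i)) j)" if "f j \<noteq> 0" for j
    using colsP shift_sumD(4)[OF assms(2) that] by (auto simp: columns_def)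
  have "mat_apply (*) (Dp i) (Dp (Suc i) j) = 0" if "f j \<noteq> 0" for j
  proof -
    have "mat_apply (*) (Dp (Suc i)) (unit_vec j) \<in> syz (\<lambda>p. if p = 0 then {0} else A p) Bp \<delta>p (\<lambda>_. 1) Dp (Suc i) (\<delta>p (Suc (Suc i)) j)"
      unfolding resolution_image[OF Pres, symmetric]
      by (rule imageI, rule unit_vec_mem, rule shift_sumD(4)[OF assms(2) that])
    then show ?thesis by (simp add: syz_def)
  qed
  moreover have "d sm i (d sm (Suc i) f) = mat_apply sm (\<lambda>j. mat_apply (*) (Dp i) (Dp (Suc i) j)) f"
    by (rule mat_apply_mat_apply[OF module_axioms shift_sumD(1)[OF assms(2)]]) (rule shift_sumD(1)[OF col])
  ultimately show ?thesis by (simp add: mat_apply_def fun_eq_iff)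
qed

lemma C0_iff: "x \<in> C 0 L p \<longleftrightarrow> x = at_zero (x 0) \<and> x 0 \<in> L p"
proof
  assume "x \<in> C 0 L p"
  from shift_sumD(2,3)[OF this] show "x = at_zero (x 0) \<and> x 0 \<in> L p"
    by (force simp: at_zero_def Bp0 \<delta>p0 fun_eq_iff)
next
  assume x: "x = at_zero (x 0) \<and> x 0 \<in> L p"
  have "finite {j. at_zero (x 0) j \<noteq> 0}"
    by (rule finite_subset[of _ "{0}"]) (auto simp: at_zero_def split: if_splits)
  with x have fin: "finite {j. x j \<noteq> 0}" by simp
  have off: "x j = 0" if "j \<noteq> 0" for j using x that by (metis at_zero_def)
  show "x \<in> C 0 L p"
    by (rule shift_sumI) (use x fin off in \<open>auto simp: Bp0 \<delta>p0\<close>)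
qed

lemma at_zero_mem: "at_zero x \<in> C 0 L p \<longleftrightarrow> x \<in> L p"
  by (subst C0_iff) (simp add: at_zero_def)

text \<open>
  Three pieces of the long exact Tor sequence of \<open>0 \<rightarrow> L/N \<rightarrow> M/N \<rightarrow> M/L \<rightarrow> 0\<close>, in the form of vanishing
  statements for the quotient, the middle term and the submodule.
\<close>

context
  fixes sm :: "'a \<Rightarrow> 'b \<Rightarrow> 'b::ab_group_add" and N L M
  assumes gm: "graded_module sm N" "graded_module sm L" "graded_module sm M" and NL: "\<And>p. N p \<subseteq> L p" and LM: "\<And>p. L p \<subseteq> M p"
begin

lemma tor_vanishes_quotient:
  assumes 1: "tor_vanishes sm M N i p" and 2: "\<And>k. i = Suc k \<Longrightarrow> tor_vanishes sm L N k p"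
  shows "tor_vanishes sm M L i p"
  unfolding tor_vanishes_def
proof (intro ballI impI)
  fix x assume x: "x \<in> C i M p" and dx: "\<forall>k. i = Suc k \<longrightarrow> d sm k x \<in> C k L p"
  have "\<exists>y\<in>C i L p. \<forall>k. i = Suc k \<longrightarrow> d sm k (x - y) \<in> C k N p"
  proof (cases i)
    case 0
    then show ?thesis by (intro bexI[of _ 0]) (auto intro: graded_moduleD(2)[OF graded_module_shift_sum[OF gm(2)]])
  next
    case (Suc k)
    have "d sm k' (d sm k x) \<in> C k' N p" if "k = Suc k'" for k'
      using dd[OF gm(3), of x k' p] x Suc that graded_moduleD(2)[OF graded_module_shift_sum[OF gm(1)]] by simp
    with tor_vanishesD[OF 2[OF Suc], of "d sm k x"] dx Suc obtain y where
      y: "y \<in> C (Suc k) L p" "d sm k x - d sm k y \<in> C k N p" by metis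
    have "d sm k (x - y) = d sm k x - d sm k y"
      by (rule d_diff[OF gm(3) x]) (use shift_sum_mono[OF LM y(1)] Suc in simp)
    with y Suc show ?thesis by (intro bexI[of _ y]) auto
  qed
  then obtain y where y: "y \<in> C i L p" "\<And>k. i = Suc k \<Longrightarrow> d sm k (x - y) \<in> C k N p" by blast
  have yM: "y \<in> C i M p" by (rule shift_sum_mono[OF LM y(1)])
  obtain z where z: "z \<in> C (Suc i) M p" "x - y - d sm i z \<in> C i N p"
    using tor_vanishesD[OF 1 shift_sum_diff[OF gm(3) x yM] y(2)] by blast
  then have "x - y - d sm i z + y \<in> C i L p"
    by (intro shift_sum_add[OF gm(2)] y(1) shift_sum_mono[OF NL])
  with z show "\<exists>y\<in>C (Suc i) M p. x - d sm i y \<in> C i L p" by auto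
qed

lemma tor_vanishes_middle:
  assumes 1: "tor_vanishes sm L N i p" and 2: "tor_vanishes sm M L i p"
  shows "tor_vanishes sm M N i p"
  unfolding tor_vanishes_def
proof (intro ballI impI)
  fix x assume x: "x \<in> C i M p" and dx: "\<forall>k. i = Suc k \<longrightarrow> d sm k x \<in> C k N p"
  have dx': "d sm k x \<in> C k L p" if "i = Suc k" for k
    by (rule shift_sum_mono[OF NL]) (use dx that in blast)
  obtain z where z: "z \<in> C (Suc i) M p" "x - d sm i z \<in> C i L p"
    using tor_vanishesD[OF 2 x dx'] by blast
  have "d sm k (x - d sm i z) \<in> C k N p" if "i = Suc k" for k
    using dx that d_diff[OF gm(3) x d_mem[OF gm(3) z(1)], of k] dd[OF gm(3), of z k p] z by simp
  then obtain y where y: "y \<in> C (Suc i) L p" "x - d sm i z - d sm i y \<in> C i N p"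
    using tor_vanishesD[OF 1 z(2)] by blast
  have yM: "y \<in> C (Suc i) M p" by (rule shift_sum_mono[OF LM y(1)])
  have "x - d sm i (z + y) \<in> C i N p"
    using y(2) d_add[OF gm(3) z(1) yM, of i] by (simp add: algebra_simps)
  then show "\<exists>y\<in>C (Suc i) M p. x - d sm i y \<in> C i N p"
    using shift_sum_add[OF gm(3) z(1) yM] by blast
qed

lemma tor_vanishes_sub:
  assumes 1: "tor_vanishes sm M L (Suc i) p" and 2: "tor_vanishes sm M N i p"
  shows "tor_vanishes sm L N i p"
  unfolding tor_vanishes_def
proof (intro ballI impI)
  fix x assume x: "x \<in> C i L p" and dx: "\<forall>k. i = Suc k \<longrightarrow> d sm k x \<in> C k N p"
  have xM: "x \<in> C i M p" by (rule shift_sum_mono[OF LM x])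
  obtain z where z: "z \<in> C (Suc i) M p" "x - d sm i z \<in> C i N p"
    using tor_vanishesD[OF 2 xM] dx by blast
  have "x - (x - d sm i z) \<in> C i L p"
    by (rule shift_sum_diff[OF gm(2) x shift_sum_mono[OF NL z(2)]])
  then have "d sm k z \<in> C k L p" if "Suc i = Suc k" for k using that by simp
  then obtain w where w: "w \<in> C (Suc (Suc i)) M p" "z - d sm (Suc i) w \<in> C (Suc i) L p"
    using tor_vanishesD[OF 1 z(1)] by blast
  have "d sm i (z - d sm (Suc i) w) = d sm i z"
    using d_diff[OF gm(3) z(1) d_mem[OF gm(3) w(1)], of i] dd[OF gm(3) w(1)] by simp
  with w(2) z(2) show "\<exists>y\<in>C (Suc i) L p. x - d sm i y \<in> C i N p" by metis
qed

end

lemma d_graded_hom: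
  assumes "graded_hom sm1 sm2 L M \<phi>" "graded_module sm1 L" "graded_module sm2 M" "f \<in> C (Suc i) L p"
  shows "d sm2 i (\<lambda>j. \<phi> (f j)) = (\<lambda>j. \<phi> (d sm1 i f j))"
  using graded_hom_mat_apply[OF colsP assms] by (auto simp: fun_eq_iff)

text \<open>
  An isomorphism \<open>L/N \<cong> L'/N'\<close> induced by a map \<open>\<phi>\<close> from \<open>L\<close> to \<open>L'\<close>.  Surjectivity is demanded only modulo
  \<open>N'\<close>; this is needed for augmentations and for multiplication by a variable.
\<close>

lemma tor_vanishes_iso:
  fixes sm1 :: "'a \<Rightarrow> 'b \<Rightarrow> 'b::ab_group_add" and sm2 :: "'a \<Rightarrow> 'c \<Rightarrow> 'c::ab_group_add"
  assumes L: "graded_module sm1 L" and N: "graded_module sm1 N" and L': "graded_module sm2 L'" and N': "graded_module sm2 N'"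
    and NL: "\<And>p. N p \<subseteq> L p" and N'L': "\<And>p. N' p \<subseteq> L' p"
    and h: "graded_hom sm1 sm2 L L' \<phi>" and inj: "\<And>p x. x \<in> L p \<Longrightarrow> \<phi> x \<in> N' p \<longleftrightarrow> x \<in> N p"
    and surj: "\<And>p y. y \<in> L' p \<Longrightarrow> \<exists>x\<in>L p. y - \<phi> x \<in> N' p"
  shows "tor_vanishes sm2 L' N' i p \<longleftrightarrow> tor_vanishes sm1 L N i p"
proof -
  note z = graded_hom_zero[OF h L]
  define \<Phi> where "\<Phi> f = (\<lambda>j::nat. \<phi> (f j))" for f
  have mem: "\<Phi> f \<in> C k L' p" if "f \<in> C k L p" for f k
    unfolding \<Phi>_def by (rule graded_hom_push[OF h L that])
  have inj': "\<Phi> f \<in> C k N' p \<longleftrightarrow> f \<in> C k N p" if "f \<in> C k L p" for f k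
  proof
    assume *: "\<Phi> f \<in> C k N' p"
    show "f \<in> C k N p"
    proof (rule shift_sumI[OF shift_sumD(1,2)[OF that]])
      fix j assume j: "j \<in> Bp k"
      show "f j \<in> N (p - \<delta>p k j)"
        using shift_sumD(3)[OF * j] inj[OF shift_sumD(3)[OF that j]] by (simp add: \<Phi>_def)
    qed
  next
    assume *: "f \<in> C k N p"
    show "\<Phi> f \<in> C k N' p"
    proof (rule shift_sumI[OF shift_sumD(1,2)[OF mem[OF that]]])
      fix j assume j: "j \<in> Bp k"
      show "\<Phi> f j \<in> N' (p - \<delta>p k j)"
        using shift_sumD(3)[OF * j] inj[OF shift_sumD(3)[OF that j]] by (simp add: \<Phi>_def)
    qed
  qed
  have dif: "\<Phi> (f - g) = \<Phi> f - \<Phi> g" if "f \<in> C k L p" "g \<in> C k L p" for f g k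
  proof
    fix j
    show "\<Phi> (f - g) j = (\<Phi> f - \<Phi> g) j"
    proof (cases "j \<in> Bp k")
      case True
      then show ?thesis using graded_hom_diff[OF h L shift_sumD(3)[OF that(1)] shift_sumD(3)[OF that(2)]] by (simp add: \<Phi>_def)
    qed (simp add: \<Phi>_def z shift_sumD(2)[OF that(1)] shift_sumD(2)[OF that(2)])
  qed
  have dcom: "d sm2 k (\<Phi> f) = \<Phi> (d sm1 k f)" if "f \<in> C (Suc k) L p" for f k
    unfolding \<Phi>_def by (rule d_graded_hom[OF h L L' that])
  have lift: "\<exists>g\<in>C k L p. f - \<Phi> g \<in> C k N' p" if "f \<in> C k L' p" for f k
    unfolding \<Phi>_def
    by (rule shift_sum_lift[OF surj z that]) (auto intro: graded_moduleD(2)[OF L] graded_moduleD(2)[OF N'])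
  have up: "f \<in> C k L' p" if "f \<in> C k N' p" for f k
    by (rule shift_sum_mono[OF N'L' that])
  note dN' = d_mem[OF N'] and dL' = d_mem[OF L'] and dL = d_mem[OF L]
  note df = shift_sum_diff[OF N'] and ad = shift_sum_add[OF N']
  show ?thesis
  proof
    assume T: "tor_vanishes sm2 L' N' i p"
    show "tor_vanishes sm1 L N i p"
      unfolding tor_vanishes_def
    proof (intro ballI impI)
      fix x assume x: "x \<in> C i L p" and dx: "\<forall>k. i = Suc k \<longrightarrow> d sm1 k x \<in> C k N p"
      have "d sm2 k (\<Phi> x) \<in> C k N' p" if "i = Suc k" for k
        using dx that x dcom[of x k] inj'[OF dL, of x k] by simp
      then obtain y' where y': "y' \<in> C (Suc i) L' p" "\<Phi> x - d sm2 i y' \<in> C i N' p"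
        using tor_vanishesD[OF T mem[OF x]] by blast
      obtain y where y: "y \<in> C (Suc i) L p" "y' - \<Phi> y \<in> C (Suc i) N' p" using lift[OF y'(1)] by blast
      have "d sm2 i (y' - \<Phi> y) = d sm2 i y' - \<Phi> (d sm1 i y)"
        using d_diff[OF L' y'(1) mem[OF y(1)]] dcom[OF y(1)] by simp
      then have "\<Phi> x - \<Phi> (d sm1 i y) \<in> C i N' p"
        using ad[OF y'(2) dN'[OF y(2)]] by simp
      then have "x - d sm1 i y \<in> C i N p"
        using dif[OF x dL[OF y(1)]] inj'[OF shift_sum_diff[OF L x dL[OF y(1)]]] by simp
      with y(1) show "\<exists>y\<in>C (Suc i) L p. x - d sm1 i y \<in> C i N p" by blast
    qed
  next
    assume T: "tor_vanishes sm1 L N i p"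
    show "tor_vanishes sm2 L' N' i p"
      unfolding tor_vanishes_def
    proof (intro ballI impI)
      fix x' assume x': "x' \<in> C i L' p" and dx: "\<forall>k. i = Suc k \<longrightarrow> d sm2 k x' \<in> C k N' p"
      obtain x where x: "x \<in> C i L p" "x' - \<Phi> x \<in> C i N' p" using lift[OF x'] by blast
      have "d sm1 k x \<in> C k N p" if i: "i = Suc k" for k
      proof -
        have "d sm2 k (x' - \<Phi> x) = d sm2 k x' - \<Phi> (d sm1 k x)"
          using d_diff[OF L' x' mem[OF x(1)]] dcom[of x k] x(1) i by simp
        then have "\<Phi> (d sm1 k x) \<in> C k N' p"
          using df[of "d sm2 k x'" "Bp k" "\<delta>p k" p "d sm2 k (x' - \<Phi> x)"] dx i dN'[of "x' - \<Phi> x" k p] x(2) by simp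
        then show ?thesis using inj'[OF dL, of x k] x(1) i by simp
      qed
      then obtain y where y: "y \<in> C (Suc i) L p" "x - d sm1 i y \<in> C i N p"
        using tor_vanishesD[OF T x(1)] by blast
      have "\<Phi> x - d sm2 i (\<Phi> y) \<in> C i N' p"
        using y inj'[OF shift_sum_diff[OF L x(1) dL[OF y(1)]]] dif[OF x(1) dL[OF y(1)]] dcom[OF y(1)] by simp
      from ad[OF x(2) this] have "x' - d sm2 i (\<Phi> y) \<in> C i N' p" by simp
      with mem[OF y(1)] show "\<exists>y\<in>C (Suc i) L' p. x' - d sm2 i y \<in> C i N' p" by blast
    qed
  qed
qed

text \<open>
  Boundaries are found summand by summand.  A chain meets only finitely many summands, which keeps the
  combined boundary finite.
\<close>

lemma tor_vanishes_dirsum: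
  assumes L: "\<And>k. k \<in> B \<Longrightarrow> graded_module sm (L k)" and m: "Modules.module sm"
    and N: "\<And>k q. k \<in> B \<Longrightarrow> 0 \<in> N k q"
    and T: "\<And>k. k \<in> B \<Longrightarrow> tor_vanishes sm (L k) (N k) i p"
  shows "tor_vanishes (pointwise sm) (dirsum B L) (dirsum B N) i p"
  unfolding tor_vanishes_def
proof (intro ballI impI)
  fix x assume x: "x \<in> C i (dirsum B L) p" and dx: "\<forall>k. i = Suc k \<longrightarrow> d (pointwise sm) k x \<in> C k (dirsum B N) p"
  have comp: "d (pointwise sm) l f j k = d sm l (\<lambda>j. f j k) j" if "f \<in> C l' (dirsum B L) p" for l l' f j k
    by (rule mat_apply_pointwise_component[OF m shift_sumD(1)[OF that]])
  have "\<exists>y\<in>C (Suc i) (L k) p. (\<lambda>j. x j k) - d sm i y \<in> C i (N k) p" if k: "k \<in> B" for k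
  proof -
    have "d sm l (\<lambda>j. x j k) \<in> C l (N k) p" if "i = Suc l" for l
      using component_mem[OF dx[rule_format, OF that] k] comp[OF x] by simp
    from tor_vanishesD[OF T[OF k] component_mem[OF x k] this] show ?thesis by blast
  qed
  then obtain y where y: "\<And>k. k \<in> B \<Longrightarrow> y k \<in> C (Suc i) (L k) p"
      "\<And>k. k \<in> B \<Longrightarrow> (\<lambda>j. x j k) - d sm i (y k) \<in> C i (N k) p" by metis
  define T where "T = {k. \<exists>j. x j k \<noteq> 0}"
  have xB: "x j \<in> dirsum B L (p - \<delta>p i j)" if "x j \<noteq> 0" for j
    using shift_sumD(3,4)[OF x] that by blast
  have TB: "T \<subseteq> B"
  proof
    fix k assume "k \<in> T"
    then obtain j where j: "x j k \<noteq> 0" by (auto simp: T_def)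
    then have "x j \<noteq> 0" by auto
    from dirsumD(4)[OF xB[OF this] j] show "k \<in> B" .
  qed
  have "T \<subseteq> (\<Union>j\<in>{j. x j \<noteq> 0}. {k. x j k \<noteq> 0})"
    by (auto simp: T_def) (metis zero_fun_apply)
  then have fT: "finite T"
    by (rule finite_subset) (use shift_sumD(1)[OF x] dirsumD(1)[OF xB] in auto)
  define Y where "Y = (\<lambda>j k. if k \<in> T then y k j else 0)"
  have Y: "Y \<in> C (Suc i) (dirsum B L) p"
    unfolding Y_def by (rule transpose_mem[OF fT TB]) (use y(1) TB graded_moduleD(2)[OF L] in auto)
  have "x - d (pointwise sm) i Y = (\<lambda>j k. if k \<in> T then ((\<lambda>j. x j k) - d sm i (y k)) j else 0)"
  proof (intro ext)
    fix j k
    show "(x - d (pointwise sm) i Y) j k = (if k \<in> T then ((\<lambda>j. x j k) - d sm i (y k)) j else 0)"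
    proof (cases "k \<in> T")
      case False
      then have "x j k = 0" by (auto simp: T_def)
      with False comp[OF Y, of i j k] show ?thesis by (simp add: Y_def)
    qed (use comp[OF Y, of i j k] in \<open>simp add: Y_def\<close>)
  qed
  also have "\<dots> \<in> C i (dirsum B N) p"
    by (rule transpose_mem[where y = "\<lambda>k. (\<lambda>j. x j k) - d sm i (y k)", OF fT TB y(2)[OF subsetD[OF TB]] N])
  finally show "\<exists>y\<in>C (Suc i) (dirsum B L) p. x - d (pointwise sm) i y \<in> C i (dirsum B N) p"
    using Y by blast
qed

lemma dirsum_zero: "dirsum B (\<lambda>_ _. {0}) p = {0}"
  by (auto simp: dirsum_def fun_eq_iff) metis

lemma aug_one: "x \<in> C 0 L p \<Longrightarrow> aug (\<lambda>_. 1) x = (x 0 :: 'a)"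
proof -
  assume x: "x \<in> C 0 L p"
  have "{j. x j \<noteq> 0} \<subseteq> {0}" using shift_sumD(4)[OF x] Bp0 by auto
  from mat_apply_eq_sum[OF module_mult _ this] show ?thesis by simp
qed

lemma P_image0: "d (*) 0 ` C 1 A p = {x \<in> C 0 A p. x 0 \<in> (if p = 0 then {0} else A p)}"
  using resolution_image[OF Pres, of 0 p] by (simp add: syz_def aug_one[of _ A p] cong: conj_cong)

lemma P_exact: "d (*) (Suc i) ` C (Suc (Suc i)) A p = {x \<in> C (Suc i) A p. d (*) i x = 0}"
  using resolution_image[OF Pres, of "Suc i" p] by (simp add: syz_def)

text \<open>
  For a shift of \<open>A\<close> itself, \<open>P \<otimes> A(-e)\<close> is a shift of \<open>P\<close>, exact except for \<open>K(-e)\<close> in degree \<open>0\<close>.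
\<close>

lemma tor_vanishes_free:
  assumes "i > 0 \<or> p \<noteq> e"
  shows "tor_vanishes (*) (\<lambda>q. A (q - e)) (\<lambda>_. {0}) i p"
  unfolding tor_vanishes_def
proof (intro ballI impI)
  fix x assume x: "x \<in> C i (\<lambda>q. A (q - e)) p" and dx: "\<forall>k. i = Suc k \<longrightarrow> d (*) k x \<in> C k (\<lambda>_. {0}) p"
  have "x \<in> d (*) i ` C (Suc i) A (p - e)"
  proof (cases i)
    case 0
    with x assms show ?thesis
      using P_image0[of "p - e"] by (auto simp: shift_sum_A_shift C0_iff)
  next
    case (Suc k)
    with x dx show ?thesis using P_exact[of k "p - e"] by (auto simp: shift_sum_A_shift C_zero)
  qed
  then show "\<exists>y\<in>C (Suc i) (\<lambda>q. A (q - e)) p. x - d (*) i y \<in> C i (\<lambda>_. {0}) p"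
    by (auto simp: shift_sum_A_shift C_zero)
qed

lemma tor_vanishes_shift_sum_A:
  assumes "i > 0"
  shows "tor_vanishes (pointwise (*)) (shift_sum B \<delta> A) (\<lambda>_. {0}) i p"
proof -
  have "tor_vanishes (pointwise (*)) (dirsum B (\<lambda>j q. A (q - \<delta> j))) (dirsum B (\<lambda>_ _. {0})) i p"
    by (rule tor_vanishes_dirsum[OF graded_module_A_shift module_mult]) (use assms in \<open>auto intro: tor_vanishes_free\<close>)
  then show ?thesis by (simp add: shift_sum_def dirsum_zero[abs_def])
qed

text \<open>
  The image of \<open>P\<^sub>1 \<otimes> F\<close> in \<open>P\<^sub>0 \<otimes> F = F\<close> is \<open>A\<^sub>+ F\<close>, since the image of \<open>P\<^sub>1\<close> in \<open>A\<close> is \<open>A\<^sub>+\<close>.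
  This links the two ways to compute Tor.
\<close>

lemma irr_part_eq: "irr_part B \<delta> p = (\<lambda>z. d (pointwise (*)) 0 z 0) ` C 1 (shift_sum B \<delta> A) p"
proof (intro equalityI subsetI)
  fix z assume "z \<in> (\<lambda>z. d (pointwise (*)) 0 z 0) ` C 1 (shift_sum B \<delta> A) p"
  then obtain y where y: "y \<in> C 1 (shift_sum B \<delta> A) p" and z: "z = d (pointwise (*)) 0 y 0" by auto
  have "d (pointwise (*)) 0 y \<in> C 0 (shift_sum B \<delta> A) p"
    by (rule d_mem[OF graded_module_shift_sum[OF graded_module_A]]) (use y in simp)
  then have zm: "z \<in> shift_sum B \<delta> A p" by (simp add: C0_iff z)
  have "z k = 0" if "\<delta> k = p" for k
  proof (cases "k \<in> B")
    case True
    have "(\<lambda>j. y j k) \<in> C 1 (\<lambda>q. A (q - \<delta> k)) p"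
      by (rule component_mem[OF _ True]) (use y in \<open>simp add: shift_sum_def\<close>)
    then have "d (*) 0 (\<lambda>j. y j k) \<in> d (*) 0 ` C 1 A 0" by (simp add: shift_sum_A_shift that)
    then have "d (*) 0 (\<lambda>j. y j k) 0 = 0" unfolding P_image0 by simp
    then show ?thesis using mat_apply_pointwise_component[OF module_mult shift_sumD(1)[OF y]] by (simp add: z)
  qed (use shift_sumD(2)[OF zm] in simp)
  with zm show "z \<in> irr_part B \<delta> p" by (simp add: irr_part_def)
next
  fix z assume "z \<in> irr_part B \<delta> p"
  then have z: "z \<in> shift_sum B \<delta> A p" "\<And>j. \<delta> j = p \<Longrightarrow> z j = 0" by (auto simp: irr_part_def)
  let ?T = "{k. z k \<noteq> 0}"
  have "\<exists>y\<in>C 1 A (p - \<delta> k). at_zero (z k) = d (*) 0 y" if "k \<in> ?T" for k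
  proof -
    have "z k \<in> A (p - \<delta> k)" using shift_sumD(3,4)[OF z(1)] that by blast
    moreover have "p - \<delta> k \<noteq> 0" using z(2) that by auto
    ultimately have "at_zero (z k) \<in> d (*) 0 ` C 1 A (p - \<delta> k)"
      unfolding P_image0 using at_zero_mem[of "z k" A "p - \<delta> k"] by (simp add: at_zero_def)
    then show ?thesis by blast
  qed
  then obtain y where y: "\<And>k. k \<in> ?T \<Longrightarrow> y k \<in> C 1 A (p - \<delta> k)" "\<And>k. k \<in> ?T \<Longrightarrow> at_zero (z k) = d (*) 0 (y k)" by metis
  define Y where "Y = (\<lambda>j k. if k \<in> ?T then y k j else 0)"
  have "Y \<in> C 1 (dirsum B (\<lambda>k q. A (q - \<delta> k))) p"
    unfolding Y_def
  proof (rule transpose_mem)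
    show "?T \<subseteq> B" using shift_sumD(4)[OF z(1)] by auto
    fix k assume "k \<in> ?T"
    from y(1)[OF this] show "y k \<in> C 1 (\<lambda>q. A (q - \<delta> k)) p" by (simp only: shift_sum_A_shift)
  qed (auto simp: A_zero shift_sumD(1)[OF z(1)])
  then have Y: "Y \<in> C 1 (shift_sum B \<delta> A) p" by (simp add: shift_sum_def[of B])
  have "d (pointwise (*)) 0 Y 0 = z"
  proof
    fix k
    have "d (pointwise (*)) 0 Y 0 k = d (*) 0 (\<lambda>j. Y j k) 0"
      by (rule mat_apply_pointwise_component[OF module_mult shift_sumD(1)[OF Y]])
    also have "\<dots> = z k"
      using y(2)[of k, symmetric] by (cases "z k = 0") (simp_all add: Y_def at_zero_def)
    finally show "d (pointwise (*)) 0 Y 0 k = z k" .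
  qed
  with Y show "z \<in> (\<lambda>z. d (pointwise (*)) 0 z 0) ` C 1 (shift_sum B \<delta> A) p" by blast
qed

end

section \<open>Tor is independent of the resolution\<close>

context graded_ring
begin

text \<open>
  The vanishing of \<open>H\<^sub>i(F / A\<^sub>+ F)\<close> in bidegree \<open>p\<close> for a complex \<open>F\<close> of free modules.
\<close>

definition tor_zero_via :: "(nat \<Rightarrow> nat set) \<Rightarrow> (nat \<Rightarrow> nat \<Rightarrow> bideg) \<Rightarrow> (nat \<Rightarrow> nat \<Rightarrow> nat \<Rightarrow> 'a) \<Rightarrow> nat \<Rightarrow> bideg \<Rightarrow> bool" where
  "tor_zero_via B \<delta> D i p \<longleftrightarrow> (\<forall>x\<in>shift_sum (B i) (\<delta> i) A p.
      (\<forall>k. i = Suc k \<longrightarrow> mat_apply (*) (D k) x \<in> irr_part (B k) (\<delta> k) p) \<longrightarrow>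
      (\<exists>y\<in>shift_sum (B (Suc i)) (\<delta> (Suc i)) A p. x - mat_apply (*) (D i) y \<in> irr_part (B i) (\<delta> i) p))"

end

context tor_ring
begin

context
  fixes I B \<delta> r D
  assumes R: "resolution I B \<delta> r D" and I: "graded_module (*) I" and IA: "\<And>p. I p \<subseteq> A p"
begin

lemma C0_transfer: "x \<in> C 0 L p \<Longrightarrow> x 0 \<in> M p \<Longrightarrow> x \<in> C 0 M p"
  by (metis C0_iff)

abbreviation (input) F where "F k \<equiv> shift_sum (B k) (\<delta> k) A"
abbreviation (input) Sy where "Sy k \<equiv> syz I B \<delta> r D k"

lemma F_graded_module: "graded_module (pointwise (*)) (F k)" by (rule graded_module_shift_sum[OF graded_module_A])
lemma S_graded_module: "graded_module (pointwise (*)) (Sy k)" by (rule graded_module_syz[OF R I IA])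
lemma Z_graded_module: "graded_module (pointwise (*)) (\<lambda>_. {0 :: nat \<Rightarrow> 'a})" by (rule graded_module_zero[OF module_pointwise[OF module_mult]])

lemma D_graded_hom: "graded_hom (pointwise (*)) (pointwise (*)) (F (Suc k)) (F k) (mat_apply (*) (D k))"
  by (rule graded_hom_mat_apply_mult[OF resolution_columns[OF R]])

lemma D_graded_hom_S: "graded_hom (pointwise (*)) (pointwise (*)) (F (Suc k)) (Sy k) (mat_apply (*) (D k))"
  using D_graded_hom[of k] resolution_image[OF R, of k] unfolding graded_hom_def by blast

lemma D_surj: "y \<in> Sy k q \<Longrightarrow> \<exists>x\<in>F (Suc k) q. y = mat_apply (*) (D k) x"
  using resolution_image[OF R, of k q] by blast

lemma S_Suc: "x \<in> Sy (Suc k) p \<longleftrightarrow> x \<in> F (Suc k) p \<and> mat_apply (*) (D k) x = 0"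
  by (simp add: syz_def)

lemma S_sub: "Sy k p \<subseteq> F k p" by (rule syz_subset)

lemma tor_vanishes_syz: "tor_vanishes (pointwise (*)) (Sy k) (\<lambda>_. {0}) i p \<longleftrightarrow> tor_vanishes (pointwise (*)) (F (Suc k)) (Sy (Suc k)) i p"
proof (rule tor_vanishes_iso[OF F_graded_module S_graded_module S_graded_module Z_graded_module S_sub _ D_graded_hom_S])
  show "{0} \<subseteq> Sy k p" for p using graded_moduleD(2)[OF S_graded_module] by simp
  show "mat_apply (*) (D k) x \<in> {0} \<longleftrightarrow> x \<in> Sy (Suc k) p" if "x \<in> F (Suc k) p" for x p
    using that by (simp add: S_Suc)
  show "\<exists>x\<in>F (Suc k) p. y - mat_apply (*) (D k) x \<in> {0}" if "y \<in> Sy k p" for y p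
    using D_surj[OF that] by auto
qed

text \<open>
  Dimension shifting along \<open>0 \<rightarrow> Z\<^sub>k \<rightarrow> F\<^sub>k \<rightarrow> F\<^sub>k / Z\<^sub>k \<rightarrow> 0\<close> with \<open>Z\<^sub>k\<close> the kernel in \<open>F\<^sub>k\<close>, where \<open>Z\<^sub>k\<close> is
  isomorphic to \<open>F\<^sub>k\<^sub>+\<^sub>1 / Z\<^sub>k\<^sub>+\<^sub>1\<close>.  It stops at \<open>Tor\<^sub>1\<close>, since \<open>Tor\<^sub>0\<close> of a free module does not vanish.
\<close>

lemma tor_vanishes_shift:
  "tor_vanishes (pointwise (*)) (F k) (Sy k) (Suc (Suc i)) p \<longleftrightarrow> tor_vanishes (pointwise (*)) (F (Suc k)) (Sy (Suc k)) (Suc i) p"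
proof -
  have z: "{0} \<subseteq> Sy k p" for p using graded_moduleD(2)[OF S_graded_module] by simp
  show ?thesis
    unfolding tor_vanishes_syz[symmetric]
  proof
    assume "tor_vanishes (pointwise (*)) (F k) (Sy k) (Suc (Suc i)) p"
    then show "tor_vanishes (pointwise (*)) (Sy k) (\<lambda>_. {0}) (Suc i) p"
      by (rule tor_vanishes_sub[OF Z_graded_module S_graded_module F_graded_module z S_sub]) (simp add: tor_vanishes_shift_sum_A)
  next
    assume "tor_vanishes (pointwise (*)) (Sy k) (\<lambda>_. {0}) (Suc i) p"
    then show "tor_vanishes (pointwise (*)) (F k) (Sy k) (Suc (Suc i)) p"
      by (intro tor_vanishes_quotient[OF Z_graded_module S_graded_module F_graded_module z S_sub]) (simp_all add: tor_vanishes_shift_sum_A)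
  qed
qed

lemma tor_vanishes_base: "tor_vanishes (*) A I i p \<longleftrightarrow> tor_vanishes (pointwise (*)) (F 0) (Sy 0) i p"
proof (rule tor_vanishes_iso[OF F_graded_module S_graded_module graded_module_A I S_sub IA])
  show "graded_hom (pointwise (*)) (*) (F 0) A (\<lambda>x. aug r x)"
    by (rule augmentation_hom) (use R in \<open>auto simp: resolution_def\<close>)
  show "aug r x \<in> I p \<longleftrightarrow> x \<in> Sy 0 p" if "x \<in> F 0 p" for x p
    using that by (simp add: syz_def)
  show "\<exists>x\<in>F 0 p. y - aug r x \<in> I p" if "y \<in> A p" for y p
    using R that unfolding resolution_def by blast
qed

lemma tor_vanishes_zero: "tor_vanishes (pointwise (*)) (F 0) (Sy 0) 0 p \<longleftrightarrow> tor_zero_via B \<delta> D 0 p"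
proof
  assume T: "tor_vanishes (pointwise (*)) (F 0) (Sy 0) 0 p"
  show "tor_zero_via B \<delta> D 0 p"
    unfolding tor_zero_via_def
  proof (intro ballI impI)
    fix x assume x: "x \<in> F 0 p"
    then have "at_zero x \<in> C 0 (F 0) p" by (simp add: at_zero_mem)
    then obtain y where y: "y \<in> C (Suc 0) (F 0) p" "at_zero x - d (pointwise (*)) 0 y \<in> C 0 (Sy 0) p"
      using tor_vanishesD[OF T] by blast
    let ?v = "d (pointwise (*)) 0 y 0"
    have v: "?v \<in> irr_part (B 0) (\<delta> 0) p" using y(1) by (auto simp: irr_part_eq)
    have "x - ?v \<in> Sy 0 p" using y(2) by (simp add: C0_iff at_zero_def)
    then obtain w where w: "w \<in> F (Suc 0) p" "x - ?v = mat_apply (*) (D 0) w" using D_surj by blast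
    then have "x - mat_apply (*) (D 0) w = ?v" by (simp add: algebra_simps)
    with w(1) v show "\<exists>y\<in>F (Suc 0) p. x - mat_apply (*) (D 0) y \<in> irr_part (B 0) (\<delta> 0) p" by metis
  qed
next
  assume T: "tor_zero_via B \<delta> D 0 p"
  show "tor_vanishes (pointwise (*)) (F 0) (Sy 0) 0 p"
    unfolding tor_vanishes_def
  proof (intro ballI impI)
    fix x assume x: "x \<in> C 0 (F 0) p"
    then have "x 0 \<in> F 0 p" by (simp add: C0_iff)
    with T obtain w where w: "w \<in> F (Suc 0) p" "x 0 - mat_apply (*) (D 0) w \<in> irr_part (B 0) (\<delta> 0) p"
      unfolding tor_zero_via_def by blast
    then obtain y where y: "y \<in> C (Suc 0) (F 0) p" "x 0 - mat_apply (*) (D 0) w = d (pointwise (*)) 0 y 0"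
      by (auto simp: irr_part_eq)
    have mw: "mat_apply (*) (D 0) w \<in> Sy 0 p" by (rule graded_homD(1)[OF D_graded_hom_S w(1)])
    have dm: "x - d (pointwise (*)) 0 y \<in> C 0 (F 0) p"
      by (rule shift_sum_diff[OF F_graded_module x d_mem[OF F_graded_module y(1)]])
    have "(x - d (pointwise (*)) 0 y) 0 = mat_apply (*) (D 0) w" using y(2) by (simp add: algebra_simps)
    with mw have "x - d (pointwise (*)) 0 y \<in> C 0 (Sy 0) p" by (intro C0_transfer[OF dm]) simp
    with y(1) show "\<exists>y\<in>C (Suc 0) (F 0) p. x - d (pointwise (*)) 0 y \<in> C 0 (Sy 0) p" by blast
  qed
qed

text \<open>
  Both sides say \<open>Z\<^sub>k \<inter> A\<^sub>+ F\<^sub>k \<subseteq> A\<^sub>+ Z\<^sub>k\<close>: on the left \<open>A\<^sub>+ F\<^sub>k\<close> is the image of \<open>P\<^sub>1 \<otimes> F\<^sub>k\<close>, on the right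
  \<open>Z\<^sub>k\<close> is the image of \<open>F\<^sub>k\<^sub>+\<^sub>1\<close>.
\<close>

lemma tor_vanishes_one: "tor_vanishes (pointwise (*)) (F k) (Sy k) (Suc 0) p \<longleftrightarrow> tor_zero_via B \<delta> D (Suc k) p"
proof
  assume T: "tor_vanishes (pointwise (*)) (F k) (Sy k) (Suc 0) p"
  show "tor_zero_via B \<delta> D (Suc k) p"
    unfolding tor_zero_via_def
  proof (intro ballI impI)
    fix x assume x: "x \<in> F (Suc k) p"
      and "\<forall>l. Suc k = Suc l \<longrightarrow> mat_apply (*) (D l) x \<in> irr_part (B l) (\<delta> l) p"
    then have "mat_apply (*) (D k) x \<in> irr_part (B k) (\<delta> k) p" by simp
    then obtain z where z: "z \<in> C 1 (F k) p" "mat_apply (*) (D k) x = d (pointwise (*)) 0 z 0"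
      unfolding irr_part_eq by blast
    have "d (pointwise (*)) 0 z \<in> C 0 (F k) p" by (rule d_mem[OF F_graded_module]) (use z in simp)
    then have "d (pointwise (*)) 0 z \<in> C 0 (Sy k) p"
      using graded_homD(1)[OF D_graded_hom_S x] z(2) by (simp add: C0_iff)
    then obtain y where y: "y \<in> C (Suc 1) (F k) p" "z - d (pointwise (*)) 1 y \<in> C 1 (Sy k) p"
      using tor_vanishesD[OF T, of z] z(1) by auto
    obtain u where u: "u \<in> C 1 (F (Suc k)) p" "z - d (pointwise (*)) 1 y - (\<lambda>j. mat_apply (*) (D k) (u j)) \<in> C 1 (\<lambda>_. {0}) p"
    proof -
      have "\<exists>g\<in>C 1 (F (Suc k)) p. z - d (pointwise (*)) 1 y - (\<lambda>j. mat_apply (*) (D k) (g j)) \<in> C 1 (\<lambda>_. {0}) p"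
      proof (rule shift_sum_lift[OF _ _ y(2)])
        show "\<exists>x\<in>F (Suc k) q. y - mat_apply (*) (D k) x \<in> {0}" if "y \<in> Sy k q" for q y
          using D_surj[OF that] by auto
      qed (auto intro: graded_moduleD(2)[OF F_graded_module])
      then show ?thesis using that by blast
    qed
    have u2: "(\<lambda>j. mat_apply (*) (D k) (u j)) = z - d (pointwise (*)) 1 y" using u(2) by (simp add: C_zero)
    let ?v = "d (pointwise (*)) 0 u 0"
    have v: "?v \<in> irr_part (B (Suc k)) (\<delta> (Suc k)) p" using u(1) unfolding irr_part_eq by blast
    then have vF: "?v \<in> F (Suc k) p" by (simp add: irr_part_def)
    have "mat_apply (*) (D k) ?v = d (pointwise (*)) 0 (\<lambda>j. mat_apply (*) (D k) (u j)) 0"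
      using d_graded_hom[OF D_graded_hom F_graded_module F_graded_module, of u 0 k p] u(1) by simp
    also have "\<dots> = d (pointwise (*)) 0 z 0 - d (pointwise (*)) 0 (d (pointwise (*)) 1 y) 0"
      unfolding u2 using d_diff[OF F_graded_module z(1), of "d (pointwise (*)) 1 y" 0] d_mem[OF F_graded_module y(1)] by simp
    also have "\<dots> = mat_apply (*) (D k) x" using dd[OF F_graded_module, of y 0] y(1) z(2) by simp
    finally have "mat_apply (*) (D k) (x - ?v) = 0"
      using graded_hom_diff[OF D_graded_hom F_graded_module x vF] by simp
    then have "x - ?v \<in> Sy (Suc k) p" using graded_moduleD(3)[OF F_graded_module x vF] by (simp add: S_Suc)
    then obtain w where w: "w \<in> F (Suc (Suc k)) p" "x - ?v = mat_apply (*) (D (Suc k)) w"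
      using D_surj by blast
    then have "x - mat_apply (*) (D (Suc k)) w = ?v" by (simp add: algebra_simps)
    with w(1) v show "\<exists>y\<in>F (Suc (Suc k)) p. x - mat_apply (*) (D (Suc k)) y \<in> irr_part (B (Suc k)) (\<delta> (Suc k)) p"
      by metis
  qed
next
  assume T: "tor_zero_via B \<delta> D (Suc k) p"
  show "tor_vanishes (pointwise (*)) (F k) (Sy k) (Suc 0) p"
    unfolding tor_vanishes_def
  proof (intro ballI impI)
    fix x assume x: "x \<in> C (Suc 0) (F k) p" and "\<forall>l. Suc 0 = Suc l \<longrightarrow> d (pointwise (*)) l x \<in> C l (Sy k) p"
    then have dx: "d (pointwise (*)) 0 x 0 \<in> Sy k p" by (simp add: C0_iff)
    then obtain y where y: "y \<in> F (Suc k) p" "d (pointwise (*)) 0 x 0 = mat_apply (*) (D k) y" using D_surj by blast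
    have "d (pointwise (*)) 0 x 0 \<in> irr_part (B k) (\<delta> k) p" using x by (auto simp: irr_part_eq)
    then obtain w where w: "w \<in> F (Suc (Suc k)) p"
        "y - mat_apply (*) (D (Suc k)) w \<in> irr_part (B (Suc k)) (\<delta> (Suc k)) p"
      using T y unfolding tor_zero_via_def by auto
    then obtain u where u: "u \<in> C (Suc 0) (F (Suc k)) p" "y - mat_apply (*) (D (Suc k)) w = d (pointwise (*)) 0 u 0"
      by (auto simp: irr_part_eq)
    let ?x' = "\<lambda>j. mat_apply (*) (D k) (u j)"
    have x'S: "?x' \<in> C (Suc 0) (Sy k) p" by (rule graded_hom_push[OF D_graded_hom_S F_graded_module u(1)])
    then have x'F: "?x' \<in> C (Suc 0) (F k) p" by (rule shift_sum_mono[OF S_sub])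
    have wS: "mat_apply (*) (D (Suc k)) w \<in> Sy (Suc k) p" by (rule graded_homD(1)[OF D_graded_hom_S w(1)])
    then have wF: "mat_apply (*) (D (Suc k)) w \<in> F (Suc k) p" by (simp add: S_Suc)
    have "d (pointwise (*)) 0 ?x' 0 = mat_apply (*) (D k) (y - mat_apply (*) (D (Suc k)) w)"
      using d_graded_hom[OF D_graded_hom F_graded_module F_graded_module u(1)] u(2) by simp
    also have "\<dots> = d (pointwise (*)) 0 x 0"
      using graded_hom_diff[OF D_graded_hom F_graded_module y(1) wF] wS y(2) by (simp add: S_Suc)
    finally have eq: "d (pointwise (*)) 0 (x - ?x') 0 = 0" using d_diff[OF F_graded_module x x'F] by simp
    have "d (pointwise (*)) 0 (x - ?x') \<in> C 0 (F k) p"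
      by (rule d_mem[OF F_graded_module]) (rule shift_sum_diff[OF F_graded_module x x'F])
    from C0_transfer[OF this] eq have "d (pointwise (*)) 0 (x - ?x') \<in> C 0 (\<lambda>_. {0}) p" by simp
    then have "\<And>l. Suc 0 = Suc l \<Longrightarrow> d (pointwise (*)) l (x - ?x') \<in> C l (\<lambda>_. {0}) p" by simp
    then obtain z where z: "z \<in> C (Suc (Suc 0)) (F k) p" "x - ?x' - d (pointwise (*)) (Suc 0) z \<in> C (Suc 0) (\<lambda>_. {0}) p"
      using tor_vanishesD[OF tor_vanishes_shift_sum_A[of "Suc 0"] shift_sum_diff[OF F_graded_module x x'F]] by blast
    then have "x - d (pointwise (*)) (Suc 0) z = ?x'" by (simp add: C_zero algebra_simps)
    with x'S z(1) show "\<exists>y\<in>C (Suc (Suc 0)) (F k) p. x - d (pointwise (*)) (Suc 0) y \<in> C (Suc 0) (Sy k) p"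
      by metis
  qed
qed

lemma tor_vanishes_Suc: "tor_vanishes (pointwise (*)) (F k) (Sy k) (Suc i) p \<longleftrightarrow> tor_zero_via B \<delta> D (Suc (k + i)) p"
proof (induction i arbitrary: k)
  case 0
  then show ?case by (simp add: tor_vanishes_one)
next
  case (Suc i)
  then show ?case by (simp add: tor_vanishes_shift)
qed

text \<open>
  The left-hand side does not mention the resolution of \<open>A / I\<close>, hence all resolutions give
  the same answer.
\<close>

theorem tor_vanishes_iff_tor_zero_via: "tor_vanishes (*) A I i p \<longleftrightarrow> tor_zero_via B \<delta> D i p"
  by (cases i) (simp_all add: tor_vanishes_base tor_vanishes_zero tor_vanishes_Suc)

end

end

section \<open>Minimal free resolutions\<close>

text \<open>
  A basis of \<open>N\<close> modulo \<open>V\<close>: extend a basis of \<open>V\<close> to one of \<open>N\<close> and keep the new vectors.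
\<close>

lemma (in vector_space) complement_basis:
  assumes N: "subspace N" and V: "subspace V" "V \<subseteq> N" and T: "N \<subseteq> span T" "finite T"
  shows "\<exists>b. finite b \<and> b \<subseteq> N \<and> (\<forall>x\<in>N. \<exists>c. x - (\<Sum>y\<in>b. scale (c y) y) \<in> V) \<and>
    (\<forall>c. (\<Sum>y\<in>b. scale (c y) y) \<in> V \<longrightarrow> (\<forall>y\<in>b. c y = 0))"
proof -
  obtain B0 where B0: "B0 \<subseteq> V" "independent B0" "V \<subseteq> span B0"
    using maximal_independent_subset by blast
  have "B0 \<subseteq> N" using B0(1) V(2) by blast
  then obtain B1 where B1: "B0 \<subseteq> B1" "B1 \<subseteq> N" "independent B1" "N \<subseteq> span B1"
    using maximal_independent_subset_extend[OF _ B0(2)] by blast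
  have sB0: "span B0 = V" using B0 V span_minimal by blast
  let ?b = "B1 - B0"
  have fin: "finite ?b"
    using independent_span_bound[OF T(2) B1(3)] B1(2) T(1) by auto
  show ?thesis
  proof (intro exI[of _ ?b] conjI ballI allI impI)
    show "finite ?b" by fact
    show "?b \<subseteq> N" using B1(2) by auto
    show "\<exists>c. x - (\<Sum>y\<in>?b. scale (c y) y) \<in> V" if x: "x \<in> N" for x
    proof -
      have "x \<in> span (B0 \<union> ?b)" using x B1(1,4) by (auto simp: Un_absorb1)
      then obtain v w where "v \<in> span B0" "w \<in> span ?b" "x = v + w"
        unfolding span_Un by blast
      moreover from this obtain c where "w = (\<Sum>y\<in>?b. scale (c y) y)"
        using span_finite[OF fin] by auto
      ultimately show ?thesis using sB0 by (intro exI[of _ c]) simp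
    qed
    show "c y0 = 0" if s: "(\<Sum>y\<in>?b. scale (c y) y) \<in> V" and y0: "y0 \<in> ?b" for c y0
    proof (rule ccontr)
      assume c: "c y0 \<noteq> 0"
      let ?S = "span (B1 - {y0})"
      have 1: "(\<Sum>y\<in>?b. scale (c y) y) \<in> ?S"
        using s y0 span_mono[of B0 "B1 - {y0}"] B1(1) by (auto simp: sB0[symmetric])
      have 2: "(\<Sum>y\<in>?b - {y0}. scale (c y) y) \<in> ?S"
        by (intro span_sum span_scale span_base) auto
      have 3: "(\<Sum>y\<in>?b. scale (c y) y) = scale (c y0) y0 + (\<Sum>y\<in>?b - {y0}. scale (c y) y)"
        by (rule sum.remove[OF fin y0])
      have "scale (c y0) y0 \<in> ?S" using span_diff[OF 1 2] by (simp add: 3)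
      then have "scale (inverse (c y0)) (scale (c y0) y0) \<in> ?S" by (rule span_scale)
      then have "y0 \<in> ?S" using c by simp
      then show False using B1(3) y0 unfolding dependent_def by blast
    qed
  qed
qed

abbreviation nonneg :: "bideg \<Rightarrow> bool" where "nonneg p \<equiv> 0 \<le> fst p \<and> 0 \<le> snd p"

context graded_ring
begin

lemma mat_apply_as_sum:
  assumes "finite T" "{j. x j \<noteq> 0} \<subseteq> T"
  shows "mat_apply (*) D x = (\<Sum>j\<in>T. pointwise (*) (x j) (D j :: nat \<Rightarrow> 'a))"
proof
  fix k
  have "(\<Sum>j\<in>T. pointwise (*) (x j) (D j)) k = (\<Sum>j\<in>T. x j * D j k)"
    by (simp add: sum_fun_apply pointwise_def)
  then show "mat_apply (*) D x k = (\<Sum>j\<in>T. pointwise (*) (x j) (D j)) k"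
    using mat_apply_eq_sum[OF module_mult assms] by (simp add: mult.commute)
qed

lemma graded_module_image:
  assumes h: "graded_hom sm1 sm2 L M \<phi>" and L: "graded_module sm1 L" and M: "graded_module sm2 M"
  shows "graded_module sm2 (\<lambda>p. \<phi> ` L p)"
  unfolding graded_module_def
proof (intro conjI allI ballI)
  show "Modules.module sm2" by (rule graded_moduleD(1)[OF M])
  show "0 \<in> \<phi> ` L p" for p by (metis (no_types) graded_hom_zero[OF h L] graded_moduleD(2)[OF L] imageI)
  show "x - y \<in> \<phi> ` L p" if "x \<in> \<phi> ` L p" "y \<in> \<phi> ` L p" for x y p
  proof -
    from that obtain u v where uv: "u \<in> L p" "v \<in> L p" "x = \<phi> u" "y = \<phi> v" by blast
    have "x - y = \<phi> (u - v)" using graded_hom_diff[OF h L uv(1,2)] uv by simp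
    then show ?thesis using graded_moduleD(3)[OF L uv(1,2)] by blast
  qed
  show "sm2 a x \<in> \<phi> ` L (p + q)" if "a \<in> A p" "x \<in> \<phi> ` L q" for a x p q
  proof -
    from that obtain u where u: "u \<in> L q" "x = \<phi> u" by blast
    have "sm2 a x = \<phi> (sm1 a u)" using graded_homD(3)[OF h that(1) u(1)] u by simp
    then show ?thesis using graded_moduleD(4)[OF L that(1) u(1)] by blast
  qed
qed

text \<open>
  In a minimal complex \<open>F\<close> the differential of \<open>F / A\<^sub>+ F\<close> is zero, so each basis vector is a nonzero class.
\<close>

lemma minimal_tor_nonzero:
  assumes "resolution I B \<delta> r D" "\<And>i p. syz I B \<delta> r D i p \<subseteq> irr_part (B i) (\<delta> i) p" "j \<in> B i"
  shows "\<not> tor_zero_via B \<delta> D i (\<delta> i j)"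
proof
  assume T: "tor_zero_via B \<delta> D i (\<delta> i j)"
  let ?e = "unit_vec j"
  have e: "?e \<in> shift_sum (B i) (\<delta> i) A (\<delta> i j)" by (rule unit_vec_mem[OF assms(3)])
  have im: "mat_apply (*) (D k) x \<in> irr_part (B k) (\<delta> k) p" if "x \<in> shift_sum (B (Suc k)) (\<delta> (Suc k)) A p" for k x p
    using resolution_image[OF assms(1), of k p] assms(2)[of k p] that by blast
  obtain y where y: "y \<in> shift_sum (B (Suc i)) (\<delta> (Suc i)) A (\<delta> i j)"
      "?e - mat_apply (*) (D i) y \<in> irr_part (B i) (\<delta> i) (\<delta> i j)"
    using T e im unfolding tor_zero_via_def by metis
  from im[OF y(1)] y(2) have "?e j = 0" by (auto simp: irr_part_def)
  then show False by (simp add: unit_vec_def)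
qed

end

text \<open>
  The base field enters through an embedding \<open>emb\<close> of a type of class \<open>field\<close> onto \<open>A 0\<close>, so that the
  linear algebra of \<open>vector_space\<close> applies.
\<close>

locale graded_algebra = graded_ring A for A :: "bideg \<Rightarrow> 'a::comm_ring_1 set" +
  fixes emb :: "'k::field \<Rightarrow> 'a"
  assumes emb_add: "emb (x + y) = emb x + emb y" and emb_mult: "emb (x * y) = emb x * emb y"
    and emb_one: "emb 1 = 1" and A0: "A 0 = range emb"
    and A_fin: "\<exists>T. finite T \<and> (\<forall>x\<in>A p. \<exists>c. x = (\<Sum>y\<in>T. emb (c y) * y))"
begin

definition scal :: "'k \<Rightarrow> (nat \<Rightarrow> 'a) \<Rightarrow> nat \<Rightarrow> 'a" where "scal c = pointwise (*) (emb c)"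

sublocale VS: vector_space scal
  by standard (auto simp: scal_def pointwise_def fun_eq_iff emb_add emb_mult emb_one algebra_simps)

lemma emb_mem: "emb c \<in> A 0" by (simp add: A0)

lemma emb_zero: "emb 0 = 0" using emb_add[of 0 0] by simp

lemma graded_module_subspace: "graded_module (pointwise (*)) L \<Longrightarrow> VS.subspace (L p)"
  unfolding VS.subspace_def scal_def
  using graded_moduleD(2)[of "pointwise (*)" L p] graded_module_add[of "pointwise (*)" L _ p] graded_module_scale[of "pointwise (*)" L "emb _" 0 _ p p] emb_mem
  by auto

definition single_entry :: "nat \<Rightarrow> 'a \<Rightarrow> nat \<Rightarrow> 'a" where "single_entry j y = (\<lambda>k. if k = j then y else 0)"

text \<open>
  Only the finitely many basis elements of bidegree at most \<open>p\<close> contribute to the component of bidegree \<open>p\<close>.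
\<close>

lemma shift_sum_finite_span:
  assumes fin: "finite {j \<in> B. nonneg (p - \<delta> j)}"
  obtains T where "finite T" "shift_sum B \<delta> A p \<subseteq> VS.span T"
proof -
  let ?J = "{j \<in> B. nonneg (p - \<delta> j)}"
  obtain T where T: "\<And>p. finite (T p)" "\<And>p x. x \<in> A p \<Longrightarrow> \<exists>c. x = (\<Sum>y\<in>T p. emb (c y) * y)"
    using A_fin by metis
  let ?U = "\<Union>j\<in>?J. single_entry j ` T (p - \<delta> j)"
  have "f \<in> VS.span ?U" if f: "f \<in> shift_sum B \<delta> A p" for f
  proof -
    have "f = (\<Sum>j\<in>?J. single_entry j (f j))"
    proof
      fix k
      have "(\<Sum>j\<in>?J. single_entry j (f j)) k = (\<Sum>j\<in>?J. single_entry j (f j) k)"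
        by (rule sum_fun_apply)
      also have "\<dots> = (if k \<in> ?J then f k else 0)"
        using fin by (simp add: single_entry_def)
      also have "\<dots> = f k"
        using shift_sumD(2)[OF f, of k] shift_sumD(3)[OF f, of k] A_neg[of "p - \<delta> k"] by auto
      finally show "f k = (\<Sum>j\<in>?J. single_entry j (f j)) k" by simp
    qed
    moreover have "single_entry j (f j) \<in> VS.span ?U" if j: "j \<in> ?J" for j
    proof -
      obtain c where c: "f j = (\<Sum>y\<in>T (p - \<delta> j). emb (c y) * y)"
        using T(2) shift_sumD(3)[OF f] j by blast
      have "single_entry j (\<Sum>y\<in>S. emb (c y) * y) = (\<Sum>y\<in>S. scal (c y) (single_entry j y))" if "finite S" for S
        by (auto simp: single_entry_def scal_def pointwise_def fun_eq_iff sum_fun_apply)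
      then have "single_entry j (f j) = (\<Sum>y\<in>T (p - \<delta> j). scal (c y) (single_entry j y))" using c T(1) by simp
      also have "\<dots> \<in> VS.span ?U"
        by (intro VS.span_sum VS.span_scale VS.span_base) (use j in auto)
      finally show ?thesis .
    qed
    ultimately show ?thesis by (metis (no_types, lifting) VS.span_sum)
  qed
  moreover have "finite ?U" using fin T(1) by auto
  ultimately show ?thesis using that by blast
qed

text \<open>
  In each bidegree \<open>p\<close> choose a basis \<open>b p\<close> of \<open>N / A\<^sub>+ N\<close>.  These elements generate \<open>N\<close> by the graded
  Nakayama lemma, and a relation among them has no coefficient in the base field, because the classes
  are linearly independent.  The basis is countable, and finite up to each bidegree, which is what
  the next step of a resolution needs.
\<close>

lemma minimal_cover:
  assumes nonnegB: "\<forall>j\<in>B. nonneg (\<delta> j)" and lf: "\<And>p. finite {j \<in> B. nonneg (p - \<delta> j)}"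
    and N: "graded_module (pointwise (*)) N" and NF: "\<And>p. N p \<subseteq> shift_sum B \<delta> A p"
  shows "\<exists>B' \<delta>' D. (\<forall>j\<in>B'. nonneg (\<delta>' j)) \<and> (\<forall>p. finite {j \<in> B'. nonneg (p - \<delta>' j)}) \<and>
    columns B' \<delta>' B \<delta> D \<and> (\<forall>p. mat_apply (*) D ` shift_sum B' \<delta>' A p = N p) \<and>
    (\<forall>p. \<forall>x\<in>shift_sum B' \<delta>' A p. mat_apply (*) D x = 0 \<longrightarrow> x \<in> irr_part B' \<delta>' p)"
proof -
  define G where "G p = {pointwise (*) a y | a y q. q \<noteq> 0 \<and> a \<in> A q \<and> y \<in> N (p - q)}" for p
  define V where "V p = VS.span (G p)" for p
  have GN: "G p \<subseteq> N p" for p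
  proof
    fix z assume "z \<in> G p"
    then obtain a y q where z: "z = pointwise (*) a y" "a \<in> A q" "y \<in> N (p - q)" unfolding G_def by blast
    show "z \<in> N p" unfolding z(1) by (rule graded_module_scale[OF N z(2,3)]) simp
  qed
  have VN: "V p \<subseteq> N p" for p unfolding V_def
    by (rule VS.span_minimal[OF GN graded_module_subspace[OF N]])
  have "\<exists>b. finite b \<and> b \<subseteq> N p \<and> (\<forall>x\<in>N p. \<exists>c. x - (\<Sum>y\<in>b. scal (c y) y) \<in> V p) \<and>
      (\<forall>c. (\<Sum>y\<in>b. scal (c y) y) \<in> V p \<longrightarrow> (\<forall>y\<in>b. c y = 0))" for p
  proof -
    obtain T where T: "finite T" "shift_sum B \<delta> A p \<subseteq> VS.span T" using shift_sum_finite_span[OF lf] by blast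
    have "N p \<subseteq> VS.span T" using T NF by blast
    then show ?thesis
      unfolding V_def
      by (rule VS.complement_basis[OF graded_module_subspace[OF N] VS.subspace_span VN[unfolded V_def] _ T(1)])
  qed
  then have "\<exists>b. \<forall>p. finite (b p) \<and> b p \<subseteq> N p \<and> (\<forall>x\<in>N p. \<exists>c. x - (\<Sum>y\<in>b p. scal (c y) y) \<in> V p) \<and>
      (\<forall>c. (\<Sum>y\<in>b p. scal (c y) y) \<in> V p \<longrightarrow> (\<forall>y\<in>b p. c y = 0))"
    by (intro choice allI)
  then obtain b where "\<forall>p. finite (b p) \<and> b p \<subseteq> N p \<and> (\<forall>x\<in>N p. \<exists>c. x - (\<Sum>y\<in>b p. scal (c y) y) \<in> V p) \<and>
      (\<forall>c. (\<Sum>y\<in>b p. scal (c y) y) \<in> V p \<longrightarrow> (\<forall>y\<in>b p. c y = 0))" by (rule exE)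
  note b = this[THEN spec, THEN conjunct1] this[THEN spec, THEN conjunct2, THEN conjunct1]
    this[THEN spec, THEN conjunct2, THEN conjunct2, THEN conjunct1, THEN bspec]
    this[THEN spec, THEN conjunct2, THEN conjunct2, THEN conjunct2, THEN spec, THEN mp, THEN bspec]
  define T where "T = (SIGMA p:{p. nonneg p}. b p)"
  have cT: "countable T" unfolding T_def using b(1) by (intro countable_SIGMA) (auto intro: countable_finite)
  \<comment> \<open>The new basis is the image under \<open>e\<close> of the set \<open>T\<close> of all generators, each paired with its bidegree.\<close>
  define e where "e = to_nat_on T"
  have inj: "inj_on e T" unfolding e_def by (rule inj_on_to_nat_on[OF cT])
  define B' where "B' = e ` T"
  define g where "g = inv_into T e"
  have ge: "g (e t) = t" if "t \<in> T" for t unfolding g_def by (rule inv_into_f_f[OF inj that])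
  define \<delta>' where "\<delta>' j = fst (g j)" for j
  define D where "D j = snd (g j)" for j
  have B'E: "nonneg (\<delta>' j) \<and> D j \<in> b (\<delta>' j) \<and> j = e (\<delta>' j, D j)" if "j \<in> B'" for j
  proof -
    obtain t where t: "t \<in> T" "j = e t" using \<open>j \<in> B'\<close> by (auto simp: B'_def)
    show ?thesis using t ge[OF t(1)] by (auto simp: \<delta>'_def D_def T_def)
  qed
  have B'I: "e (q, y) \<in> B' \<and> \<delta>' (e (q, y)) = q \<and> D (e (q, y)) = y" if "nonneg q" "y \<in> b q" for q y
    using ge[of "(q, y)"] that by (auto simp: B'_def T_def \<delta>'_def D_def)
  have 1: "nonneg (\<delta>' j)" if "j \<in> B'" for j using B'E[OF that] by blast
  have 2: "finite {j \<in> B'. nonneg (p - \<delta>' j)}" for p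
  proof -
    have "{q. nonneg q \<and> nonneg (p - q)} \<subseteq> {0..fst p} \<times> {0..snd p}" by auto
    then have "finite {q. nonneg q \<and> nonneg (p - q)}" by (rule finite_subset) auto
    then have "finite (SIGMA q:{q. nonneg q \<and> nonneg (p - q)}. b q)" using b(1) by blast
    moreover have "{j \<in> B'. nonneg (p - \<delta>' j)} \<subseteq> e ` (SIGMA q:{q. nonneg q \<and> nonneg (p - q)}. b q)"
      using B'E by (auto simp: image_iff)
    ultimately show ?thesis by (meson finite_imageI finite_subset)
  qed
  have DN: "D j \<in> N (\<delta>' j)" if "j \<in> B'" for j using B'E[OF that] b(2) by blast
  have 3: "columns B' \<delta>' B \<delta> D" unfolding columns_def using DN NF by blast
  note gF' = graded_module_shift_sum[OF graded_module_A, of B' \<delta>'] and gF = graded_module_shift_sum[OF graded_module_A, of B \<delta>]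
  define Im where "Im p = mat_apply (*) D ` shift_sum B' \<delta>' A p" for p
  have gIm: "graded_module (pointwise (*)) Im"
    unfolding Im_def by (rule graded_module_image[OF graded_hom_mat_apply_mult[OF 3] gF' gF])
  have ImN: "Im p \<subseteq> N p" for p
  proof
    fix z assume "z \<in> Im p"
    then obtain x where x: "x \<in> shift_sum B' \<delta>' A p" "z = mat_apply (*) D x" by (auto simp: Im_def)
    have "z = (\<Sum>j | x j \<noteq> 0. pointwise (*) (x j) (D j))"
      unfolding x(2) by (rule mat_apply_as_sum[OF shift_sumD(1)[OF x(1)]]) simp
    also have "\<dots> \<in> N p"
    proof (rule graded_module_sum[OF N])
      fix j assume "j \<in> {j. x j \<noteq> 0}"
      then have j: "j \<in> B'" using shift_sumD(4)[OF x(1)] by blast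
      show "pointwise (*) (x j) (D j) \<in> N p"
        by (rule graded_module_scale[OF N shift_sumD(3)[OF x(1) j] DN[OF j]]) simp
    qed
    finally show "z \<in> N p" .
  qed
  have bIm: "y \<in> Im p" if "nonneg p" "y \<in> b p" for p y
  proof -
    have "mat_apply (*) D (unit_vec (e (p, y))) \<in> Im p"
      unfolding Im_def using unit_vec_mem[of "e (p, y)" B' \<delta>'] B'I[OF that] by (intro imageI) simp
    then show ?thesis using B'I[OF that] by simp
  qed
  have Nneg: "N p = {0}" if "\<not> nonneg p" for p
  proof -
    have "x = 0" if x: "x \<in> N p" for x
    proof
      fix j
      have x': "x \<in> shift_sum B \<delta> A p" using x NF by blast
      show "x j = 0 j"
      proof (cases "j \<in> B")
        case True
        then have "\<not> nonneg (p - \<delta> j)" using bspec[OF nonnegB True] \<open>\<not> nonneg p\<close> by auto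
        then show ?thesis using shift_sumD(3)[OF x' True] A_neg by simp
      qed (use shift_sumD(2)[OF x'] in simp)
    qed
    then show ?thesis using graded_moduleD(2)[OF N] by blast
  qed
  have NIm: "N p \<subseteq> Im p" for p
  \<comment> \<open>Nakayama: elements of \<open>A\<^sub>+ N\<close> are combinations of elements of \<open>N\<close> of smaller total degree.\<close>
  proof (induction "nat (fst p + snd p)" arbitrary: p rule: less_induct)
    case less
    show ?case
    proof (cases "nonneg p")
      case False
      then show ?thesis using Nneg graded_moduleD(2)[OF gIm] by auto
    next
      case True
      have "G p \<subseteq> Im p"
      proof
        fix z assume "z \<in> G p"
        then obtain a y q where z: "z = pointwise (*) a y" "q \<noteq> 0" "a \<in> A q" "y \<in> N (p - q)" by (auto simp: G_def)
        show "z \<in> Im p"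
        proof (cases "nonneg q \<and> nonneg (p - q)")
          case True
          have "nat (fst (p - q) + snd (p - q)) < nat (fst p + snd p)"
            using True z(2) by (cases p; cases q) (auto simp: zero_prod_def)
          then have "y \<in> Im (p - q)" using less z(4) by blast
          then show ?thesis unfolding z(1) by (rule graded_module_scale[OF gIm z(3)]) simp
        next
          case False
          then have "a = 0 \<or> y = 0" using z A_neg[of q] Nneg[of "p - q"] by blast
          then have "z = 0" by (auto simp: z(1) pointwise_def fun_eq_iff)
          then show ?thesis using graded_moduleD(2)[OF gIm] by simp
        qed
      qed
      then have VI: "V p \<subseteq> Im p" unfolding V_def by (rule VS.span_minimal[OF _ graded_module_subspace[OF gIm]])
      show ?thesis
      proof
        fix x assume "x \<in> N p"
        then obtain c where c: "x - (\<Sum>y\<in>b p. scal (c y) y) \<in> V p" using b(3) by blast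
        have "(\<Sum>y\<in>b p. scal (c y) y) \<in> Im p"
          by (rule graded_module_sum[OF gIm]) (auto intro: VS.subspace_scale[OF graded_module_subspace[OF gIm]] bIm[OF True])
        with c VI graded_module_add[OF gIm, of _ p] show "x \<in> Im p" by (metis diff_add_cancel subsetD)
      qed
    qed
  qed
  have 4: "mat_apply (*) D ` shift_sum B' \<delta>' A p = N p" for p
    using ImN[of p] NIm[of p] by (simp add: Im_def)
  have 5: "x \<in> irr_part B' \<delta>' p" if x: "x \<in> shift_sum B' \<delta>' A p" and Dx: "mat_apply (*) D x = 0" for x p
    unfolding irr_part_def
  proof (intro CollectI conjI allI impI)
    show "x \<in> shift_sum B' \<delta>' A p" by fact
    fix j0 assume j0: "\<delta>' j0 = p"
    show "x j0 = 0"
    proof (cases "j0 \<in> B'")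
      case True
      have nnp: "nonneg p" using 1[OF True] j0 by simp
      let ?J = "{j \<in> B'. \<delta>' j = p}" and ?K = "{j. x j \<noteq> 0 \<and> \<delta>' j \<noteq> p}"
      have Jeq: "?J = (\<lambda>y. e (p, y)) ` b p"
        using B'E B'I[OF nnp] by (auto simp: image_iff)
      have injp: "inj_on (\<lambda>y. e (p, y)) (b p)"
        using B'I[OF nnp] by (intro inj_onI) metis
      have fJ: "finite ?J" unfolding Jeq using b(1) by simp
      have fK: "finite ?K" by (rule finite_subset[OF _ shift_sumD(1)[OF x]]) auto
      have "{j. x j \<noteq> 0} \<subseteq> ?J \<union> ?K" using shift_sumD(4)[OF x] by auto
      then have "mat_apply (*) D x = (\<Sum>j\<in>?J \<union> ?K. pointwise (*) (x j) (D j))"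
        by (rule mat_apply_as_sum[rotated]) (use fJ fK in auto)
      also have "\<dots> = (\<Sum>j\<in>?J. pointwise (*) (x j) (D j)) + (\<Sum>j\<in>?K. pointwise (*) (x j) (D j))"
        by (rule sum.union_disjoint[OF fJ fK]) auto
      \<comment> \<open>Modulo \<open>A\<^sub>+ N\<close> only the generators of bidegree \<open>p\<close> survive in the relation.\<close>
      finally have s: "(\<Sum>j\<in>?J. pointwise (*) (x j) (D j)) = - (\<Sum>j\<in>?K. pointwise (*) (x j) (D j))"
        using Dx by (simp add: eq_neg_iff_add_eq_0)
      have "(\<Sum>j\<in>?K. pointwise (*) (x j) (D j)) \<in> V p"
        unfolding V_def
      proof (intro VS.span_sum VS.span_base)
        fix j assume "j \<in> ?K"
        then have j: "j \<in> B'" "\<delta>' j \<noteq> p" using shift_sumD(4)[OF x] by auto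
        show "pointwise (*) (x j) (D j) \<in> G p"
          unfolding G_def using j shift_sumD(3)[OF x j(1)] DN[OF j(1)]
          by (intro CollectI exI[of _ "x j"] exI[of _ "D j"] exI[of _ "p - \<delta>' j"]) auto
      qed
      then have sV: "(\<Sum>j\<in>?J. pointwise (*) (x j) (D j)) \<in> V p"
        unfolding s V_def by (rule VS.span_neg)
      have "\<exists>c. x (e (p, y)) = emb c" if "y \<in> b p" for y
        using shift_sumD(3)[OF x, of "e (p, y)"] B'I[OF nnp that] A0 by auto
      then obtain c where c: "\<And>y. y \<in> b p \<Longrightarrow> x (e (p, y)) = emb (c y)" by metis
      have "(\<Sum>j\<in>?J. pointwise (*) (x j) (D j)) = (\<Sum>y\<in>b p. pointwise (*) (x (e (p, y))) (D (e (p, y))))"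
        unfolding Jeq using sum.reindex[OF injp] by simp
      also have "\<dots> = (\<Sum>y\<in>b p. scal (c y) y)"
        by (rule sum.cong[OF refl]) (use c B'I[OF nnp] in \<open>simp add: scal_def\<close>)
      finally have "\<And>y. y \<in> b p \<Longrightarrow> c y = 0" using b(4) sV by metis
      moreover have "D j0 \<in> b p" "j0 = e (p, D j0)" using B'E[OF True] j0 by auto
      ultimately show ?thesis using c emb_zero by metis
    qed (use shift_sumD(2)[OF x] in simp)
  qed
  show ?thesis using 1 2 3 4 5 by (intro exI[of _ B'] exI[of _ \<delta>'] exI[of _ D]) blast
qed

text \<open>
  Iterate \<open>minimal_cover\<close>, starting with \<open>I\<close> as a submodule of \<open>A\<close>.  If \<open>1\<close> is not in \<open>I\<close>, then \<open>I\<close> is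
  contained in \<open>A\<^sub>+\<close>, and the resolution is minimal from the very first step.
\<close>

lemma minimal_resolution:
  assumes I: "graded_module (*) I" and IA: "\<And>p. I p \<subseteq> A p"
  shows "\<exists>B \<delta> D. resolution I B \<delta> (\<lambda>_. 1) D \<and> B 0 = {0} \<and> \<delta> 0 0 = 0 \<and>
    (\<forall>i. \<forall>j\<in>B i. nonneg (\<delta> i j)) \<and>
    (1 \<notin> I 0 \<longrightarrow> (\<forall>i p. syz I B \<delta> (\<lambda>_. 1) D i p \<subseteq> irr_part (B i) (\<delta> i) p))"
proof -
  \<comment> \<open>A state consists of the basis, its bidegrees and the submodule that has to be covered next.\<close>
  define P where "P n s \<longleftrightarrow> (case s of (B, \<delta>, N) \<Rightarrow> (\<forall>j\<in>B. nonneg (\<delta> j)) \<and> (\<forall>p. finite {j \<in> B. nonneg (p - \<delta> j)}) \<and>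
     graded_module (pointwise (*)) N \<and> (\<forall>p. N p \<subseteq> shift_sum B \<delta> A p) \<and>
     (if n = 0 then B = {0} \<and> \<delta> = (\<lambda>_. 0) \<and> N = (\<lambda>p. {x \<in> shift_sum {0} (\<lambda>_. 0) A p. x 0 \<in> I p})
      else \<forall>p. N p \<subseteq> irr_part B \<delta> p))" for n :: nat and s :: "nat set \<times> (nat \<Rightarrow> bideg) \<times> (bideg \<Rightarrow> (nat \<Rightarrow> 'a) set)"
  define Q where "Q n s s' \<longleftrightarrow> (case s of (B, \<delta>, N) \<Rightarrow> case s' of (B', \<delta>', N') \<Rightarrow> \<exists>D. columns B' \<delta>' B \<delta> D \<and>
     (\<forall>p. mat_apply (*) D ` shift_sum B' \<delta>' A p = N p) \<and> N' = (\<lambda>p. {x \<in> shift_sum B' \<delta>' A p. mat_apply (*) D x = 0}))"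
     for n :: nat and s s' :: "nat set \<times> (nat \<Rightarrow> bideg) \<times> (bideg \<Rightarrow> (nat \<Rightarrow> 'a) set)"
  have "\<exists>f. \<forall>n. P n (f n) \<and> Q n (f n) (f (Suc n))"
  proof (rule dependent_nat_choice)
    let ?N = "\<lambda>p. {x \<in> shift_sum {0::nat} (\<lambda>_. 0) A p. x 0 \<in> I p}"
    have g: "graded_module (pointwise (*)) (shift_sum {0} (\<lambda>_. 0) A)" by (rule graded_module_shift_sum[OF graded_module_A])
    have "graded_module (pointwise (*)) ?N"
      unfolding graded_module_def
      using graded_moduleD(2,3,4)[OF g] graded_moduleD(2,3,4)[OF I]
      by (auto simp: module_pointwise[OF module_mult]) (auto simp: pointwise_def)
    then have "P 0 ({0}, \<lambda>_. 0, ?N)" by (auto simp: P_def)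
    then show "\<exists>x. P 0 x" by blast
  next
    fix s n assume "P n s"
    obtain B \<delta> N where s: "s = (B, \<delta>, N)" by (cases s)
    have a: "\<forall>j\<in>B. nonneg (\<delta> j)" "\<And>p. finite {j \<in> B. nonneg (p - \<delta> j)}"
      "graded_module (pointwise (*)) N" "\<And>p. N p \<subseteq> shift_sum B \<delta> A p" using \<open>P n s\<close> by (auto simp: P_def s)
    from minimal_cover[OF a] obtain B' \<delta>' D where m: "\<forall>j\<in>B'. nonneg (\<delta>' j)" "\<forall>p. finite {j \<in> B'. nonneg (p - \<delta>' j)}"
      "columns B' \<delta>' B \<delta> D" "\<forall>p. mat_apply (*) D ` shift_sum B' \<delta>' A p = N p"
      "\<forall>p. \<forall>x\<in>shift_sum B' \<delta>' A p. mat_apply (*) D x = 0 \<longrightarrow> x \<in> irr_part B' \<delta>' p"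
      by (elim exE conjE) (rule that)
    let ?N = "\<lambda>p. {x \<in> shift_sum B' \<delta>' A p. mat_apply (*) D x = 0}"
    have g': "graded_module (pointwise (*)) (shift_sum B' \<delta>' A)" by (rule graded_module_shift_sum[OF graded_module_A])
    have h: "graded_hom (pointwise (*)) (pointwise (*)) (shift_sum B' \<delta>' A) (shift_sum B \<delta> A) (mat_apply (*) D)"
      by (rule graded_hom_mat_apply_mult[OF m(3)])
    have "graded_module (pointwise (*)) ?N"
      unfolding graded_module_def
      using graded_moduleD(2,3,4)[OF g'] graded_hom_diff[OF h g'] graded_homD(3)[OF h]
      by (auto simp: module_pointwise[OF module_mult]) (auto simp: pointwise_def)
    then have "P (Suc n) (B', \<delta>', ?N)" using m by (auto simp: P_def)
    moreover have "Q n s (B', \<delta>', ?N)" using m(3,4) by (auto simp: Q_def s)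
    ultimately show "\<exists>y. P (Suc n) y \<and> Q n s y" by blast
  qed
  then obtain f where f: "\<And>n. P n (f n)" "\<And>n. Q n (f n) (f (Suc n))" by blast
  define B \<delta> N where "B n = fst (f n)" and "\<delta> n = fst (snd (f n))" and "N n = snd (snd (f n))" for n
  have fn: "f n = (B n, \<delta> n, N n)" for n by (simp add: B_def \<delta>_def N_def)
  have "\<forall>n. \<exists>D. columns (B (Suc n)) (\<delta> (Suc n)) (B n) (\<delta> n) D \<and>
     (\<forall>p. mat_apply (*) D ` shift_sum (B (Suc n)) (\<delta> (Suc n)) A p = N n p) \<and>
     N (Suc n) = (\<lambda>p. {x \<in> shift_sum (B (Suc n)) (\<delta> (Suc n)) A p. mat_apply (*) D x = 0})"
    using f(2) by (simp add: Q_def fn)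
  then have "\<exists>D. \<forall>n. columns (B (Suc n)) (\<delta> (Suc n)) (B n) (\<delta> n) (D n) \<and>
     (\<forall>p. mat_apply (*) (D n) ` shift_sum (B (Suc n)) (\<delta> (Suc n)) A p = N n p) \<and>
     N (Suc n) = (\<lambda>p. {x \<in> shift_sum (B (Suc n)) (\<delta> (Suc n)) A p. mat_apply (*) (D n) x = 0})"
    by (rule choice)
  then obtain D where "\<forall>n. columns (B (Suc n)) (\<delta> (Suc n)) (B n) (\<delta> n) (D n) \<and>
     (\<forall>p. mat_apply (*) (D n) ` shift_sum (B (Suc n)) (\<delta> (Suc n)) A p = N n p) \<and>
     N (Suc n) = (\<lambda>p. {x \<in> shift_sum (B (Suc n)) (\<delta> (Suc n)) A p. mat_apply (*) (D n) x = 0})"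
    by (rule exE)
  note D = this[THEN spec, THEN conjunct1] this[THEN spec, THEN conjunct2, THEN conjunct1, THEN spec]
    this[THEN spec, THEN conjunct2, THEN conjunct2]
  have base: "B 0 = {0}" "\<delta> 0 = (\<lambda>_. 0)" "N 0 = (\<lambda>p. {x \<in> shift_sum {0} (\<lambda>_. 0) A p. x 0 \<in> I p})"
    using f(1)[of 0] by (simp_all add: P_def fn)
  have aug: "aug (\<lambda>_. 1) x = (x 0 :: 'a)" if "x \<in> shift_sum {0} (\<lambda>_. 0) A p" for x p
  proof -
    have "{j. x j \<noteq> 0} \<subseteq> {0}" using shift_sumD(4)[OF that] by auto
    from mat_apply_eq_sum[OF module_mult _ this] show ?thesis by simp
  qed
  have N0: "N 0 p = {x \<in> shift_sum (B 0) (\<delta> 0) A p. aug (\<lambda>_. 1) x \<in> I p}" for p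
    unfolding base by (simp add: aug cong: conj_cong)
  have syz: "syz I B \<delta> (\<lambda>_. 1) D i p = N i p" for i p
    by (cases i) (simp_all add: syz_def N0 D(3))
  have R: "resolution I B \<delta> (\<lambda>_. 1) D"
    unfolding resolution_def
  proof (intro conjI allI ballI D(1))
    show "1 \<in> A (\<delta> 0 j)" for j by (simp add: base A_one)
    show "\<exists>x\<in>shift_sum (B 0) (\<delta> 0) A p. a - aug (\<lambda>_. 1) x \<in> I p" if a: "a \<in> A p" for a p
    proof -
      have s: "single_entry 0 a \<in> shift_sum {0} (\<lambda>_. 0) A p"
        by (rule shift_sumI) (use a in \<open>auto simp: single_entry_def intro: finite_subset[of _ "{0}"]\<close>)
      then show ?thesis using aug[OF s] graded_moduleD(2)[OF I]
        by (intro bexI[of _ "single_entry 0 a"]) (simp_all add: base single_entry_def)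
    qed
    show "mat_apply (*) (D 0) ` shift_sum (B 1) (\<delta> 1) A p = {x \<in> shift_sum (B 0) (\<delta> 0) A p. aug (\<lambda>_. 1) x \<in> I p}" for p
      using D(2)[of 0 p] N0 by simp
    show "mat_apply (*) (D (Suc i)) ` shift_sum (B (Suc (Suc i))) (\<delta> (Suc (Suc i))) A p
          = {x \<in> shift_sum (B (Suc i)) (\<delta> (Suc i)) A p. mat_apply (*) (D i) x = 0}" for i p
      using D(2)[of "Suc i" p] by (simp add: D(3))
  qed
  have nonneg: "nonneg (\<delta> i j)" if "j \<in> B i" for i j
    using f(1)[of i] that by (auto simp: P_def fn)
  have min: "syz I B \<delta> (\<lambda>_. 1) D i p \<subseteq> irr_part (B i) (\<delta> i) p" if u: "1 \<notin> I 0" for i p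
  proof (cases i)
    case 0
    have "I 0 = {0}"
    proof -
      have "x = 0" if "x \<in> I 0" for x
      proof (rule ccontr)
        assume "x \<noteq> 0"
        obtain c where c: "x = emb c" using \<open>x \<in> I 0\<close> IA[of 0] A0 by auto
        then have "c \<noteq> 0" using \<open>x \<noteq> 0\<close> emb_zero by auto
        have "emb (inverse c) * x \<in> I 0" by (rule graded_module_scale[OF I emb_mem that]) simp
        moreover have "emb (inverse c) * x = 1" using \<open>c \<noteq> 0\<close> by (simp add: c emb_mult[symmetric] emb_one)
        ultimately show False using u by simp
      qed
      then show ?thesis using graded_moduleD(2)[OF I, of 0] by auto
    qed
    have "x \<in> irr_part {0} (\<lambda>_. 0) p" if x: "x \<in> shift_sum {0} (\<lambda>_. 0) A p" "x 0 \<in> I p" for x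
    proof -
      have "x j = 0" if "0 = p" for j
        using x \<open>I 0 = {0}\<close> that shift_sumD(2)[OF x(1), of j] by (cases "j = 0") auto
      then show ?thesis using x by (simp add: irr_part_def)
    qed
    then show ?thesis
      unfolding syz 0 base by blast
  next
    case (Suc k)
    then show ?thesis using f(1)[of i] by (simp add: P_def fn syz)
  qed
  show ?thesis
    by (intro exI[of _ B] exI[of _ \<delta>] exI[of _ D] conjI R base(1) allI ballI impI nonneg min) (simp_all add: base)
qed

end

section \<open>Veronese modules spanned by monomials\<close>

abbreviation lookup :: "('a \<Rightarrow>\<^sub>0 'b::zero) \<Rightarrow> 'a \<Rightarrow> 'b" where "lookup \<equiv> Poly_Mapping.lookup"
abbreviation keys :: "('a \<Rightarrow>\<^sub>0 'b::zero) \<Rightarrow> 'a set" where "keys \<equiv> Poly_Mapping.keys"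
abbreviation single :: "'a \<Rightarrow> 'b::zero \<Rightarrow> 'a \<Rightarrow>\<^sub>0 'b" where "single \<equiv> Poly_Mapping.single"

lemma lookup_single_mult:
  fixes g :: "('a::cancel_comm_monoid_add) \<Rightarrow>\<^sub>0 'b::comm_semiring_1"
  shows "lookup (single a c * g) (a + \<nu>) = c * lookup g \<nu>"
proof -
  have "lookup (single a c * g) (a + \<nu>)
     = (\<Sum>l. (c when a = l) * (\<Sum>q. lookup g q when a + \<nu> = l + q))"
    by (simp add: lookup_mult lookup_single)
  also have "\<dots> = (\<Sum>l. (c * (\<Sum>q. lookup g q when a + \<nu> = l + q)) when a = l)"
    by (intro Sum_any.cong) (simp add: when_def)
  also have "\<dots> = c * (\<Sum>q. lookup g q when \<nu> = q)" by simp
  finally show ?thesis by simp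
qed

lemma keys_single_mult:
  fixes g :: "('a::cancel_comm_monoid_add) \<Rightarrow>\<^sub>0 'b::comm_semiring_1"
  shows "keys (single a 1 * g) = (+) a ` keys g"
proof
  show "keys (single a 1 * g) \<subseteq> (+) a ` keys g"
    using keys_mult[of "single a 1" g] by (auto split: if_splits)
  show "(+) a ` keys g \<subseteq> keys (single a 1 * g)"
    by (auto simp: in_keys_iff lookup_single_mult)
qed

lemma bidegree_add: "bidegree n m (\<mu> + \<nu>) = bidegree n m \<mu> + bidegree n m \<nu>"
  by (simp add: bidegree_def lookup_add sum.distrib)

lemma bidegree_0 [simp]: "bidegree n m 0 = 0"
  by (simp add: bidegree_def zero_prod_def)

lemma bidegree_nonneg: "nonneg (bidegree n m \<mu>)"
  unfolding bidegree_def by (simp add: sum_nonneg)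

lemma keys_add_nat: "keys (\<mu> + \<nu> :: monomial) = keys \<mu> \<union> keys \<nu>"
  by (auto simp: in_keys_iff lookup_add)

lemma finite_monomials: "finite {\<mu>. keys \<mu> \<subseteq> vars n m \<and> bidegree n m \<mu> = p}"
proof -
  have fv: "finite (vars n m)" by (simp add: vars_def)
  let ?N = "nat (fst p + snd p)"
  let ?S = "{f. \<forall>x. (x \<in> vars n m \<longrightarrow> f x \<in> {..?N}) \<and> (x \<notin> vars n m \<longrightarrow> f x = (0::nat))}"
  have "finite ?S" by (rule finite_set_of_finite_funs) (use fv in auto)
  moreover have "lookup ` {\<mu>. keys \<mu> \<subseteq> vars n m \<and> bidegree n m \<mu> = p} \<subseteq> ?S"
  proof
    fix f assume "f \<in> lookup ` {\<mu>. keys \<mu> \<subseteq> vars n m \<and> bidegree n m \<mu> = p}"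
    then obtain \<mu> where f: "f = lookup \<mu>" and k: "keys \<mu> \<subseteq> vars n m"
      and p: "bidegree n m \<mu> = p" by blast
    have "f x \<in> {..?N}" if "x \<in> vars n m" for x
    proof (cases x)
      case (Inl i)
      then have "lookup \<mu> x \<le> (\<Sum>i<n. lookup \<mu> (Inl i))"
        using that by (auto simp: vars_def intro!: member_le_sum[where f = "\<lambda>i. lookup \<mu> (Inl i)"])
      then show ?thesis by (simp add: f p[symmetric] bidegree_def nat_int_add del: of_nat_sum)
    next
      case (Inr j)
      then have "lookup \<mu> x \<le> (\<Sum>i<m. lookup \<mu> (Inr i))"
        using that by (auto simp: vars_def intro!: member_le_sum[where f = "\<lambda>i. lookup \<mu> (Inr i)"])
      then show ?thesis by (simp add: f p[symmetric] bidegree_def nat_int_add del: of_nat_sum)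
    qed
    moreover have "f x = 0" if "x \<notin> vars n m" for x using that k f by (auto simp: in_keys_iff)
    ultimately show "f \<in> ?S" by blast
  qed
  ultimately have "finite (lookup ` {\<mu>. keys \<mu> \<subseteq> vars n m \<and> bidegree n m \<mu> = p})"
    by (rule finite_subset[rotated])
  then show ?thesis by (rule finite_imageD) (simp add: inj_on_def poly_mapping_eqI)
qed

text \<open>
  With \<open>s = t = 1\<close> this is the polynomial ring itself.
\<close>

locale veronese_setup =
  fixes n m s t :: nat
begin

definition scaled :: "bideg \<Rightarrow> bideg" where "scaled p = (fst p * int s, snd p * int t)"

text \<open>
  The Veronese module of \<open>S(-c)\<close>, restricted to monomials with property \<open>\<Phi>\<close>.  In negative bidegrees it has to be
  put to zero by hand, because for \<open>s = 0\<close> the scaled bidegree forgets the first coordinate.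
\<close>

definition mon :: "(monomial \<Rightarrow> bool) \<Rightarrow> bideg \<Rightarrow> bideg \<Rightarrow> 'k::field polynomial set" where
  "mon \<Phi> c p = (if nonneg p then {f. \<forall>\<mu>\<in>keys f.
      keys \<mu> \<subseteq> vars n m \<and> bidegree n m \<mu> = scaled p - c \<and> \<Phi> \<mu>} else {0})"

abbreviation all where "all \<equiv> (\<lambda>_::monomial. True)"
abbreviation VA :: "bideg \<Rightarrow> 'k::field polynomial set" where "VA \<equiv> mon all 0"

text \<open>
  Membership of a monomial in the ideal generated by the variables in \<open>U\<close>.
\<close>

definition hits :: "(nat + nat) set \<Rightarrow> monomial \<Rightarrow> bool" where "hits U \<mu> \<longleftrightarrow> (\<exists>v\<in>U. lookup \<mu> v > 0)"

lemma scaled_add: "scaled (p + q) = scaled p + scaled q"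
  by (simp add: scaled_def algebra_simps)

lemma scaled_diff: "scaled (p - q) = scaled p - scaled q"
  by (simp add: scaled_def algebra_simps)

lemma scaled_0 [simp]: "scaled 0 = 0" by (simp add: scaled_def zero_prod_def)

lemma mon_zero: "0 \<in> mon \<Phi> c p" by (simp add: mon_def)

text \<open>
  There are no monomials of negative bidegree.
\<close>

lemma mon_eq_zero:
  assumes "\<not> nonneg (scaled q - c)"
  shows "mon \<Phi> c q = {0 :: 'k::field polynomial}"
proof (cases "nonneg q")
  case True
  have "bidegree n m \<mu> \<noteq> scaled q - c" for \<mu>
    using assms bidegree_nonneg[of n m \<mu>] by auto
  then have "f = 0" if "f \<in> mon \<Phi> c q" for f :: "'k polynomial"
    using that True by (simp add: mon_def)
  then show ?thesis using mon_zero by blast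
qed (auto simp: mon_def)

lemma mon_diff: "f \<in> mon \<Phi> c p \<Longrightarrow> g \<in> mon \<Phi> c p \<Longrightarrow> f - g \<in> mon \<Phi> c p"
  using keys_diff[of f g] by (fastforce simp: mon_def)

lemma mon_mult:
  assumes up: "\<And>\<mu> \<nu>. \<Phi> \<nu> \<Longrightarrow> \<Phi> (\<mu> + \<nu>)" and f: "f \<in> VA p" and g: "g \<in> mon \<Phi> c q"
  shows "f * g \<in> mon \<Phi> c (p + q)"
proof (cases "nonneg p \<and> nonneg q")
  case True
  then have "nonneg (p + q)" by simp
  moreover have "keys \<mu> \<subseteq> vars n m \<and> bidegree n m \<mu> = scaled (p + q) - c \<and> \<Phi> \<mu>"
    if "\<mu> \<in> keys (f * g)" for \<mu>
  proof -
    from that keys_mult[of f g] obtain a b where ab: "a \<in> keys f" "b \<in> keys g" "\<mu> = a + b"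
      by blast
    from f g True ab(1,2) have "keys a \<subseteq> vars n m" "bidegree n m a = scaled p"
      "keys b \<subseteq> vars n m" "bidegree n m b = scaled q - c" "\<Phi> b"
      by (auto simp: mon_def)
    then show ?thesis using up[of b a] by (simp add: ab(3) keys_add_nat bidegree_add scaled_add algebra_simps)
  qed
  ultimately show ?thesis by (simp add: mon_def)
next
  case False
  then have "f * g = 0" using f g by (auto simp: mon_def split: if_splits)
  then show ?thesis by (simp add: mon_zero)
qed

sublocale graded_algebra "VA :: bideg \<Rightarrow> 'k::field polynomial set" "single 0"
proof
  show "(0 :: 'k polynomial) \<in> VA p" for p by (rule mon_zero)
  show "f - g \<in> VA p" if "f \<in> VA p" "g \<in> VA p" for f g :: "'k polynomial" and p
    using that by (rule mon_diff)
  show "(1 :: 'k polynomial) \<in> VA 0"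
    by (simp add: mon_def)
  show "f * g \<in> VA (p + q)" if "f \<in> VA p" "g \<in> VA q" for f g :: "'k polynomial" and p q
    by (rule mon_mult[OF _ that]) simp
  show "VA p = {0 :: 'k polynomial}" if "\<not> nonneg p" for p using that by (auto simp: mon_def)
  show "single (0::monomial) (x + y) = single 0 x + single 0 y" for x y :: 'k
    by (rule single_add)
  show "single (0::monomial) (x * y) = single 0 x * single 0 y" for x y :: 'k
    by (simp add: mult_single)
  show "single (0::monomial) (1::'k) = 1" by simp
  show "VA 0 = range (single (0::monomial) :: 'k \<Rightarrow> 'k polynomial)"
  proof (intro equalityI subsetI)
    fix f :: "'k polynomial" assume f: "f \<in> VA 0"
    have "\<mu> = 0" if "\<mu> \<in> keys f" for \<mu>
    proof -
      have k: "keys \<mu> \<subseteq> vars n m" "bidegree n m \<mu> = 0" using f that by (auto simp: mon_def)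
      from k(2) have "(\<Sum>i<n. lookup \<mu> (Inl i)) = 0" "(\<Sum>j<m. lookup \<mu> (Inr j)) = 0"
        by (simp_all add: bidegree_def zero_prod_def del: of_nat_sum)
      then have *: "lookup \<mu> x = 0" if "x \<in> vars n m" for x
        using that by (auto simp: vars_def)
      have "lookup \<mu> x = 0" for x
        using * k(1) by (cases "x \<in> vars n m") (auto simp: in_keys_iff)
      then show ?thesis by (simp add: poly_mapping_eqI)
    qed
    then have no: "lookup f \<mu> = 0" if "\<mu> \<noteq> 0" for \<mu>
      using that by (auto simp: in_keys_iff)
    have "f = single 0 (lookup f 0)"
      by (rule poly_mapping_eqI) (simp add: lookup_single when_def no)
    then show "f \<in> range (single (0::monomial))" by blast
  next
    fix f :: "'k polynomial" assume "f \<in> range (single (0::monomial))"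
    then show "f \<in> VA 0" by (auto simp: mon_def split: if_splits)
  qed
  show "\<exists>T. finite T \<and> (\<forall>x\<in>VA p. \<exists>c. x = (\<Sum>y\<in>T. single 0 (c y) * (y :: 'k polynomial)))" for p
  proof -
    let ?M = "{\<mu>. keys \<mu> \<subseteq> vars n m \<and> bidegree n m \<mu> = scaled p}"
    let ?s = "\<lambda>\<mu>. single \<mu> (1::'k)"
    have inj: "inj_on ?s ?M"
    proof (rule inj_onI)
      fix a b :: monomial assume "?s a = ?s b"
      then have "keys (?s a) = keys (?s b)" by (rule arg_cong)
      then show "a = b" by simp
    qed
    have "\<exists>c. x = (\<Sum>y\<in>?s ` ?M. single 0 (c y) * y)" if x: "x \<in> VA p" for x :: "'k polynomial"
    proof -
      let ?c = "\<lambda>y. lookup x (inv_into ?M ?s y)"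
      have "(\<Sum>y\<in>?s ` ?M. single 0 (?c y) * y) = (\<Sum>\<mu>\<in>?M. single 0 (lookup x \<mu>) * ?s \<mu>)"
        by (subst sum.reindex[OF inj]) (auto simp: inv_into_f_f[OF inj])
      also have "\<dots> = (\<Sum>\<mu>\<in>?M. single \<mu> (lookup x \<mu>))"
        by (simp add: mult_single)
      also have "\<dots> = x"
      proof (rule poly_mapping_eqI)
        fix k
        have "lookup (\<Sum>\<mu>\<in>?M. single \<mu> (lookup x \<mu>)) k = (\<Sum>\<mu>\<in>?M. if \<mu> = k then lookup x k else 0)"
          unfolding lookup_sum by (rule sum.cong) (auto simp: lookup_single when_def)
        also have "\<dots> = (if k \<in> ?M then lookup x k else 0)"
          using finite_monomials[of n m "scaled p"] by simp
        also have "\<dots> = lookup x k"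
          using x by (auto simp: mon_def in_keys_iff split: if_splits)
        finally show "lookup (\<Sum>\<mu>\<in>?M. single \<mu> (lookup x \<mu>)) k = lookup x k" .
      qed
      finally show ?thesis by (intro exI[of _ ?c]) simp
    qed
    then show ?thesis using finite_monomials[of n m "scaled p"] by (intro exI[of _ "?s ` ?M"]) auto
  qed
qed

lemma mon_graded_module:
  assumes "\<And>\<mu> \<nu>. \<Phi> \<nu> \<Longrightarrow> \<Phi> (\<mu> + \<nu>)"
  shows "graded_module (*) (mon \<Phi> c :: bideg \<Rightarrow> 'k::field polynomial set)"
  unfolding graded_module_def
  by (intro conjI allI ballI module_mult mon_zero mon_diff mon_mult[where \<Phi> = \<Phi>, OF assms])

lemma hits_up: "hits U \<nu> \<Longrightarrow> hits U (\<mu> + \<nu>)" by (auto simp: hits_def lookup_add)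

lemma hits_graded_module: "graded_module (*) (mon (hits U) c :: bideg \<Rightarrow> 'k::field polynomial set)"
  by (rule mon_graded_module[where \<Phi> = "hits U", OF hits_up])

lemma all_graded_module: "graded_module (*) (mon all c :: bideg \<Rightarrow> 'k::field polynomial set)"
  by (rule mon_graded_module[where \<Phi> = all, OF TrueI])

lemma mon_mono: "(\<And>\<mu>. \<Phi> \<mu> \<Longrightarrow> \<Phi>' \<mu>) \<Longrightarrow> mon \<Phi> c p \<subseteq> mon \<Phi>' c p"
  by (auto simp: mon_def)

definition vdeg :: "nat + nat \<Rightarrow> bideg" where
  "vdeg v = (case v of Inl _ \<Rightarrow> (1, 0) | Inr _ \<Rightarrow> (0, 1))"

lemma bidegree_var: "v \<in> vars n m \<Longrightarrow> bidegree n m (single v (Suc 0)) = vdeg v"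
  by (auto simp: bidegree_def vars_def vdeg_def lookup_single when_def simp del: of_nat_sum split: sum.splits)

text \<open>
  The bidegree \<open>p\<close> lies beyond the claimed regularity \<open>\<lceil>c\<^sub>1 / s\<rceil>\<close> or \<open>\<lceil>c\<^sub>2 / t\<rceil>\<close> of \<open>S(-c)\<^sub>\<Delta>\<close> in homological
  degree \<open>i\<close>; the ceiling of \<open>a / s\<close> is written as \<open>- (- a div s)\<close>.  Treating both coordinates at
  once allows one induction for \<open>x\<close> and \<open>y\<close>.
\<close>

definition excess :: "nat \<Rightarrow> bideg \<Rightarrow> bideg \<Rightarrow> bool" where
  "excess i c p \<longleftrightarrow> (s > 0 \<and> fst p > int i - (- fst c div int s)) \<or> (t > 0 \<and> snd p > int i - (- snd c div int t))"

text \<open>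
  For \<open>s, t > 0\<close>, the number of variables whose degrees have to be added to \<open>c\<close> to make \<open>s\<close> and \<open>t\<close> divide the
  coordinates.
\<close>

definition dist_to_lattice :: "bideg \<Rightarrow> nat" where
  "dist_to_lattice c = nat (- fst c mod int s) + nat (- snd c mod int t)"

end

text \<open>
  The Veronese ring together with a free resolution of its residue field.
\<close>

locale veronese_tor = veronese_setup n m s t +
    tor_ring "veronese_setup.mon n m s t (\<lambda>_. True) 0 :: bideg \<Rightarrow> 'k::field polynomial set" Bp \<delta>p Dp
  for n m s t :: nat and Bp \<delta>p and Dp :: "nat \<Rightarrow> nat \<Rightarrow> nat \<Rightarrow> 'k::field polynomial"
begin

text \<open>
  The vanishing of \<open>Tor\<^sub>i(Q\<^sub>U(-c)\<^sub>\<Delta>, K)\<close> in bidegree \<open>p\<close>, where \<open>Q\<^sub>U = S/(U)\<close>.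
\<close>

abbreviation vtor :: "nat \<Rightarrow> (nat + nat) set \<Rightarrow> bideg \<Rightarrow> bideg \<Rightarrow> bool" where
  "vtor i U c p \<equiv> tor_vanishes (*) (mon all c :: bideg \<Rightarrow> 'k polynomial set) (mon (hits U) c) i p"

text \<open>
  Multiplication by \<open>v\<close> identifies \<open>Q\<^sub>U(-c - deg v)\<close> with the kernel \<open>(U, v)/(U)\<close> of \<open>Q\<^sub>U(-c) \<rightarrow> Q\<^sub>U\<^sub>\<union>\<^sub>{\<^sub>v\<^sub>}(-c)\<close>: a monomial in
  \<open>(U, v)\<close> is divisible by \<open>v\<close> or lies in \<open>(U)\<close>.
\<close>

lemma hits_insert_iso:
  assumes v: "v \<in> vars n m" "v \<notin> U"
  shows "tor_vanishes (*) (mon (hits (insert v U)) c :: bideg \<Rightarrow> 'k polynomial set) (mon (hits U) c) i p \<longleftrightarrow> vtor i U (c + vdeg v) p"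
proof -
  let ?e = "single v (Suc 0) :: monomial"
  let ?X = "single ?e (1::'k)"
  have deg: "scaled q - (c + vdeg v) + bidegree n m ?e = scaled q - c" for q
    by (simp add: bidegree_var[OF v(1)])
  have deg': "bidegree n m (?e + \<mu>) = scaled q - c \<longleftrightarrow> bidegree n m \<mu> = scaled q - (c + vdeg v)" for q \<mu>
    by (auto simp: bidegree_add bidegree_var[OF v(1)] algebra_simps)
  have kv: "keys (?e + \<mu>) \<subseteq> vars n m \<longleftrightarrow> keys \<mu> \<subseteq> vars n m" for \<mu>
    using v(1) by (simp add: keys_add_nat)
  have Qv: "hits U (?e + \<mu>) \<longleftrightarrow> hits U \<mu>" for \<mu>
    using v(2) unfolding hits_def by (intro bex_cong refl) (auto simp: lookup_add lookup_single when_def)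
  have Qi: "hits (insert v U) (?e + \<mu>)" for \<mu>
    unfolding hits_def by (intro bexI[of _ v]) (auto simp: lookup_add)
  show ?thesis
  proof (rule tor_vanishes_iso[OF all_graded_module hits_graded_module hits_graded_module hits_graded_module, where \<phi> = "\<lambda>f. ?X * f"])
    show "mon (hits U) (c + vdeg v) q \<subseteq> (mon all (c + vdeg v) q :: 'k polynomial set)" for q by (rule mon_mono) simp
    show "mon (hits U) c q \<subseteq> (mon (hits (insert v U)) c q :: 'k polynomial set)" for q
      by (rule mon_mono) (auto simp: hits_def)
    show "graded_hom (*) (*) (mon all (c + vdeg v)) (mon (hits (insert v U)) c) (\<lambda>f. ?X * f)"
      unfolding graded_hom_def
    proof (intro conjI allI ballI)
      show "?X * f \<in> mon (hits (insert v U)) c q" if "f \<in> mon all (c + vdeg v) q" for q f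
        using that by (auto simp: mon_def keys_single_mult kv deg' Qi split: if_splits)
    qed (simp_all add: algebra_simps)
    show "?X * f \<in> mon (hits U) c q \<longleftrightarrow> f \<in> mon (hits U) (c + vdeg v) q" if "f \<in> mon all (c + vdeg v) q" for q f
      using that by (auto simp: mon_def keys_single_mult kv deg' Qv split: if_splits)
    show "\<exists>x\<in>mon all (c + vdeg v) q. y - ?X * x \<in> mon (hits U) c q" if y: "y \<in> mon (hits (insert v U)) c q" for q and y :: "'k polynomial"
    proof (cases "nonneg q")
      case False
      then have "y = 0" using y by (auto simp: mon_def split: if_splits)
      then show ?thesis by (intro bexI[of _ 0]) (simp_all add: mon_zero)
    next
      case True
      have inj: "inj ((+) ?e)" by simp
      \<comment> \<open>The quotient of the part of \<open>y\<close> that is divisible by \<open>v\<close>.\<close>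
      define x where "x = Poly_Mapping.map_key ((+) ?e) y"
      have lx: "lookup x \<mu> = lookup y (?e + \<mu>)" for \<mu>
        by (simp add: x_def map_key.rep_eq[OF inj])
      have "x \<in> mon all (c + vdeg v) q"
      proof -
        have "keys \<mu> \<subseteq> vars n m \<and> bidegree n m \<mu> = scaled q - (c + vdeg v)"
          if "\<mu> \<in> keys x" for \<mu>
        proof -
          have "?e + \<mu> \<in> keys y" using that by (simp add: in_keys_iff lx)
          then show ?thesis using y True unfolding mon_def kv[of \<mu>, symmetric] deg'[symmetric] by simp
        qed
        then show ?thesis using True by (simp add: mon_def)
      qed
      moreover have "y - ?X * x \<in> mon (hits U) c q"
      proof -
        have "keys \<mu> \<subseteq> vars n m \<and> bidegree n m \<mu> = scaled q - c \<and> hits U \<mu>"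
          if mu: "\<mu> \<in> keys (y - ?X * x)" for \<mu>
        proof -
          have no: "\<mu> \<noteq> ?e + \<nu>" for \<nu>
            using mu by (auto simp: in_keys_iff lookup_minus lookup_single_mult lx)
          then have "\<mu> \<notin> keys (?X * x)" by (auto simp: keys_single_mult)
          then have my: "\<mu> \<in> keys y" using mu by (auto simp: in_keys_iff lookup_minus)
          have "lookup \<mu> v = 0"
          proof (rule ccontr)
            assume "lookup \<mu> v \<noteq> 0"
            then have "\<mu> = ?e + (\<mu> - ?e)"
              by (intro poly_mapping_eqI) (auto simp: lookup_add lookup_minus lookup_single when_def)
            with no show False by blast
          qed
          with my y True show ?thesis by (auto simp: mon_def hits_def)
        qed
        then show ?thesis using True by (simp add: mon_def)
      qed
      ultimately show ?thesis by blast
    qed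
  qed
qed

text \<open>
  Adjoin the elements of \<open>U\<close> one at a time; in each step \<open>Q\<^sub>U\<^sub>\<union>\<^sub>{\<^sub>v\<^sub>}(-c)\<close> is a quotient of
  \<open>Q\<^sub>U(-c)\<close> by a copy of \<open>Q\<^sub>U(-c - deg v)\<close>, which enters with the homological degree lowered by one.
\<close>

lemma vtor_up:
  assumes "vtor i {} c p" "\<And>k U v. i = Suc k \<Longrightarrow> U \<subseteq> vars n m \<Longrightarrow> v \<in> vars n m \<Longrightarrow> vtor k U (c + vdeg v) p"
    and "finite U" "U \<subseteq> vars n m"
  shows "vtor i U c p"
  using assms(3,4)
proof (induction U)
  case empty
  then show ?case using assms(1) by simp
next
  case (insert v U)
  show ?case
  proof (rule tor_vanishes_quotient[OF hits_graded_module[of U] hits_graded_module all_graded_module])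
    show "vtor i U c p" using insert by simp
    show "tor_vanishes (*) (mon (hits (insert v U)) c) (mon (hits U) c) k p" if "i = Suc k" for k
      using assms(2)[OF that, of U v] insert by (subst hits_insert_iso) auto
    show "mon (hits U) c q \<subseteq> (mon (hits (insert v U)) c q :: 'k polynomial set)" for q
      by (rule mon_mono) (auto simp: hits_def)
  qed (rule mon_mono, simp)
qed

text \<open>
  Remove the elements of \<open>X\<close> one at a time; in the same exact sequence \<open>Q\<^sub>U(-c)\<close> is the middle term, and all
  terms live in the same homological degree.
\<close>

lemma vtor_down:
  assumes "vtor i X c p" "\<And>U v. U \<subseteq> X \<Longrightarrow> v \<in> X \<Longrightarrow> vtor i U (c + vdeg v) p"
    and "finite X" "X \<subseteq> vars n m"
  shows "vtor i {} c p"
  using assms(3,4,1,2)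
proof (induction X)
  case empty
  then show ?case by simp
next
  case (insert v U)
  have "vtor i U c p"
  proof (rule tor_vanishes_middle[OF hits_graded_module[of U] hits_graded_module[of "insert v U"] all_graded_module])
    show "mon (hits U) c q \<subseteq> (mon (hits (insert v U)) c q :: 'k polynomial set)" for q
      by (rule mon_mono) (auto simp: hits_def)
    show "mon (hits (insert v U)) c q \<subseteq> (mon all c q :: 'k polynomial set)" for q
      by (rule mon_mono) simp
    show "tor_vanishes (*) (mon (hits (insert v U)) c) (mon (hits U) c) i p"
      using insert.prems(3)[of U v] insert by (subst hits_insert_iso) auto
    show "vtor i (insert v U) c p" by fact
  qed
  moreover have "U \<subseteq> vars n m" using insert by simp
  moreover have "vtor i U' (c + vdeg v') p" if "U' \<subseteq> U" "v' \<in> U" for U' v'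
    using insert.prems(3)[of U' v'] that by blast
  ultimately show ?case using insert.IH by blast
qed

text \<open>
  For \<open>c = (e\<^sub>1 s, e\<^sub>2 t)\<close> the module \<open>S(-c)\<^sub>\<Delta>\<close> is the free module \<open>A(-e)\<close>.  When \<open>s = 0\<close> the coordinate \<open>e\<^sub>1\<close> is not
  determined by \<open>c\<close>; choosing \<open>0\<close> makes the negative bidegrees of both sides agree.
\<close>

lemma vtor_lattice:
  assumes c: "c = scaled e" "nonneg e" and p: "i > 0 \<or> p \<noteq> e"
    and e: "s = 0 \<Longrightarrow> fst e = 0" "t = 0 \<Longrightarrow> snd e = 0"
  shows "vtor i {} c p"
proof -
  have "mon all c q = (VA (q - e) :: 'k polynomial set)" for q
  proof (cases "nonneg q")
    case True
    show ?thesis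
    proof (cases "nonneg (q - e)")
      case False
      have "\<not> nonneg (scaled (q - e))"
      proof
        assume *: "nonneg (scaled (q - e))"
        have "0 \<le> fst (q - e)"
        proof (cases "s = 0")
          case False
          with * show ?thesis by (simp add: scaled_def zero_le_mult_iff)
        qed (use e(1) True in simp)
        moreover have "0 \<le> snd (q - e)"
        proof (cases "t = 0")
          case False
          with * show ?thesis by (simp add: scaled_def zero_le_mult_iff)
        qed (use e(2) True in simp)
        ultimately show False using False by blast
      qed
      then have "mon all c q = ({0} :: 'k polynomial set)"
        unfolding c(1) scaled_diff by (rule mon_eq_zero)
      then show ?thesis using False by (auto simp: mon_def)
    qed (simp add: mon_def c scaled_diff True)
  next
    case False
    then have "\<not> nonneg (q - e)" using c(2) by auto
    with False show ?thesis by (auto simp: mon_def)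
  qed
  then have 1: "mon all c = (\<lambda>q. VA (q - e) :: 'k polynomial set)" by (simp add: fun_eq_iff)
  have 2: "mon (hits {}) c = (\<lambda>_. {0 :: 'k polynomial})"
    by (auto simp: mon_def hits_def fun_eq_iff)
  show ?thesis unfolding 1 2 by (rule tor_vanishes_free[OF p])
qed

end

section \<open>Regularity of the Veronese modules\<close>

lemma div_pred:
  fixes x s :: int
  assumes "s > 0"
  shows "x div s \<le> (x - 1) div s + 1"
proof -
  have "x div s \<le> (x - 1 + s) div s" using assms by (intro zdiv_mono1) auto
  then show ?thesis using assms by simp
qed

lemma div_mod_pred:
  fixes x s :: int
  assumes "s > 0" "x mod s \<noteq> 0"
  shows "(x - 1) div s = x div s" "(x - 1) mod s = x mod s - 1"
proof -
  have r: "0 \<le> x mod s" "x mod s < s" using assms by auto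
  have "x - 1 = s * (x div s) + (x mod s - 1)" by simp
  moreover have "0 \<le> x mod s - 1" "x mod s - 1 < s" using r assms(2) by linarith+
  ultimately show "(x - 1) div s = x div s" "(x - 1) mod s = x mod s - 1"
    by (rule int_div_pos_eq, rule int_mod_pos_eq)
qed

context veronese_tor
begin

lemma vdeg_cases: "vdeg v = (1, 0) \<or> vdeg v = (0, 1)"
  by (cases v) (auto simp: vdeg_def)

lemma excess_Suc:
  assumes "excess (Suc k) c p"
  shows "excess k (c + vdeg v) p"
proof -
  obtain a b where c: "c = (a, b)" by (cases c)
  have e: "- x - 1 = - 1 - x" for x :: int by simp
  have "- a div int s \<le> (- 1 - a) div int s + 1" if "s > 0"
    using div_pred[of "int s" "- a", unfolded e] that by simp
  moreover have "- b div int t \<le> (- 1 - b) div int t + 1" if "t > 0"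
    using div_pred[of "int t" "- b", unfolded e] that by simp
  ultimately show ?thesis
    using assms vdeg_cases[of v] unfolding excess_def c by (elim disjE) (auto simp: add.commute)
qed

text \<open>
  Induction on the distance of \<open>c\<close> to the lattice.  If \<open>s > 0\<close> does not divide \<open>c\<^sub>1\<close>, then \<open>Q\<^sub>X(-c)\<^sub>\<Delta> = 0\<close> for the set \<open>X\<close> of all
  \<open>x\<^sub>i\<close>, and \<open>vtor_down\<close> reduces the claim to \<open>c\<^sub>1 + 1\<close>, with the same ceiling; similarly for \<open>t\<close>.  On the lattice the
  module is free.  Finally \<open>vtor_up\<close> passes to arbitrary \<open>U\<close>.
\<close>

lemma vtor_excess_step:
  assumes IH: "\<And>k c U. i = Suc k \<Longrightarrow> nonneg c \<Longrightarrow> excess k c p \<Longrightarrow> U \<subseteq> vars n m \<Longrightarrow> vtor k U c p"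
  shows "nonneg c \<Longrightarrow> excess i c p \<Longrightarrow> U \<subseteq> vars n m \<Longrightarrow> vtor i U c p"
proof (induction "dist_to_lattice c" arbitrary: c U rule: less_induct)
  case less
  obtain a b where c: "c = (a, b)" by (cases c)
  have ab: "a \<ge> 0" "b \<ge> 0" using less.prems(1) by (auto simp: c)
  let ?X = "Inl ` {..<n} :: (nat + nat) set" and ?Y = "Inr ` {..<m} :: (nat + nat) set"
  have zero: "vtor i {} c p" if z: "\<And>q. nonneg q \<Longrightarrow> \<not> nonneg (scaled q - c)"
  proof (rule tor_vanishes_trivial[OF all_graded_module])
    fix q
    have "mon all c q = ({0} :: 'k polynomial set)"
    proof (cases "nonneg q")
      case True
      show ?thesis by (rule mon_eq_zero[OF z[OF True]])
    qed (auto simp: mon_def)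
    then show "mon all c q \<subseteq> (mon (hits {}) c q :: 'k polynomial set)" using mon_zero by simp
  qed
  have "vtor i {} c p"
  proof (cases "s > 0 \<and> (- a) mod int s \<noteq> 0")
    case True
    note dm = div_mod_pred[of "int s" "- a"]
    show ?thesis
    proof (rule vtor_down[where X = ?X])
      show "vtor i ?X c p"
      proof (rule tor_vanishes_trivial[OF all_graded_module])
        fix q
        have "hits ?X \<mu>" if "bidegree n m \<mu> = scaled q - c" for \<mu>
        proof (rule ccontr)
          assume "\<not> hits ?X \<mu>"
          then have "fst (bidegree n m \<mu>) = 0" by (simp add: hits_def bidegree_def)
          then have "a = fst q * int s" using that by (simp add: c scaled_def)
          then show False using True by (simp add: mod_minus_eq)
        qed
        then show "mon all c q \<subseteq> (mon (hits ?X) c q :: 'k polynomial set)" by (auto simp: mon_def)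
      qed
      fix U and v :: "nat + nat" assume U: "U \<subseteq> ?X" and v: "v \<in> ?X"
      have v1: "c + vdeg v = (a + 1, b)" using v by (auto simp: c vdeg_def)
      have d1: "- (a + 1) div int s = - a div int s" "- (a + 1) mod int s = - a mod int s - 1"
        using dm True by simp_all
      show "vtor i U (c + vdeg v) p"
      proof (rule less.hyps)
        have "0 \<le> (- a) mod int s" using True by simp
        with True have "(- a) mod int s \<ge> 1" by linarith
        then show "dist_to_lattice (c + vdeg v) < dist_to_lattice c"
          unfolding dist_to_lattice_def v1 unfolding c fst_conv snd_conv d1 by linarith
        show "excess i (c + vdeg v) p"
          using less.prems(2) unfolding excess_def v1 unfolding c fst_conv snd_conv d1 .
        show "nonneg (c + vdeg v)" using ab by (simp add: v1)
        show "U \<subseteq> vars n m" using U by (auto simp: vars_def)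
      qed
    qed (auto simp: vars_def)
  next
    case x: False
    show ?thesis
    proof (cases "t > 0 \<and> (- b) mod int t \<noteq> 0")
      case True
      note dm = div_mod_pred[of "int t" "- b"]
      show ?thesis
      proof (rule vtor_down[where X = ?Y])
        show "vtor i ?Y c p"
        proof (rule tor_vanishes_trivial[OF all_graded_module])
          fix q
          have "hits ?Y \<mu>" if "bidegree n m \<mu> = scaled q - c" for \<mu>
          proof (rule ccontr)
            assume "\<not> hits ?Y \<mu>"
            then have "snd (bidegree n m \<mu>) = 0" by (simp add: hits_def bidegree_def)
            then have "b = snd q * int t" using that by (simp add: c scaled_def)
            then show False using True by (simp add: mod_minus_eq)
          qed
          then show "mon all c q \<subseteq> (mon (hits ?Y) c q :: 'k polynomial set)" by (auto simp: mon_def)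
        qed
        fix U and v :: "nat + nat" assume U: "U \<subseteq> ?Y" and v: "v \<in> ?Y"
        have v1: "c + vdeg v = (a, b + 1)" using v by (auto simp: c vdeg_def)
        have d1: "- (b + 1) div int t = - b div int t" "- (b + 1) mod int t = - b mod int t - 1"
          using dm True by simp_all
        show "vtor i U (c + vdeg v) p"
        proof (rule less.hyps)
          have "0 \<le> (- b) mod int t" using True by simp
          with True have "(- b) mod int t \<ge> 1" by linarith
          then show "dist_to_lattice (c + vdeg v) < dist_to_lattice c"
            unfolding dist_to_lattice_def v1 unfolding c fst_conv snd_conv d1 by linarith
          show "excess i (c + vdeg v) p"
            using less.prems(2) unfolding excess_def v1 unfolding c fst_conv snd_conv d1 .
          show "nonneg (c + vdeg v)" using ab by (simp add: v1)
          show "U \<subseteq> vars n m" using U by (auto simp: vars_def)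
        qed
      qed (auto simp: vars_def)
    next
      case y: False
      \<comment> \<open>For \<open>s = 0 < a\<close> or \<open>t = 0 < b\<close> the Veronese module is zero; otherwise \<open>c\<close> is in the lattice.\<close>
      consider "s = 0" "a > 0" | "t = 0" "b > 0" | "s = 0 \<longrightarrow> a = 0" "t = 0 \<longrightarrow> b = 0" using ab by linarith
      then show ?thesis
      proof cases
        case 1
        have "\<not> nonneg (scaled q - c)" for q
        proof -
          have "fst (scaled q - c) = fst q * int s - a" by (simp add: scaled_def c)
          then show ?thesis using 1 by simp
        qed
        then show ?thesis by (rule zero)
      next
        case 2
        have "\<not> nonneg (scaled q - c)" for q
        proof -
          have "snd (scaled q - c) = snd q * int t - b" by (simp add: scaled_def c)
          then show ?thesis using 2 by simp
        qed
        then show ?thesis by (rule zero)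
      next
        case 3
        have ds: "int s dvd a" using x 3(1) by (cases "s = 0") (auto simp: mod_eq_0_iff_dvd)
        have dt: "int t dvd b" using y 3(2) by (cases "t = 0") (auto simp: mod_eq_0_iff_dvd)
        let ?e = "(a div int s, b div int t)"
        have na: "- a div int s = - (a div int s)" "- b div int t = - (b div int t)"
          using ds dt by (simp_all add: dvd_neg_div)
        show ?thesis
        proof (rule vtor_lattice)
          show "c = scaled ?e" using ds dt by (simp add: c scaled_def)
          show "nonneg ?e" using ab by (cases "s = 0"; cases "t = 0") (simp_all add: pos_imp_zdiv_nonneg_iff)
          show "i > 0 \<or> p \<noteq> ?e" using less.prems(2) by (auto simp: excess_def c na)
        qed simp_all
      qed
    qed
  qed
  moreover have "vtor k U (c + vdeg v) p" if "i = Suc k" "U \<subseteq> vars n m" "v \<in> vars n m" for k U v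
  proof (rule IH[OF that(1) _ _ that(2)])
    show "nonneg (c + vdeg v)" using ab vdeg_cases[of v] by (auto simp: c)
    show "excess k (c + vdeg v) p" using less.prems(2) that(1) by (intro excess_Suc) simp
  qed
  moreover have "finite U" by (rule finite_subset[OF less.prems(3)]) (simp add: vars_def)
  ultimately show ?case by (rule vtor_up[OF _ _ _ less.prems(3)])
qed

theorem vtor_excess:
  "nonneg c \<Longrightarrow> excess i c p \<Longrightarrow> U \<subseteq> vars n m \<Longrightarrow> vtor i U c p"
proof (induction i arbitrary: c U)
  case 0
  show ?case by (rule vtor_excess_step[OF _ 0]) simp
next
  case (Suc i)
  show ?case by (rule vtor_excess_step[OF _ Suc.prems]) (use Suc.IH in simp)
qed

section \<open>The Veronese functor applied to a resolution\<close>

text \<open>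
  The Veronese functor on graded families.
\<close>

definition ver_fam :: "(bideg \<Rightarrow> 'c::zero set) \<Rightarrow> bideg \<Rightarrow> 'c set" where
  "ver_fam L p = (if nonneg p then L (scaled p) else {0})"

lemma ver_fam_neg: "\<not> nonneg p \<Longrightarrow> ver_fam L p = {0}"
  unfolding ver_fam_def by (rule if_not_P)

sublocale S1: veronese_setup n m "Suc 0" "Suc 0" .

lemma S1_scaled [simp]: "S1.scaled p = p" by (simp add: S1.scaled_def)

lemma mon_eq_S1: "nonneg p \<Longrightarrow> mon all c p = (S1.VA (scaled p - c) :: 'k polynomial set)"
proof (cases "nonneg (scaled p - c)")
  case False
  have "mon all c p = ({0} :: 'k polynomial set)" by (rule mon_eq_zero[OF False])
  then show ?thesis using mon_zero[of all c p] False by (auto simp: S1.mon_def)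
qed (auto simp: mon_def S1.mon_def)

lemma VA_eq_ver_fam: "VA = (ver_fam S1.VA :: bideg \<Rightarrow> 'k polynomial set)"
proof
  fix p show "VA p = (ver_fam S1.VA p :: 'k polynomial set)"
    using mon_eq_S1[of p 0] by (cases "nonneg p") (auto simp: ver_fam_def mon_def)
qed

text \<open>
  The Veronese of a free \<open>S\<close>-module is the direct sum of the Veronese modules \<open>S(-c)\<^sub>\<Delta>\<close> over its basis.
\<close>

lemma ver_fam_dirsum: "ver_fam (shift_sum B \<delta> S1.VA) = dirsum B (\<lambda>j. mon all (\<delta> j) :: bideg \<Rightarrow> 'k polynomial set)"
proof
  fix p
  show "ver_fam (shift_sum B \<delta> S1.VA) p = dirsum B (\<lambda>j. mon all (\<delta> j) :: bideg \<Rightarrow> 'k polynomial set) p"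
  proof (cases "nonneg p")
    case True
    then show ?thesis by (simp add: ver_fam_def shift_sum_def dirsum_def mon_eq_S1)
  next
    case False
    then have "mon all c p = ({0} :: 'k polynomial set)" for c by (auto simp: mon_def)
    then have "dirsum B (\<lambda>j. mon all (\<delta> j) :: bideg \<Rightarrow> 'k polynomial set) p = dirsum B (\<lambda>_ _. {0}) p"
      by (simp add: dirsum_def)
    then show ?thesis using ver_fam_neg[OF False, of "shift_sum B \<delta> S1.VA"] by (simp add: dirsum_zero)
  qed
qed

lemma VA_S1: "a \<in> VA p \<Longrightarrow> nonneg p \<and> a \<in> S1.VA (scaled p) \<or> \<not> nonneg p \<and> a = (0 :: 'k polynomial)"
  by (simp add: VA_eq_ver_fam ver_fam_def split: if_splits)

lemma ver_fam_graded_module: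
  fixes sm :: "'k polynomial \<Rightarrow> 'c \<Rightarrow> 'c::ab_group_add"
  assumes L: "S1.graded_module sm L" and sm: "Modules.module sm"
  shows "graded_module sm (ver_fam L)"
proof -
  interpret m: Modules.module sm by fact
  have "sm a x \<in> ver_fam L (p + q)" if "a \<in> VA p" "x \<in> ver_fam L q" for a p x q
  proof (cases "nonneg p \<and> nonneg q")
    case True
    then have "nonneg (p + q)" by simp
    moreover have "sm a x \<in> L (scaled (p + q))"
      by (rule S1.graded_module_scale[OF L, of a "scaled p" x "scaled q"])
         (use that True VA_S1[OF that(1)] in \<open>auto simp: ver_fam_def scaled_add\<close>)
    ultimately show ?thesis by (simp add: ver_fam_def)
  next
    case False
    then have "sm a x = 0" using that VA_S1[OF that(1)] by (auto simp: ver_fam_def)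
    then show ?thesis using S1.graded_moduleD(2)[OF L] by (simp add: ver_fam_def)
  qed
  then show ?thesis
    unfolding graded_module_def using S1.graded_moduleD(2,3)[OF L] by (simp add: sm) (simp add: ver_fam_def)
qed

lemma ver_fam_graded_hom:
  fixes sm1 :: "'k polynomial \<Rightarrow> 'c \<Rightarrow> 'c::ab_group_add" and sm2 :: "'k polynomial \<Rightarrow> 'd \<Rightarrow> 'd::ab_group_add"
  assumes h: "S1.graded_hom sm1 sm2 L M \<phi>" and L: "S1.graded_module sm1 L" and m: "Modules.module sm1" "Modules.module sm2"
  shows "graded_hom sm1 sm2 (ver_fam L) (ver_fam M) \<phi>"
proof -
  interpret m1: Modules.module sm1 by (rule m(1))
  interpret m2: Modules.module sm2 by (rule m(2))
  note z = S1.graded_hom_zero[OF h L]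
  show ?thesis unfolding graded_hom_def
  proof (intro conjI allI ballI)
    fix p x assume x: "x \<in> ver_fam L p"
    then show "\<phi> x \<in> ver_fam M p" using S1.graded_homD(1)[OF h] z by (auto simp: ver_fam_def split: if_splits)
    fix y assume "y \<in> ver_fam L p"
    with x show "\<phi> (x + y) = \<phi> x + \<phi> y" using S1.graded_homD(2)[OF h] z by (auto simp: ver_fam_def split: if_splits)
  next
    fix p q and a :: "'k polynomial" and x assume a: "a \<in> VA p" and x: "x \<in> ver_fam L q"
    show "\<phi> (sm1 a x) = sm2 a (\<phi> x)"
    proof (cases "nonneg p \<and> nonneg q")
      case True
      then show ?thesis using S1.graded_homD(3)[OF h, of a "scaled p" x "scaled q"] VA_S1[OF a] x by (simp add: ver_fam_def)
    next
      case False
      then have "a = 0 \<or> x = 0" using VA_S1[OF a] x by (auto simp: ver_fam_def)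
      then show ?thesis using z by auto
    qed
  qed
qed

context
  fixes I :: "bideg \<Rightarrow> 'k polynomial set" and B \<delta> r D
  assumes R: "S1.resolution I B \<delta> r D" and I: "S1.graded_module (*) I" and IA: "\<And>p. I p \<subseteq> S1.VA p"
    and nonnegB: "\<forall>i. \<forall>j\<in>B i. nonneg (\<delta> i j)"
begin

abbreviation (input) FV :: "nat \<Rightarrow> bideg \<Rightarrow> (nat \<Rightarrow> 'k polynomial) set" where "FV k \<equiv> ver_fam (shift_sum (B k) (\<delta> k) S1.VA)"
abbreviation (input) SV :: "nat \<Rightarrow> bideg \<Rightarrow> (nat \<Rightarrow> 'k polynomial) set" where "SV k \<equiv> ver_fam (S1.syz I B \<delta> r D k)"

lemmas mp = module_pointwise[OF module_mult]

lemma gF: "graded_module (pointwise (*)) (FV k)" by (rule ver_fam_graded_module[OF S1.graded_module_shift_sum[OF S1.graded_module_A] mp])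
lemma gS: "graded_module (pointwise (*)) (SV k)" by (rule ver_fam_graded_module[OF S1.graded_module_syz[OF R I IA] mp])
lemma gZ: "graded_module (pointwise (*)) (\<lambda>_. {0 :: nat \<Rightarrow> 'k polynomial})" by (rule graded_module_zero[OF mp])

lemma SF: "SV k p \<subseteq> FV k p" using S1.syz_subset[of I B \<delta> r D k "scaled p"] by (auto simp: ver_fam_def)
lemma ZS: "{0} \<subseteq> SV k p" using graded_moduleD(2)[OF gS] by simp

lemma SV_Suc: "x \<in> FV (Suc k) p \<Longrightarrow> x \<in> SV (Suc k) p \<longleftrightarrow> mat_apply (*) (D k) x = 0"
  by (auto simp: ver_fam_def S1.syz_def split: if_splits)

lemma tor_vanishes_SV: "tor_vanishes (pointwise (*)) (SV k) (\<lambda>_. {0}) i p \<longleftrightarrow> tor_vanishes (pointwise (*)) (FV (Suc k)) (SV (Suc k)) i p"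
proof (rule tor_vanishes_iso[OF gF gS gS gZ SF ZS])
  have h: "S1.graded_hom (pointwise (*)) (pointwise (*)) (shift_sum (B (Suc k)) (\<delta> (Suc k)) S1.VA) (S1.syz I B \<delta> r D k) (mat_apply (*) (D k))"
    using S1.graded_hom_mat_apply_mult[OF S1.resolution_columns[OF R], of k] S1.resolution_image[OF R, of k]
    unfolding S1.graded_hom_def by blast
  show "graded_hom (pointwise (*)) (pointwise (*)) (FV (Suc k)) (SV k) (mat_apply (*) (D k))"
    by (rule ver_fam_graded_hom[OF h S1.graded_module_shift_sum[OF S1.graded_module_A] mp mp])
  show "mat_apply (*) (D k) x \<in> {0} \<longleftrightarrow> x \<in> SV (Suc k) p" if "x \<in> FV (Suc k) p" for x p
    using SV_Suc[OF that] by simp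
  show "\<exists>x\<in>FV (Suc k) p. y - mat_apply (*) (D k) x \<in> {0}" if y: "y \<in> SV k p" for y p
  proof (cases "nonneg p")
    case True
    then obtain x where "x \<in> shift_sum (B (Suc k)) (\<delta> (Suc k)) S1.VA (scaled p)" "y = mat_apply (*) (D k) x"
      using y S1.resolution_image[OF R, of k "scaled p"] by (auto simp: ver_fam_def)
    then show ?thesis using True by (intro bexI[of _ x]) (simp_all add: ver_fam_def)
  next
    case False
    then have "y = 0" using y ver_fam_neg[OF False, of "S1.syz I B \<delta> r D k"] by simp
    then show ?thesis using graded_moduleD(2)[OF gF] by (intro bexI[of _ 0]) simp_all
  qed
qed

lemma tor_vanishes_base_ver_fam: "tor_vanishes (*) VA (ver_fam I) i p \<longleftrightarrow> tor_vanishes (pointwise (*)) (FV 0) (SV 0) i p"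
proof (rule tor_vanishes_iso[OF gF gS graded_module_A ver_fam_graded_module[OF I module_mult] SF])
  show "ver_fam I p \<subseteq> VA p" for p using IA by (auto simp: ver_fam_def VA_eq_ver_fam)
  have h: "S1.graded_hom (pointwise (*)) (*) (shift_sum (B 0) (\<delta> 0) S1.VA) S1.VA (\<lambda>x. aug r x)"
    by (rule S1.augmentation_hom) (use R in \<open>auto simp: S1.resolution_def\<close>)
  show "graded_hom (pointwise (*)) (*) (FV 0) VA (\<lambda>x. aug r x)"
    by (rule ver_fam_graded_hom[OF h S1.graded_module_shift_sum[OF S1.graded_module_A] mp module_mult, unfolded VA_eq_ver_fam[symmetric]])
  show "aug r x \<in> ver_fam I p \<longleftrightarrow> x \<in> SV 0 p" if "x \<in> FV 0 p" for x p
    using that by (auto simp: ver_fam_def S1.syz_def split: if_splits)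
  show "\<exists>x\<in>FV 0 p. y - aug r x \<in> ver_fam I p" if y: "y \<in> VA p" for y p
  proof (cases "nonneg p")
    case True
    then have "y \<in> S1.VA (scaled p)" using y VA_S1 by blast
    then obtain x where "x \<in> shift_sum (B 0) (\<delta> 0) S1.VA (scaled p)" "y - aug r x \<in> I (scaled p)"
      using S1.resolution_cover[OF R] by blast
    then show ?thesis using True by (intro bexI[of _ x]) (simp_all add: ver_fam_def)
  next
    case False
    then have "y = 0" using VA_S1[OF y] by blast
    then show ?thesis using graded_moduleD(2)[OF gF] graded_moduleD(2)[OF ver_fam_graded_module[OF I module_mult]]
      by (intro bexI[of _ 0]) simp_all
  qed
qed

text \<open>
  Here \<open>FV\<close> and \<open>SV\<close> are the Veronese families of the free modules and of the kernels in them.  In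
  \<open>0 \<rightarrow> Z\<^sub>k \<rightarrow> F\<^sub>k \<rightarrow> F\<^sub>k / Z\<^sub>k \<rightarrow> 0\<close> the kernel is again of the form \<open>F\<^sub>k\<^sub>+\<^sub>1 / Z\<^sub>k\<^sub>+\<^sub>1\<close>, with the homological degree lowered by one.
\<close>

lemma tor_vanishes_FV_SV:
  "(\<And>l. l \<le> i \<Longrightarrow> tor_vanishes (pointwise (*)) (FV (k + l)) (\<lambda>_. {0}) (i - l) p) \<Longrightarrow> tor_vanishes (pointwise (*)) (FV k) (SV k) i p"
proof (induction i arbitrary: k)
  case 0
  show ?case
  proof (rule tor_vanishes_quotient[OF gZ gS gF ZS SF])
    show "tor_vanishes (pointwise (*)) (FV k) (\<lambda>_. {0}) 0 p" using 0[OF le_refl] by (simp only: add_0_right diff_self_eq_0)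
  qed simp
next
  case (Suc i)
  have "tor_vanishes (pointwise (*)) (FV (Suc k)) (SV (Suc k)) i p"
  proof (rule Suc.IH)
    show "tor_vanishes (pointwise (*)) (FV (Suc k + l)) (\<lambda>_. {0}) (i - l) p" if "l \<le> i" for l
      using Suc.prems[of "Suc l"] that by (simp only: Suc_le_mono add_Suc_right add_Suc diff_Suc_Suc)
  qed
  then have *: "tor_vanishes (pointwise (*)) (SV k) (\<lambda>_. {0}) i p" by (simp only: tor_vanishes_SV)
  show ?case
  proof (rule tor_vanishes_quotient[OF gZ gS gF ZS SF])
    show "tor_vanishes (pointwise (*)) (FV k) (\<lambda>_. {0}) (Suc i) p"
      using Suc.prems[OF le0] by (simp only: add_0_right minus_nat.diff_0)
    show "tor_vanishes (pointwise (*)) (SV k) (\<lambda>_. {0}) j p" if "Suc i = Suc j" for j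
      using * that by (simp only: nat.inject)
  qed
qed

theorem tor_vanishes_veronese:
  assumes "\<not> tor_vanishes (*) VA (ver_fam I) i p"
  shows "\<exists>l\<le>i. \<exists>j\<in>B l. \<not> excess (i - l) (\<delta> l j) p"
proof (rule ccontr)
  assume *: "\<not> (\<exists>l\<le>i. \<exists>j\<in>B l. \<not> excess (i - l) (\<delta> l j) p)"
  have "tor_vanishes (pointwise (*)) (FV (0 + l)) (\<lambda>_. {0}) (i - l) p" if l: "l \<le> i" for l
  proof -
    have Q0: "mon (hits {}) c = (\<lambda>_. {0 :: 'k polynomial})" for c
      by (auto simp: mon_def hits_def fun_eq_iff)
    have "tor_vanishes (*) (mon all (\<delta> l j) :: bideg \<Rightarrow> 'k polynomial set) (\<lambda>_. {0}) (i - l) p" if "j \<in> B l" for j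
      using vtor_excess[OF nonnegB[rule_format, OF that], of "i - l" p "{}"] * l that by (simp add: Q0)
    then have "tor_vanishes (pointwise (*)) (dirsum (B l) (\<lambda>j. mon all (\<delta> l j) :: bideg \<Rightarrow> 'k polynomial set)) (dirsum (B l) (\<lambda>_ _. {0})) (i - l) p"
      by (intro tor_vanishes_dirsum all_graded_module module_mult) simp_all
    then show ?thesis by (simp add: ver_fam_dirsum dirsum_zero[abs_def])
  qed
  then show False using assms tor_vanishes_FV_SV[of i 0 p] by (simp add: tor_vanishes_base_ver_fam)
qed

end

end

section \<open>Betti numbers and vanishing of Tor\<close>

text \<open>
  Induction on the size of the support, removing one multiple of a basis vector at a time.
\<close>

lemma (in graded_ring) shift_sum_induct [consumes 1, case_names zero step]:
  assumes f: "f \<in> shift_sum B \<delta> A p" and z: "P 0"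
    and step: "\<And>g j a. g \<in> shift_sum B \<delta> A p \<Longrightarrow> j \<in> B \<Longrightarrow> a \<in> A (p - \<delta> j) \<Longrightarrow> P g \<Longrightarrow> P (g + pointwise (*) a (unit_vec j))"
  shows "P f"
proof -
  have "P f" if "f \<in> shift_sum B \<delta> A p" "card {j. f j \<noteq> 0} = k" for k f
    using that
  proof (induction k arbitrary: f)
    case 0
    then have "f = 0" using shift_sumD(1)[OF 0(1)] by (auto simp: fun_eq_iff)
    then show ?case using z by (simp only:)
  next
    case (Suc k)
    note fin = shift_sumD(1)[OF Suc.prems(1)]
    obtain j where j: "f j \<noteq> 0" using Suc.prems(2) by (cases "{j. f j \<noteq> 0} = {}") auto
    define g where "g = (\<lambda>l. if l = j then 0 else f l)"
    have sup: "{l. g l \<noteq> 0} = {l. f l \<noteq> 0} - {j}" by (auto simp: g_def)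
    have g: "g \<in> shift_sum B \<delta> A p"
      by (rule shift_sumI) (use sup fin shift_sumD(2,3)[OF Suc.prems(1)] in \<open>auto simp: g_def A_zero\<close>)
    have jB: "j \<in> B" by (rule shift_sumD(4)[OF Suc.prems(1) j])
    have "card {l. g l \<noteq> 0} = k" unfolding sup using fin j Suc.prems(2) by simp
    then have "P g" using Suc.IH g by blast
    then have "P (g + pointwise (*) (f j) (unit_vec j))"
      using step[OF g jB shift_sumD(3)[OF Suc.prems(1) jB]] by blast
    moreover have "g + pointwise (*) (f j) (unit_vec j) = f"
      by (auto simp: fun_eq_iff g_def pointwise_def unit_vec_def)
    ultimately show ?case by simp
  qed
  then show ?thesis using f by blast
qed

lemma (in graded_ring) unit_scale_mem:
  assumes "j \<in> B" "a \<in> A (p - \<delta> j)"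
  shows "pointwise (*) a (unit_vec j) \<in> shift_sum B \<delta> A p"
  by (rule graded_module_scale[OF graded_module_shift_sum[OF graded_module_A] assms(2) unit_vec_mem[OF assms(1)]]) simp

lemma (in graded_ring) irr_part_closed:
  "x \<in> irr_part B \<delta> p \<Longrightarrow> y \<in> irr_part B \<delta> p \<Longrightarrow> x + y \<in> irr_part B \<delta> p"
  "x \<in> irr_part B \<delta> p \<Longrightarrow> - x \<in> irr_part B \<delta> p"
  "a \<in> A 0 \<Longrightarrow> x \<in> irr_part B \<delta> p \<Longrightarrow> pointwise (*) a x \<in> irr_part B \<delta> p"
  "0 \<in> irr_part B \<delta> p"
proof -
  note F = graded_module_shift_sum[OF graded_module_A, of B \<delta>]
  show "x \<in> irr_part B \<delta> p \<Longrightarrow> y \<in> irr_part B \<delta> p \<Longrightarrow> x + y \<in> irr_part B \<delta> p"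
    using graded_module_add[OF F, of x p y] by (simp add: irr_part_def)
  show "x \<in> irr_part B \<delta> p \<Longrightarrow> - x \<in> irr_part B \<delta> p"
    using graded_moduleD(3)[OF F graded_moduleD(2)[OF F], of x p, unfolded diff_0] by (simp add: irr_part_def)
  show "a \<in> A 0 \<Longrightarrow> x \<in> irr_part B \<delta> p \<Longrightarrow> pointwise (*) a x \<in> irr_part B \<delta> p"
    using graded_module_scale[OF F, of a 0 x p p] by (simp add: irr_part_def) (simp add: pointwise_def)
  show "0 \<in> irr_part B \<delta> p" using graded_moduleD(2)[OF F] by (simp add: irr_part_def)
qed

text \<open>
  A bigraded algebra in the sense of the definitions whose operations are those of the type class.
\<close>

locale record_algebra = graded_algebra A emb for A :: "bideg \<Rightarrow> 'a::comm_ring_1 set" and emb :: "'k::field \<Rightarrow> 'a" +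
  fixes AR :: "'a bigraded_algebra"
  assumes comp: "acomp AR = A" and AR_mult: "monoid.mult AR = (*)" and AR_add: "add AR = (+)"
    and AR_zero: "zero AR = 0" and AR_one: "one AR = 1"
    and A_sub: "A p \<subseteq> carrier AR" and AR_diff: "x \<in> carrier AR \<Longrightarrow> y \<in> carrier AR \<Longrightarrow> x - y \<in> carrier AR"
    and AR_mult_closed: "x \<in> carrier AR \<Longrightarrow> y \<in> carrier AR \<Longrightarrow> x * y \<in> carrier AR"
begin

abbreviation CM where "CM \<equiv> chain_module AR"
abbreviation FF where "FF F i \<equiv> shift_sum (basis F i) (bdeg F i) A"

lemma chain_simps:
  "zero (CM F i) = 0" "add (CM F i) = (+)" "smult (CM F i) = pointwise (*)" "mcomp (CM F i) p = FF F i p"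
  "carrier (CM F i) = {f. (\<forall>j. f j \<in> carrier AR) \<and> finite {j. f j \<noteq> 0} \<and> (\<forall>j. j \<notin> basis F i \<longrightarrow> f j = 0)}"
proof -
  have A0c: "0 \<in> carrier AR" using A_sub A_zero by blast
  show "zero (CM F i) = 0" "add (CM F i) = (+)" "smult (CM F i) = pointwise (*)"
    by (simp_all add: chain_module_def free_bigraded_module_def AR_zero AR_add AR_mult pointwise_def fun_eq_iff)
  show "carrier (CM F i) = {f. (\<forall>j. f j \<in> carrier AR) \<and> finite {j. f j \<noteq> 0} \<and> (\<forall>j. j \<notin> basis F i \<longrightarrow> f j = 0)}"
    by (simp add: chain_module_def free_bigraded_module_def AR_zero)
  show "mcomp (CM F i) p = FF F i p"
  proof (intro equalityI subsetI)
    fix f assume f: "f \<in> FF F i p"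
    have "f j \<in> carrier AR" for j
      using shift_sumD(2)[OF f, of j] subsetD[OF A_sub shift_sumD(3)[OF f, of j]] A0c by (cases "j \<in> basis F i") auto
    with shift_sumD[OF f] show "f \<in> mcomp (CM F i) p"
      by (simp add: chain_module_def free_bigraded_module_def AR_zero comp)
  next
    fix f assume "f \<in> mcomp (CM F i) p"
    then show "f \<in> FF F i p"
      by (intro shift_sumI) (simp_all add: chain_module_def free_bigraded_module_def AR_zero comp)
  qed
qed

lemma AR_carrier: "0 \<in> carrier AR" "x \<in> carrier AR \<Longrightarrow> - x \<in> carrier AR"
  "x \<in> carrier AR \<Longrightarrow> y \<in> carrier AR \<Longrightarrow> x + y \<in> carrier AR"
proof -
  show z: "0 \<in> carrier AR" using A_sub A_zero by blast
  show n: "- x \<in> carrier AR" if "x \<in> carrier AR" for x using AR_diff[OF z that] by simp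
  show "x \<in> carrier AR \<Longrightarrow> y \<in> carrier AR \<Longrightarrow> x + y \<in> carrier AR"
    using AR_diff[of x "- y"] n[of y] by simp
qed

lemma chain_group: "abelian_group (CM F i)"
proof (rule abelian_groupI)
  fix x y assume x: "x \<in> carrier (CM F i)" and y: "y \<in> carrier (CM F i)"
  have "{j. (x + y) j \<noteq> 0} \<subseteq> {j. x j \<noteq> 0} \<union> {j. y j \<noteq> 0}" by auto
  with x y show "x \<oplus>\<^bsub>CM F i\<^esub> y \<in> carrier (CM F i)"
    by (auto simp: chain_simps AR_carrier intro: finite_subset)
  show "x \<oplus>\<^bsub>CM F i\<^esub> y = y \<oplus>\<^bsub>CM F i\<^esub> x" by (simp add: chain_simps add.commute)
  have "- x \<in> carrier (CM F i)" using x by (simp add: chain_simps AR_carrier)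
  then show "\<exists>y\<in>carrier (CM F i). y \<oplus>\<^bsub>CM F i\<^esub> x = \<zero>\<^bsub>CM F i\<^esub>" by (intro bexI[of _ "- x"]) (simp_all add: chain_simps)
  fix z assume "z \<in> carrier (CM F i)"
  show "x \<oplus>\<^bsub>CM F i\<^esub> y \<oplus>\<^bsub>CM F i\<^esub> z = x \<oplus>\<^bsub>CM F i\<^esub> (y \<oplus>\<^bsub>CM F i\<^esub> z)" by (simp add: chain_simps add.assoc)
qed (simp_all add: chain_simps AR_carrier)

lemma comp_carrier: "x \<in> FF F i p \<Longrightarrow> x \<in> carrier (CM F i)"
proof -
  assume x: "x \<in> FF F i p"
  have "x j \<in> carrier AR" for j
    using shift_sumD(2)[OF x, of j] subsetD[OF A_sub shift_sumD(3)[OF x, of j]] AR_carrier(1)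
    by (cases "j \<in> basis F i") auto
  then show ?thesis using shift_sumD(1,2)[OF x] by (simp add: chain_simps)
qed

text \<open>
  A product of a homogeneous \<open>a\<close> of bidegree \<open>q \<noteq> 0\<close> with a vector has no coefficient in bidegree \<open>0\<close>, as \<open>q\<close> and
  \<open>- q\<close> cannot both be nonnegative.  Conversely a vector without such coefficients is a combination of basis vectors.
\<close>

lemma irrelevant_eq: "irrelevant_part AR (CM F i) p = irr_part (basis F i) (bdeg F i) p"
proof -
  let ?B = "basis F i" and ?\<delta> = "bdeg F i"
  let ?X = "{pointwise (*) a x | a x q. q \<noteq> 0 \<and> a \<in> A q \<and> x \<in> FF F i (p - q)}"
  let ?G = "add_monoid (CM F i)"
  interpret G: abelian_group "CM F i" by (rule chain_group)
  have eq: "irrelevant_part AR (CM F i) p = generate ?G ?X"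
    by (simp add: irrelevant_part_def chain_simps comp)
  have g0: "\<one>\<^bsub>?G\<^esub> = 0" and gp: "x \<otimes>\<^bsub>?G\<^esub> y = x + y" for x y
    by (simp_all only: monoid.select_convs chain_simps)
  have X: "?X \<subseteq> irr_part ?B ?\<delta> p"
  proof
    fix z assume "z \<in> ?X"
    then obtain a x q where z: "z = pointwise (*) a x" "q \<noteq> 0" "a \<in> A q" "x \<in> FF F i (p - q)" by blast
    have zF: "z \<in> FF F i p" unfolding z(1) by (rule graded_module_scale[OF graded_module_shift_sum[OF graded_module_A] z(3,4)]) simp
    have "z j = 0" if "?\<delta> j = p" for j
    proof (cases "j \<in> ?B")
      case True
      then have "x j \<in> A (- q)" using shift_sumD(3)[OF z(4) True] that by simp
      moreover have "\<not> (nonneg q \<and> nonneg (- q))" using z(2) by (cases q) (auto simp: zero_prod_def)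
      ultimately have "a = 0 \<or> x j = 0" using z(3) A_neg[of q] A_neg[of "- q"] by blast
      then show ?thesis by (auto simp: z(1) pointwise_def)
    qed (use shift_sumD(2)[OF zF] in simp)
    with zF show "z \<in> irr_part ?B ?\<delta> p" by (simp add: irr_part_def)
  qed
  have car: "z \<in> carrier (CM F i)" if "z \<in> irr_part ?B ?\<delta> p" for z
    using comp_carrier[of z F i p] that by (simp add: irr_part_def)
  have "z \<in> irr_part ?B ?\<delta> p" if "z \<in> generate ?G ?X" for z
    using that
  proof (induction rule: generate.induct)
    case one
    show ?case using irr_part_closed(4)[of ?B ?\<delta> p] by (simp only: g0)
  next
    case (incl h)
    then show ?case using X by blast
  next
    case (inv h)
    then have h: "h \<in> irr_part ?B ?\<delta> p" using X by blast
    have "inv\<^bsub>?G\<^esub> h = - h"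
      by (rule group.inv_equality[OF G.a_group])
         (use car[OF h] car[OF irr_part_closed(2)[OF h]] in \<open>simp_all add: chain_simps\<close>)
    then show ?case using irr_part_closed(2)[OF h] by (simp only:)
  next
    case (eng h1 h2)
    show ?case using irr_part_closed(1)[OF eng.IH] by (simp only: gp)
  qed
  moreover have "z \<in> generate ?G ?X" if z: "z \<in> irr_part ?B ?\<delta> p" for z
  proof -
    have zF: "z \<in> FF F i p" using z by (simp add: irr_part_def)
    have "(\<Sum>j\<in>T. pointwise (*) (z j) (unit_vec j)) \<in> generate ?G ?X" if "finite T" "T \<subseteq> {j. z j \<noteq> 0}" for T
      using that
    proof (induction T)
      case empty
      then show ?case using generate.one[of ?G ?X] by (simp only: g0 sum.empty)
    next
      case (insert j T)
      then have j: "j \<in> ?B" "?\<delta> j \<noteq> p" using shift_sumD(4)[OF zF] z by (auto simp: irr_part_def)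
      have "unit_vec j \<in> FF F i (p - (p - ?\<delta> j))" using unit_vec_mem[OF j(1)] by simp
      then have x: "pointwise (*) (z j) (unit_vec j) \<in> ?X"
        using shift_sumD(3)[OF zF j(1)] j(2)
        by (intro CollectI exI[of _ "z j"] exI[of _ "unit_vec j"] exI[of _ "p - ?\<delta> j"]) simp
      have "(\<Sum>j\<in>T. pointwise (*) (z j) (unit_vec j)) \<in> generate ?G ?X" using insert by blast
      from generate.eng[OF generate.incl[OF x] this]
      show ?case unfolding gp sum.insert[OF insert.hyps(1,2)] .
    qed
    moreover have "z = (\<Sum>j | z j \<noteq> 0. pointwise (*) (z j) (unit_vec j))"
    proof -
      have "mat_apply (*) unit_vec z = z"
      proof
        fix k
        have "mat_apply (*) unit_vec z k = (\<Sum>j | z j \<noteq> 0. if k = j then z j else 0)"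
          unfolding mat_apply_def by (rule sum.cong) (auto simp: unit_vec_def)
        also have "\<dots> = z k" using shift_sumD(1)[OF zF] by simp
        finally show "mat_apply (*) unit_vec z k = z k" .
      qed
      then show ?thesis using mat_apply_as_sum[OF shift_sumD(1)[OF zF] subset_refl, of unit_vec] by simp
    qed
    ultimately show ?thesis using shift_sumD(1)[OF zF] by (metis (no_types, lifting) subset_refl)
  qed
  ultimately show ?thesis unfolding eq by blast
qed

text \<open>
  If \<open>Z \<subseteq> Y\<close>, the coefficient vector of a single element shows that no nonempty set is independent modulo \<open>Y\<close>.  Otherwise any element of
  \<open>Z\<close> outside \<open>Y\<close> forms an independent set, since nonzero scalars are invertible.
\<close>

lemma quotient_dim_eq_0_iff:
  assumes Z: "Z \<subseteq> carrier (CM F i)" and Y: "\<And>c y. c \<in> A 0 \<Longrightarrow> y \<in> Y \<Longrightarrow> pointwise (*) c y \<in> Y"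
  shows "quotient_dim (base_field AR) (CM F i) Z Y = 0 \<longleftrightarrow> Z \<subseteq> Y"
proof -
  interpret G: abelian_group "CM F i" by (rule chain_group)
  have bf: "carrier (base_field AR) = A 0" "zero (base_field AR) = 0"
    by (simp_all add: base_field_def comp AR_zero ring.defs zero_prod_def)
  define indep where "indep X \<longleftrightarrow> finite X \<and> X \<subseteq> Z \<and>
     (\<forall>c \<in> X \<rightarrow> A 0. (\<Oplus>\<^bsub>CM F i\<^esub>x\<in>X. pointwise (*) (c x) x) \<in> Y \<longrightarrow> (\<forall>x\<in>X. c x = 0))" for X
  have qd: "quotient_dim (base_field AR) (CM F i) Z Y = (SUP X\<in>{X. indep X}. enat (card X))"
    unfolding quotient_dim_def indep_def bf by (simp add: chain_simps)
  show ?thesis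
  proof
    assume "Z \<subseteq> Y"
    have "X = {}" if X: "indep X" for X
    proof (rule ccontr)
      assume "X \<noteq> {}"
      then obtain x where x: "x \<in> X" by blast
      let ?c = "\<lambda>y. if y = x then 1 else 0 :: 'a"
      have fX: "finite X" "X \<subseteq> carrier (CM F i)" using X Z by (auto simp: indep_def)
      have "(\<Oplus>\<^bsub>CM F i\<^esub>y\<in>X. pointwise (*) (?c y) y) = (\<Oplus>\<^bsub>CM F i\<^esub>y\<in>X. if x = y then y else \<zero>\<^bsub>CM F i\<^esub>)"
        by (rule G.finsum_cong') (use fX G.zero_closed in \<open>auto simp: chain_simps(1) pointwise_def fun_eq_iff\<close>)
      also have "\<dots> = x"
        by (rule G.finsum_singleton[OF x fX(1)]) (use fX in auto)
      finally have inY: "(\<Oplus>\<^bsub>CM F i\<^esub>y\<in>X. pointwise (*) (?c y) y) \<in> Y"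
        using X x \<open>Z \<subseteq> Y\<close> by (auto simp: indep_def)
      have cX: "?c \<in> X \<rightarrow> A 0" by (simp add: A_zero A_one)
      have "\<forall>c \<in> X \<rightarrow> A 0. (\<Oplus>\<^bsub>CM F i\<^esub>x\<in>X. pointwise (*) (c x) x) \<in> Y \<longrightarrow> (\<forall>x\<in>X. c x = 0)"
        using X unfolding indep_def by (elim conjE)
      from this[THEN bspec, THEN mp, OF cX inY] have "\<forall>y\<in>X. ?c y = 0" .
      from bspec[OF this x] show False by simp
    qed
    then have "card X = 0" if "indep X" for X using that by (metis card.empty)
    then have "(SUP X\<in>{X. indep X}. enat (card X)) \<le> 0" by (intro SUP_least) (simp add: zero_enat_def)
    then show "quotient_dim (base_field AR) (CM F i) Z Y = 0" by (simp add: qd)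
  next
    assume q0: "quotient_dim (base_field AR) (CM F i) Z Y = 0"
    show "Z \<subseteq> Y"
    proof (rule ccontr)
      assume "\<not> Z \<subseteq> Y"
      then obtain z where z: "z \<in> Z" "z \<notin> Y" by blast
      have "indep {z}"
        unfolding indep_def
      proof (intro conjI ballI impI)
        fix c x assume c: "c \<in> {z} \<rightarrow> A 0" and s: "(\<Oplus>\<^bsub>CM F i\<^esub>x\<in>{z}. pointwise (*) (c x) x) \<in> Y" and x: "x \<in> {z}"
        have zc: "z \<in> carrier (CM F i)" using z(1) Z by blast
        have cz: "c z \<in> A 0" using c by auto
        then have "c z \<in> carrier AR" using A_sub by blast
        then have "pointwise (*) (c z) z \<in> carrier (CM F i)"
          using zc by (auto simp: chain_simps pointwise_def AR_mult_closed elim: finite_subset[rotated])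
        then have "(\<Oplus>\<^bsub>CM F i\<^esub>x\<in>{z}. pointwise (*) (c x) x) = pointwise (*) (c z) z"
          using G.finsum_insert[of "{}" z "\<lambda>x. pointwise (*) (c x) x"] by simp
        then have cY: "pointwise (*) (c z) z \<in> Y" using s by simp
        have "c z = 0"
        proof (rule ccontr)
          assume nz: "c z \<noteq> 0"
          obtain k where k: "c z = emb k" using cz A0 by auto
          then have "k \<noteq> 0" using nz emb_zero by auto
          then have "emb (inverse k) * emb k = 1" by (simp add: emb_mult[symmetric] emb_one)
          then have "pointwise (*) (emb (inverse k)) (pointwise (*) (c z) z) = z"
            by (simp add: pointwise_def k mult.assoc[symmetric])
          then have "z \<in> Y" using Y[OF emb_mem cY, of "inverse k"] by simp
          with z(2) show False by simp
        qed
        with x show "c x = 0" by simp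
      qed (use z in auto)
      then have "enat (card {z}) \<le> quotient_dim (base_field AR) (CM F i) Z Y"
        unfolding qd by (intro SUP_upper) simp
      then show False using q0 by (simp add: zero_enat_def)
    qed
  qed
qed

end

text \<open>
  A cyclic module \<open>A / I\<close> whose elements are the values of \<open>\<pi>\<close>.  This describes \<open>R\<^sub>\<Delta>\<close>, whose elements are cosets,
  entirely in terms of \<open>A\<close>.
\<close>

locale presented_module = record_algebra A emb AR for A :: "bideg \<Rightarrow> 'a::comm_ring_1 set" and emb :: "'k::field \<Rightarrow> 'a" and AR +
  fixes MR :: "('a, 'b) bigraded_module" and \<pi> :: "'a \<Rightarrow> 'b" and I :: "bideg \<Rightarrow> 'a set"
  assumes I_graded_module: "graded_module (*) I" and I_sub: "I p \<subseteq> A p"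
    and M_comp: "mcomp MR p = \<pi> ` A p"
    and M_add: "x \<in> A p \<Longrightarrow> y \<in> A p \<Longrightarrow> add MR (\<pi> x) (\<pi> y) = \<pi> (x + y)"
    and M_smult: "a \<in> A q \<Longrightarrow> x \<in> A p \<Longrightarrow> smult MR a (\<pi> x) = \<pi> (a * x)"
    and M_zero: "zero MR = \<pi> 0"
    and M_eq: "x \<in> A p \<Longrightarrow> y \<in> A p \<Longrightarrow> \<pi> x = \<pi> y \<longleftrightarrow> x - y \<in> I p"
begin

lemma M_eq_zero: "x \<in> A p \<Longrightarrow> \<pi> x = zero MR \<longleftrightarrow> x \<in> I p"
  using M_eq[of x p 0] A_zero by (simp add: M_zero)

lemma aug_graded_hom: "(\<And>j. j \<in> B \<Longrightarrow> r j \<in> A (\<delta> j)) \<Longrightarrow> graded_hom (pointwise (*)) (*) (shift_sum B \<delta> A) A (aug r)"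
  by (rule augmentation_hom)

text \<open>
  The definition of the Betti numbers is meaningful only if some resolution exists.
\<close>

lemma resolution_to_free:
  assumes R: "resolution I B \<delta> r D"
  shows "\<exists>F. free_resolution AR MR F"
proof -
  let ?F = "\<lparr>basis = B, bdeg = \<delta>, bdry = (\<lambda>i p. mat_apply (*) (D i)), augm = (\<lambda>p x. \<pi> (aug r x))\<rparr>"
  have r: "\<And>j. j \<in> B 0 \<Longrightarrow> r j \<in> A (\<delta> 0 j)" using R by (simp add: resolution_def)
  note h = aug_graded_hom[of "B 0" r "\<delta> 0", OF r] and hD = graded_hom_mat_apply_mult[OF resolution_columns[OF R]]
  have "bigraded_hom AR (chain_module AR ?F 0) MR (augm ?F)"
    unfolding bigraded_hom_def
  proof (intro conjI allI ballI)
    fix p x assume "x \<in> mcomp (CM ?F 0) p"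
    then have x: "x \<in> shift_sum (B 0) (\<delta> 0) A p" by (simp add: chain_simps)
    then show "augm ?F p x \<in> mcomp MR p" using graded_homD(1)[OF h x] by (simp add: M_comp)
    fix y assume "y \<in> mcomp (CM ?F 0) p"
    then have y: "y \<in> shift_sum (B 0) (\<delta> 0) A p" by (simp add: chain_simps)
    show "augm ?F p (x \<oplus>\<^bsub>CM ?F 0\<^esub> y) = augm ?F p x \<oplus>\<^bsub>MR\<^esub> augm ?F p y"
      using graded_homD(2)[OF h x y] M_add[OF graded_homD(1)[OF h x] graded_homD(1)[OF h y]] by (simp add: chain_simps)
  next
    fix p q a x assume "a \<in> acomp AR p" and "x \<in> mcomp (CM ?F 0) q"
    then have a: "a \<in> A p" and x: "x \<in> shift_sum (B 0) (\<delta> 0) A q" by (simp_all add: chain_simps comp)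
    show "augm ?F (p + q) (a \<odot>\<^bsub>CM ?F 0\<^esub> x) = a \<odot>\<^bsub>MR\<^esub> augm ?F q x"
      using graded_homD(3)[OF h a x] M_smult[OF a graded_homD(1)[OF h x]] by (simp add: chain_simps)
  qed
  moreover have "bigraded_hom AR (chain_module AR ?F (Suc i)) (chain_module AR ?F i) (bdry ?F i)" for i
    unfolding bigraded_hom_def
    using graded_homD[OF hD[of i]] by (simp add: chain_simps comp)
  moreover have "augm ?F p ` mcomp (chain_module AR ?F 0) p = mcomp MR p" for p
  proof (intro equalityI subsetI)
    fix z assume "z \<in> augm ?F p ` mcomp (chain_module AR ?F 0) p"
    then show "z \<in> mcomp MR p" using graded_homD(1)[OF h, of _ p] by (auto simp: chain_simps M_comp)
  next
    fix z assume "z \<in> mcomp MR p"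
    then obtain a where a: "a \<in> A p" "z = \<pi> a" by (auto simp: M_comp)
    obtain x where x: "x \<in> shift_sum (B 0) (\<delta> 0) A p" "a - aug r x \<in> I p"
      using resolution_cover[OF R a(1)] by blast
    have "z = \<pi> (aug r x)" using M_eq[OF a(1) graded_homD(1)[OF h x(1)]] x(2) a(2) by simp
    then show "z \<in> augm ?F p ` mcomp (chain_module AR ?F 0) p" using x(1) by (simp add: chain_simps)
  qed
  moreover have "bdry ?F 0 p ` mcomp (chain_module AR ?F 1) p
        = {x \<in> mcomp (chain_module AR ?F 0) p. augm ?F p x = \<zero>\<^bsub>MR\<^esub>}" for p
    using resolution_image[OF R, of 0 p] M_eq_zero[OF graded_homD(1)[OF h]]
    by (simp add: chain_simps syz_def cong: conj_cong)
  moreover have "bdry ?F (Suc i) p ` mcomp (chain_module AR ?F (Suc (Suc i))) p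
        = {x \<in> mcomp (chain_module AR ?F (Suc i)) p. bdry ?F i p x = \<zero>\<^bsub>chain_module AR ?F i\<^esub>}" for i p
    unfolding chain_simps using resolution_image[OF R, of "Suc i" p] by (simp add: syz_def)
  ultimately show ?thesis unfolding free_resolution_def by blast
qed

text \<open>
  A homogeneous map from a free module, given as a family \<open>\<phi>\<close>, agrees with a degree-independent map
  \<open>\<psi>\<close> once they agree on the basis.  The operations \<open>pl\<close> and \<open>sc\<close> of the target are left open, since the target
  may be a module of cosets.
\<close>

lemma hom_determined:
  assumes "\<And>x y. x \<in> shift_sum B \<delta> A p \<Longrightarrow> y \<in> shift_sum B \<delta> A p \<Longrightarrow> \<phi> p (x + y) = pl (\<phi> p x) (\<phi> p y)"
    and "\<And>x y. x \<in> shift_sum B \<delta> A p \<Longrightarrow> y \<in> shift_sum B \<delta> A p \<Longrightarrow> \<psi> (x + y) = pl (\<psi> x) (\<psi> y)"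
    and "\<And>q a x. a \<in> A (p - q) \<Longrightarrow> x \<in> shift_sum B \<delta> A q \<Longrightarrow> \<phi> p (pointwise (*) a x) = sc a (\<phi> q x)"
    and "\<And>q a x. a \<in> A (p - q) \<Longrightarrow> x \<in> shift_sum B \<delta> A q \<Longrightarrow> \<psi> (pointwise (*) a x) = sc a (\<psi> x)"
    and "\<phi> p 0 = \<psi> 0" "\<And>j. j \<in> B \<Longrightarrow> \<phi> (\<delta> j) (unit_vec j) = \<psi> (unit_vec j)"
    and "f \<in> shift_sum B \<delta> A p"
  shows "\<phi> p f = \<psi> f"
  using assms(7)
proof (induction rule: shift_sum_induct)
  case zero
  then show ?case by (rule assms(5))
next
  case (step g j a)
  have u: "unit_vec j \<in> shift_sum B \<delta> A (\<delta> j)" by (rule unit_vec_mem[OF step(2)])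
  have s: "pointwise (*) a (unit_vec j) \<in> shift_sum B \<delta> A p" by (rule unit_scale_mem[where \<delta> = \<delta> and p = p, OF step(2,3)])
  show ?case
    unfolding assms(1)[OF step(1) s] assms(2)[OF step(1) s] assms(3)[OF step(3) u] assms(4)[OF step(3) u]
    by (simp only: step(4) assms(6)[OF step(2)])
qed

text \<open>
  The columns of the matrices are the images of the basis vectors; the row of the augmentation
  consists of representatives of their images.
\<close>

lemma free_to_resolution:
  assumes F: "free_resolution AR MR F"
  shows "\<exists>r D. resolution I (basis F) (bdeg F) r D \<and>
    (\<forall>i p. \<forall>x\<in>FF F (Suc i) p. bdry F i p x = mat_apply (*) (D i) x)"
proof -
  let ?B = "basis F" and ?\<delta> = "bdeg F"
  note F' = F[unfolded free_resolution_def chain_simps M_comp]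
  have ha: "bigraded_hom AR (CM F 0) MR (augm F)"
    by (rule F'[THEN conjunct1])
  have hb: "bigraded_hom AR (CM F (Suc i)) (CM F i) (bdry F i)" for i
    by (rule F'[THEN conjunct2, THEN conjunct1, THEN spec])
  have sa: "augm F p ` FF F 0 p = \<pi> ` A p" for p
    by (rule F'[THEN conjunct2, THEN conjunct2, THEN conjunct1, THEN spec])
  have k0: "bdry F 0 p ` FF F 1 p = {x \<in> FF F 0 p. augm F p x = \<zero>\<^bsub>MR\<^esub>}" for p
    by (rule F'[THEN conjunct2, THEN conjunct2, THEN conjunct2, THEN conjunct1, THEN spec])
  have kS: "bdry F (Suc i) p ` FF F (Suc (Suc i)) p = {x \<in> FF F (Suc i) p. bdry F i p x = 0}" for i p
    by (rule F'[THEN conjunct2, THEN conjunct2, THEN conjunct2, THEN conjunct2, THEN spec, THEN spec])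
  have a1: "augm F p x \<in> \<pi> ` A p" if "x \<in> FF F 0 p" for p x
    using ha that by (simp add: bigraded_hom_def chain_simps M_comp)
  have a2: "augm F p (x + y) = augm F p x \<oplus>\<^bsub>MR\<^esub> augm F p y" if "x \<in> FF F 0 p" "y \<in> FF F 0 p" for p x y
    using ha that by (simp add: bigraded_hom_def chain_simps)
  have a3: "augm F p (pointwise (*) a x) = a \<odot>\<^bsub>MR\<^esub> augm F q x" if "a \<in> A (p - q)" "x \<in> FF F 0 q" for p q a x
  proof -
    have "augm F (p - q + q) (pointwise (*) a x) = a \<odot>\<^bsub>MR\<^esub> augm F q x"
      using ha that unfolding bigraded_hom_def chain_simps comp by blast
    then show ?thesis by simp
  qed
  have b1: "bdry F i p x \<in> FF F i p" if "x \<in> FF F (Suc i) p" for i p x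
    using hb[of i] that by (simp add: bigraded_hom_def chain_simps)
  have b2: "bdry F i p (x + y) = bdry F i p x + bdry F i p y" if "x \<in> FF F (Suc i) p" "y \<in> FF F (Suc i) p" for i p x y
    using hb[of i] that unfolding bigraded_hom_def chain_simps by blast
  have b3: "bdry F i p (pointwise (*) a x) = pointwise (*) a (bdry F i q x)" if "a \<in> A (p - q)" "x \<in> FF F (Suc i) q" for i p q a x
  proof -
    have "bdry F i (p - q + q) (pointwise (*) a x) = pointwise (*) a (bdry F i q x)"
      using hb[of i] that unfolding bigraded_hom_def chain_simps comp by blast
    then show ?thesis by simp
  qed
  define D where "D i j = bdry F i (?\<delta> (Suc i) j) (unit_vec j)" for i j
  have cols: "columns (?B (Suc i)) (?\<delta> (Suc i)) (?B i) (?\<delta> i) (D i)" for i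
    unfolding columns_def D_def using b1 unit_vec_mem by blast
  note hD = graded_hom_mat_apply_mult[OF cols]
  note gF = graded_module_shift_sum[OF graded_module_A]
  have bD: "bdry F i p x = mat_apply (*) (D i) x" if x: "x \<in> FF F (Suc i) p" for i p x
  proof (rule hom_determined[where \<phi> = "bdry F i" and \<psi> = "mat_apply (*) (D i)", OF b2 graded_homD(2)[OF hD] b3 graded_homD(3)[OF hD] _ _ x])
    have "bdry F i p (0 + 0) = bdry F i p 0 + bdry F i p 0"
      by (rule b2) (rule graded_moduleD(2)[OF gF])+
    then show "bdry F i p 0 = mat_apply (*) (D i) 0" by (simp only: add_0 add_cancel_left_left mat_apply_zero) simp
    show "bdry F i (?\<delta> (Suc i) j) (unit_vec j) = mat_apply (*) (D i) (unit_vec j)" for j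
      by (simp add: D_def)
  qed
  have "\<exists>y. y \<in> A (?\<delta> 0 j) \<and> augm F (?\<delta> 0 j) (unit_vec j) = \<pi> y" if "j \<in> ?B 0" for j
    using a1[OF unit_vec_mem[OF that]] by blast
  then obtain r where r: "\<And>j. j \<in> ?B 0 \<Longrightarrow> r j \<in> A (?\<delta> 0 j) \<and> augm F (?\<delta> 0 j) (unit_vec j) = \<pi> (r j)"
    by metis
  have h: "graded_hom (pointwise (*)) (*) (FF F 0) A (aug r)" by (rule aug_graded_hom) (use r in blast)
  have ar: "augm F p x = \<pi> (aug r x)" if x: "x \<in> FF F 0 p" for p x
  proof (rule hom_determined[where \<phi> = "augm F" and \<psi> = "\<lambda>x. \<pi> (aug r x)", OF a2 _ a3 _ _ _ x])
    show "\<pi> (aug r (x + y)) = \<pi> (aug r x) \<oplus>\<^bsub>MR\<^esub> \<pi> (aug r y)" if "x \<in> FF F 0 p" "y \<in> FF F 0 p" for x y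
      using graded_homD(2)[OF h that] M_add[OF graded_homD(1)[OF h that(1)] graded_homD(1)[OF h that(2)]] by simp
    show "\<pi> (aug r (pointwise (*) a x)) = a \<odot>\<^bsub>MR\<^esub> \<pi> (aug r x)" if "a \<in> A (p - q)" "x \<in> FF F 0 q" for q a x
      using graded_homD(3)[OF h that] M_smult[OF that(1) graded_homD(1)[OF h that(2)]] by simp
    show "augm F (?\<delta> 0 j) (unit_vec j) = \<pi> (aug r (unit_vec j))" if "j \<in> ?B 0" for j
      using r[OF that] by simp
    have "augm F p (0 + 0) = augm F p 0 \<oplus>\<^bsub>MR\<^esub> augm F p 0"
      by (rule a2) (rule graded_moduleD(2)[OF gF])+
    then have e: "augm F p 0 = augm F p 0 \<oplus>\<^bsub>MR\<^esub> augm F p 0" by (simp only: add_0)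
    obtain y where y: "y \<in> A p" "augm F p 0 = \<pi> y" using a1[OF graded_moduleD(2)[OF gF]] by blast
    have yy: "y + y \<in> A p" by (rule graded_module_add[OF graded_module_A y(1) y(1)])
    have "\<pi> y = \<pi> (y + y)" using e y M_add[OF y(1) y(1)] by simp
    then have "y - (y + y) \<in> I p" using M_eq[OF y(1) yy] by simp
    then have "y \<in> I p" using graded_moduleD(3)[OF I_graded_module graded_moduleD(2)[OF I_graded_module], of "- y" p] by simp
    then have "augm F p 0 = \<pi> 0" using M_eq_zero[OF y(1)] y(2) by (simp add: M_zero)
    then show "augm F p 0 = \<pi> (aug r 0)" using graded_hom_zero[OF h gF] by (simp only:)
  qed
  have az: "augm F p x = \<zero>\<^bsub>MR\<^esub> \<longleftrightarrow> aug r x \<in> I p" if x: "x \<in> FF F 0 p" for p x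
    unfolding ar[OF x] by (rule M_eq_zero[OF graded_homD(1)[OF h x]])
  have "resolution I ?B ?\<delta> r D"
    unfolding resolution_def
  proof (intro conjI allI ballI cols)
    show "r j \<in> A (?\<delta> 0 j)" if "j \<in> ?B 0" for j using r[OF that] by blast
    show "\<exists>x\<in>FF F 0 p. a - aug r x \<in> I p" if a: "a \<in> A p" for p a
    proof -
      obtain x where x: "x \<in> FF F 0 p" "\<pi> a = augm F p x" using sa[of p] a by (metis imageE imageI)
      then have "a - aug r x \<in> I p" using M_eq[OF a graded_homD(1)[OF h x(1)]] ar[OF x(1)] by simp
      with x(1) show ?thesis by blast
    qed
    have im: "mat_apply (*) (D i) ` FF F (Suc i) p = bdry F i p ` FF F (Suc i) p" for i p
      by (rule image_cong) (simp_all add: bD)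
    show "mat_apply (*) (D 0) ` FF F 1 p = {x \<in> FF F 0 p. aug r x \<in> I p}" for p
      using im[of 0 p] k0[of p] az[of _ p] by (simp cong: conj_cong)
    show "mat_apply (*) (D (Suc i)) ` FF F (Suc (Suc i)) p = {x \<in> FF F (Suc i) p. mat_apply (*) (D i) x = 0}" for i p
      unfolding im kS by (rule Collect_cong) (use bD[of _ i p] in auto)
  qed
  with bD show ?thesis by blast
qed

text \<open>
  The resolution in the assumption only guarantees existence; the one obtained belongs to the choice made in the
  definition of the Betti numbers.
\<close>

theorem betti_eq_0_iff:
  assumes "resolution I B0 \<delta>0 r0 D0"
  shows "\<exists>B \<delta> r D. resolution I B \<delta> r D \<and> (\<forall>i p. betti AR MR i p = 0 \<longleftrightarrow> tor_zero_via B \<delta> D i p)"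
proof -
  define F where "F = (SOME F. free_resolution AR MR F)"
  have F: "free_resolution AR MR F"
    unfolding F_def by (rule someI_ex[OF resolution_to_free[OF assms]])
  obtain r D where R: "resolution I (basis F) (bdeg F) r D"
    and bD: "\<forall>i p. \<forall>x\<in>FF F (Suc i) p. bdry F i p x = mat_apply (*) (D i) x"
    using free_to_resolution[OF F] by (elim exE conjE)
  note hD = graded_hom_mat_apply_mult[OF resolution_columns[OF R]] and gF = graded_module_shift_sum[OF graded_module_A]
  have "betti AR MR i p = 0 \<longleftrightarrow> tor_zero_via (basis F) (bdeg F) D i p" for i p
  proof -
    let ?Z = "tor_cycles AR F i p" and ?Y = "tor_boundaries AR F i p"
    let ?im = "mat_apply (*) (D i) ` FF F (Suc i) p" and ?ap = "irr_part (basis F i) (bdeg F i) p"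
    have Z: "x \<in> ?Z \<longleftrightarrow> x \<in> FF F i p \<and> (\<forall>k. i = Suc k \<longrightarrow> mat_apply (*) (D k) x \<in> irr_part (basis F k) (bdeg F k) p)" for x
      using bD by (auto simp: tor_cycles_def chain_simps irrelevant_eq)
    have im: "bdry F i p ` FF F (Suc i) p = ?im"
      by (rule image_cong) (use bD in auto)
    have Y: "x \<in> ?Y \<longleftrightarrow> (\<exists>y\<in>FF F (Suc i) p. x - mat_apply (*) (D i) y \<in> ?ap)" for x
    proof -
      have "?Y = (\<Union>h\<in>?im. \<Union>k\<in>?ap. {h + k})"
        by (simp add: tor_boundaries_def irrelevant_eq set_add_def' chain_simps im)
      then have "x \<in> ?Y \<longleftrightarrow> (\<exists>y\<in>FF F (Suc i) p. \<exists>k\<in>?ap. x = mat_apply (*) (D i) y + k)" by auto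
      also have "\<dots> \<longleftrightarrow> (\<exists>y\<in>FF F (Suc i) p. x - mat_apply (*) (D i) y \<in> ?ap)"
      proof (intro bex_cong refl iffI)
        fix y
        show "x - mat_apply (*) (D i) y \<in> ?ap" if "\<exists>k\<in>?ap. x = mat_apply (*) (D i) y + k"
          using that by (metis add_diff_cancel_left')
        show "\<exists>k\<in>?ap. x = mat_apply (*) (D i) y + k" if "x - mat_apply (*) (D i) y \<in> ?ap"
          using that by (intro bexI[of _ "x - mat_apply (*) (D i) y"]) (simp only: add.commute[of "mat_apply (*) (D i) y"] diff_add_cancel)
      qed
      finally show ?thesis .
    qed
    have "betti AR MR i p = quotient_dim (base_field AR) (CM F i) ?Z ?Y"
      by (simp add: betti_def F_def[symmetric] Let_def)
    also have "\<dots> = 0 \<longleftrightarrow> ?Z \<subseteq> ?Y"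
    proof (rule quotient_dim_eq_0_iff)
      show "?Z \<subseteq> carrier (CM F i)" using Z comp_carrier[of _ F i p] by blast
      fix c x assume c: "c \<in> A 0" and "x \<in> ?Y"
      then obtain y where y: "y \<in> FF F (Suc i) p" "x - mat_apply (*) (D i) y \<in> ?ap" using Y by blast
      have "pointwise (*) c (x - mat_apply (*) (D i) y) \<in> ?ap" by (rule irr_part_closed(3)[OF c y(2)])
      moreover have "pointwise (*) c (x - mat_apply (*) (D i) y) = pointwise (*) c x - mat_apply (*) (D i) (pointwise (*) c y)"
        using graded_homD(3)[OF hD[of i] c y(1)] by (simp add: pointwise_def fun_eq_iff right_diff_distrib)
      moreover have "pointwise (*) c y \<in> FF F (Suc i) p" by (rule graded_module_scale[OF gF c y(1)]) simp
      ultimately show "pointwise (*) c x \<in> ?Y" using Y by metis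
    qed
    also have "\<dots> \<longleftrightarrow> tor_zero_via (basis F) (bdeg F) D i p"
      unfolding tor_zero_via_def subset_iff Z Y by blast
    finally show ?thesis .
  qed
  with R show ?thesis by blast
qed

end

section \<open>The regularity of Veronese quotients\<close>

lemma S_simps:
  "carrier (S_alg n m) = poly_carrier n m" "monoid.mult (S_alg n m) = (*)" "one (S_alg n m) = 1"
  "zero (S_alg n m) = 0" "add (S_alg n m) = (+)"
  "acomp (S_alg n m) p = {f \<in> poly_carrier n m. \<forall>\<mu>\<in>keys f. bidegree n m \<mu> = p}"
  by (simp_all add: S_alg_def)

lemma poly_carrier_closed:
  fixes f g :: "'k::field polynomial"
  assumes "f \<in> poly_carrier n m" "g \<in> poly_carrier n m"
  shows "f - g \<in> poly_carrier n m" "f * g \<in> poly_carrier n m" "f + g \<in> poly_carrier n m"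
proof -
  show "f - g \<in> poly_carrier n m" using assms keys_diff[of f g] by (fastforce simp: poly_carrier_def)
  show "f + g \<in> poly_carrier n m" using assms Poly_Mapping.keys_add[of f g] by (fastforce simp: poly_carrier_def)
  show "f * g \<in> poly_carrier n m"
    unfolding poly_carrier_def
  proof (intro CollectI ballI)
    fix \<mu> assume "\<mu> \<in> keys (f * g)"
    then obtain a b where "a \<in> keys f" "b \<in> keys g" "\<mu> = a + b"
      using keys_mult[of f g] by blast
    with assms show "keys \<mu> \<subseteq> vars n m" by (auto simp: poly_carrier_def keys_add_nat)
  qed
qed

lemma coset_eq: "J +>\<^bsub>S_alg n m\<^esub> x = {h + x | h. h \<in> J}"
  by (auto simp: a_r_coset_def' S_simps)

lemma ideal_closed:
  assumes "ideal J (S_alg n m)"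
  shows "0 \<in> J" "x \<in> J \<Longrightarrow> y \<in> J \<Longrightarrow> x + y \<in> J" "x \<in> J \<Longrightarrow> y \<in> J \<Longrightarrow> x - y \<in> J"
    "a \<in> poly_carrier n m \<Longrightarrow> x \<in> J \<Longrightarrow> a * x \<in> J"
proof -
  interpret ideal J "S_alg n m" by fact
  show "0 \<in> J" using additive_subgroup.zero_closed[OF ideal.axioms(1)[OF assms]] by (simp add: S_simps)
  show p: "x + y \<in> J" if "x \<in> J" "y \<in> J" for x y
    using additive_subgroup.a_closed[OF ideal.axioms(1)[OF assms] that] by (simp add: S_simps)
  show m: "a * x \<in> J" if "a \<in> poly_carrier n m" "x \<in> J" for a x using I_l_closed[of x a] that by (simp add: S_simps)
  show "x - y \<in> J" if "x \<in> J" "y \<in> J" for x y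
  proof -
    have "- 1 * y \<in> J" by (rule m[OF _ that(2)]) (simp add: poly_carrier_def)
    from p[OF that(1) this] show ?thesis by simp
  qed
qed

lemma coset_eq_iff:
  assumes "ideal J (S_alg n m)"
  shows "J +>\<^bsub>S_alg n m\<^esub> x = J +>\<^bsub>S_alg n m\<^esub> y \<longleftrightarrow> x - y \<in> J"
proof
  assume "J +>\<^bsub>S_alg n m\<^esub> x = J +>\<^bsub>S_alg n m\<^esub> y"
  moreover have "x \<in> J +>\<^bsub>S_alg n m\<^esub> x" using ideal_closed(1)[OF assms] by (force simp: coset_eq)
  ultimately show "x - y \<in> J" by (auto simp: coset_eq)
next
  assume d: "x - y \<in> J"
  have "h + x \<in> J +>\<^bsub>S_alg n m\<^esub> y" if "h \<in> J" for h
    using ideal_closed(2)[OF assms that d] unfolding coset_eq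
    by (intro CollectI exI[of _ "h + (x - y)"]) simp
  moreover have "h + y \<in> J +>\<^bsub>S_alg n m\<^esub> x" if "h \<in> J" for h
    using ideal_closed(3)[OF assms that d] unfolding coset_eq
    by (intro CollectI exI[of _ "h - (x - y)"]) simp
  ultimately show "J +>\<^bsub>S_alg n m\<^esub> x = J +>\<^bsub>S_alg n m\<^esub> y" unfolding coset_eq by blast
qed

lemma coset_add:
  assumes "ideal J (S_alg n m)"
  shows "(J +>\<^bsub>S_alg n m\<^esub> x) <+>\<^bsub>S_alg n m\<^esub> (J +>\<^bsub>S_alg n m\<^esub> y) = J +>\<^bsub>S_alg n m\<^esub> (x + y)"
proof (intro equalityI subsetI)
  fix z assume "z \<in> (J +>\<^bsub>S_alg n m\<^esub> x) <+>\<^bsub>S_alg n m\<^esub> (J +>\<^bsub>S_alg n m\<^esub> y)"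
  then obtain h k where hk: "h \<in> J" "k \<in> J" "z = (h + x) + (k + y)"
    by (auto simp: set_add_def' S_simps coset_eq)
  have "z = (h + k) + (x + y)" by (simp add: hk(3))
  then show "z \<in> J +>\<^bsub>S_alg n m\<^esub> (x + y)" using ideal_closed(2)[OF assms hk(1,2)] unfolding coset_eq by blast
next
  fix z assume "z \<in> J +>\<^bsub>S_alg n m\<^esub> (x + y)"
  then obtain h where h: "h \<in> J" "z = h + (x + y)" by (auto simp: coset_eq)
  have "z = (h + x) + (0 + y)" by (simp add: h(2))
  moreover have "h + x \<in> J +>\<^bsub>S_alg n m\<^esub> x" using h(1) unfolding coset_eq by blast
  moreover have "0 + y \<in> J +>\<^bsub>S_alg n m\<^esub> y" using ideal_closed(1)[OF assms] unfolding coset_eq by blast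
  ultimately show "z \<in> (J +>\<^bsub>S_alg n m\<^esub> x) <+>\<^bsub>S_alg n m\<^esub> (J +>\<^bsub>S_alg n m\<^esub> y)"
    unfolding set_add_def' S_simps by blast
qed

lemma quotient_simps:
  "add (quotient_algebra A J) = set_add A" "zero (quotient_algebra A J) = J"
  "monoid.mult (quotient_algebra A J) = rcoset_mult A J"
  "acomp (quotient_algebra A J) = (\<lambda>p. (\<lambda>f. J +>\<^bsub>A\<^esub> f) ` acomp A p)"
  by (simp_all add: quotient_algebra_def FactRing_def ring.defs bigraded_algebra.defs)

lemma (in veronese_setup) acomp_veronese:
  "acomp (veronese s t (S_alg n m)) p = (VA p :: 'k::field polynomial set)"
  by (cases p) (auto simp: veronese_def S_simps mon_def scaled_def poly_carrier_def)

abbreviation coset :: "nat \<Rightarrow> nat \<Rightarrow> 'k::field polynomial set \<Rightarrow> 'k polynomial \<Rightarrow> 'k polynomial set" where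
  "coset n m J \<equiv> (\<lambda>f. J +>\<^bsub>S_alg n m\<^esub> f)"

abbreviation ver_quotient :: "nat \<Rightarrow> nat \<Rightarrow> 'k::field polynomial set \<Rightarrow> nat \<Rightarrow> nat \<Rightarrow>
    ('k polynomial, 'k polynomial set) bigraded_module" where
  "ver_quotient n m J s t \<equiv> module_via (coset n m J) (veronese s t (quotient_algebra (S_alg n m) J))"

text \<open>
  The kernel of \<open>A \<rightarrow> R\<^sub>\<Delta>\<close> in each bidegree is the intersection with \<open>J\<close>.
\<close>

lemma (in veronese_setup) presented_quotient:
  fixes J :: "'k::field polynomial set"
  assumes J: "ideal J (S_alg n m)"
  shows "presented_module (VA :: bideg \<Rightarrow> 'k polynomial set) (single 0)
    (veronese s t (S_alg n m)) (ver_quotient n m J s t)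
    (coset n m J) (\<lambda>p. VA p \<inter> J)"
proof -
  interpret J: ideal J "S_alg n m" by (rule J)
  let ?S = "S_alg n m :: 'k polynomial bigraded_algebra"
  let ?\<pi> = "\<lambda>f. J +>\<^bsub>?S\<^esub> f"
  let ?M = "module_via ?\<pi> (veronese s t (quotient_algebra ?S J))"
  have sub: "VA p \<subseteq> (poly_carrier n m :: 'k polynomial set)" for p
    by (auto simp: mon_def poly_carrier_def split: if_splits)
  have M: "add ?M = set_add ?S" "zero ?M = J" "smult ?M = (\<lambda>a x. rcoset_mult ?S J (?\<pi> a) x)"
    by (simp_all add: module_via_def veronese_def quotient_simps)
  have Mc: "mcomp ?M p = (if nonneg p then ?\<pi> ` acomp ?S (scaled p) else {J})" for p
    by (cases p) (simp add: module_via_def veronese_def quotient_simps scaled_def)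
  have p0: "?\<pi> 0 = J" by (auto simp: coset_eq)
  show ?thesis
  proof
    show "acomp (veronese s t ?S) = VA" by (simp add: fun_eq_iff acomp_veronese)
    show "monoid.mult (veronese s t ?S) = (*)" "add (veronese s t ?S) = (+)" "zero (veronese s t ?S) = 0"
      "one (veronese s t ?S) = 1" by (simp_all add: veronese_def S_simps)
    show "VA p \<subseteq> carrier (veronese s t ?S)" for p using sub by (simp add: veronese_def S_simps)
    show "x - y \<in> carrier (veronese s t ?S)" "x * y \<in> carrier (veronese s t ?S)"
      if "x \<in> carrier (veronese s t ?S)" "y \<in> carrier (veronese s t ?S)" for x y
      using that poly_carrier_closed[of x n m y] by (simp_all add: veronese_def S_simps)
    show "graded_module (*) (\<lambda>p. VA p \<inter> J)"
      unfolding graded_module_def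
    proof (intro conjI allI ballI module_mult)
      show "a * x \<in> VA (p + q) \<inter> J" if "a \<in> VA p" "x \<in> VA q \<inter> J" for p q a x
        using A_mult[of a p x q] ideal_closed(4)[OF J subsetD[OF sub that(1)], of x] that by simp
    qed (simp_all add: ideal_closed[OF J] A_zero A_diff)
    show "VA p \<inter> J \<subseteq> VA p" for p by blast
    show "mcomp ?M p = ?\<pi> ` VA p" for p
      by (auto simp: Mc S_simps mon_def poly_carrier_def p0 image_iff)
    show "?\<pi> x \<oplus>\<^bsub>?M\<^esub> ?\<pi> y = ?\<pi> (x + y)" for x y by (simp only: M coset_add[OF J])
    show "a \<odot>\<^bsub>?M\<^esub> ?\<pi> x = ?\<pi> (a * x)" if "a \<in> VA q" "x \<in> VA p" for a q x p
      using J.rcoset_mult_add[of a x] subsetD[OF sub that(1)] subsetD[OF sub that(2)] by (simp add: M S_simps)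
    show "\<zero>\<^bsub>?M\<^esub> = ?\<pi> 0" by (simp only: M p0)
    show "?\<pi> x = ?\<pi> y \<longleftrightarrow> x - y \<in> VA p \<inter> J" if "x \<in> VA p" "y \<in> VA p" for x y p
      using A_diff[OF that] by (simp add: coset_eq_iff[OF J])
  qed
qed

text \<open>
  The polynomial ring and its quotient have no components in negative bidegrees, so they are their own Veronese
  algebras.  This lets one development cover both sides of the inequality.
\<close>

lemma veronese_one_one:
  fixes J :: "'k::field polynomial set"
  assumes J: "ideal J (S_alg n m)"
  shows "veronese (Suc 0) (Suc 0) (S_alg n m) = (S_alg n m :: 'k polynomial bigraded_algebra)"
    "veronese (Suc 0) (Suc 0) (quotient_algebra (S_alg n m) J) = quotient_algebra (S_alg n m) J"
proof -
  have neg: "acomp (S_alg n m) p = {0 :: 'k polynomial}" if "\<not> nonneg p" for p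
  proof -
    have "f = 0" if f: "f \<in> acomp (S_alg n m) p" for f :: "'k polynomial"
    proof -
      have "keys f = {}"
      proof (rule ccontr)
        assume "keys f \<noteq> {}"
        then obtain \<mu> where "\<mu> \<in> keys f" by blast
        then have "bidegree n m \<mu> = p" using f by (simp add: S_simps)
        then show False using \<open>\<not> nonneg p\<close> bidegree_nonneg[of n m \<mu>] by simp
      qed
      then show ?thesis by simp
    qed
    moreover have "0 \<in> acomp (S_alg n m) p" by (simp add: S_simps poly_carrier_def)
    ultimately show ?thesis by blast
  qed
  have eqI: "veronese (Suc 0) (Suc 0) R = R" if "\<And>p. \<not> nonneg p \<Longrightarrow> acomp R p = {zero R}" for R :: "'c bigraded_algebra"
  proof -
    have "(\<lambda>(a, b). if 0 \<le> a \<and> 0 \<le> b then acomp R (a * int (Suc 0), b * int (Suc 0)) else {\<zero>\<^bsub>R\<^esub>}) = acomp R"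
    proof
      fix p show "(case p of (a, b) \<Rightarrow> if 0 \<le> a \<and> 0 \<le> b then acomp R (a * int (Suc 0), b * int (Suc 0)) else {\<zero>\<^bsub>R\<^esub>}) = acomp R p"
        using that[of p] by (cases p; cases "nonneg p") auto
    qed
    then show ?thesis by (simp add: veronese_def)
  qed
  show "veronese (Suc 0) (Suc 0) (S_alg n m) = (S_alg n m :: 'k polynomial bigraded_algebra)"
    by (rule eqI) (simp add: neg, simp add: S_simps)
  have "J +>\<^bsub>S_alg n m\<^esub> 0 = J" by (auto simp: coset_eq)
  then show "veronese (Suc 0) (Suc 0) (quotient_algebra (S_alg n m) J) = quotient_algebra (S_alg n m) J"
    by (intro eqI) (simp add: quotient_simps neg)
qed

lemma (in graded_ring) graded_module_irrelevant: "graded_module (*) (\<lambda>p. if p = 0 then {0} else A p)"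
proof -
  have "a * x \<in> (if p + q = 0 then {0} else A (p + q))"
    if a: "a \<in> A p" and x: "x \<in> (if q = 0 then {0} else A q)" for a x p q
  proof (cases "q = 0")
    case False
    have "a = 0 \<or> x = 0" if "p + q = 0"
    proof -
      have "\<not> (nonneg p \<and> nonneg q)" using that False by (cases p; cases q) (auto simp: zero_prod_def)
      then show ?thesis using a x False A_neg[of p] A_neg[of q] by auto
    qed
    then show ?thesis using A_mult[OF a, of x q] x False A_zero by auto
  qed (use x A_zero in simp)
  then show ?thesis unfolding graded_module_def by (simp add: module_mult A_zero A_diff)
qed

lemma (in veronese_setup) residue_field_resolution:
  "\<exists>Bp \<delta>p (Dp :: nat \<Rightarrow> nat \<Rightarrow> nat \<Rightarrow> 'k::field polynomial). veronese_tor n m s t Bp \<delta>p Dp"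
proof -
  have sub: "(if p = 0 then {0} else VA p) \<subseteq> (VA p :: 'k polynomial set)" for p by (simp add: mon_zero)
  obtain Bp \<delta>p and Dp :: "nat \<Rightarrow> nat \<Rightarrow> nat \<Rightarrow> 'k polynomial"
    where R: "resolution (\<lambda>p. if p = 0 then {0} else VA p) Bp \<delta>p (\<lambda>_. 1) Dp" "Bp 0 = {0}" "\<delta>p 0 0 = 0"
    using minimal_resolution[OF graded_module_irrelevant sub] by (elim exE conjE) (rule that)
  have "veronese_tor n m s t Bp \<delta>p Dp"
    by unfold_locales (rule R)+
  then show ?thesis by blast
qed

lemma (in veronese_tor) betti_eq_0_iff_tor_vanishes:
  fixes J :: "'k polynomial set"
  assumes J: "ideal J (S_alg n m)"
  shows "betti (veronese s t (S_alg n m)) (ver_quotient n m J s t) i p = 0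
    \<longleftrightarrow> tor_vanishes (*) VA (\<lambda>p. VA p \<inter> J) i p"
proof -
  interpret M: presented_module "VA :: bideg \<Rightarrow> 'k polynomial set" "single 0"
    "veronese s t (S_alg n m)" "ver_quotient n m J s t"
    "coset n m J" "\<lambda>p. VA p \<inter> J"
    by (rule presented_quotient[OF J])
  obtain B0 \<delta>0 D0 where R0: "resolution (\<lambda>p. VA p \<inter> J) B0 \<delta>0 (\<lambda>_. 1) D0"
    using minimal_resolution[OF M.I_graded_module M.I_sub] by (elim exE conjE) (rule that)
  obtain B \<delta> r D where R: "resolution (\<lambda>p. VA p \<inter> J) B \<delta> r D"
    and b: "\<forall>i p. betti (veronese s t (S_alg n m)) (ver_quotient n m J s t) i p = 0
      \<longleftrightarrow> tor_zero_via B \<delta> D i p"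
    using M.betti_eq_0_iff[OF R0] by (elim exE conjE)
  show ?thesis using b tor_vanishes_iff_tor_zero_via[OF R M.I_graded_module M.I_sub] by simp
qed

text \<open>
  The Betti numbers of \<open>R\<^sub>\<Delta>\<close> over \<open>S\<^sub>\<Delta>\<close> are controlled by those of \<open>R\<close> over \<open>S\<close>, in both coordinates at once.
\<close>

lemma betti_veronese_nonzero:
  fixes J :: "'k::field polynomial set"
  assumes J: "ideal J (S_alg n m)"
    and b: "betti (veronese s t (S_alg n m)) (ver_quotient n m J s t) i p \<noteq> 0"
  shows "\<exists>l\<le>i. \<exists>c. nonneg c \<and> betti (S_alg n m) (module_via (coset n m J) (quotient_algebra (S_alg n m) J)) l c \<noteq> 0 \<and>
    \<not> veronese_setup.excess s t (i - l) c p"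
proof -
  obtain Bq \<delta>q and Dq :: "nat \<Rightarrow> nat \<Rightarrow> nat \<Rightarrow> 'k polynomial" where "veronese_tor n m (Suc 0) (Suc 0) Bq \<delta>q Dq"
    using veronese_setup.residue_field_resolution[of n m "Suc 0" "Suc 0"] by blast
  then interpret T: veronese_tor n m "Suc 0" "Suc 0" Bq \<delta>q Dq .
  obtain Bp \<delta>p and Dp :: "nat \<Rightarrow> nat \<Rightarrow> nat \<Rightarrow> 'k polynomial" where "veronese_tor n m s t Bp \<delta>p Dp"
    using veronese_setup.residue_field_resolution[of n m s t] by blast
  then interpret V: veronese_tor n m s t Bp \<delta>p Dp .
  interpret M: presented_module "T.VA :: bideg \<Rightarrow> 'k polynomial set" "single 0"
    "veronese (Suc 0) (Suc 0) (S_alg n m)" "ver_quotient n m J (Suc 0) (Suc 0)"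
    "coset n m J" "\<lambda>p. T.VA p \<inter> J"
    by (rule T.presented_quotient[OF J])
  have nt: "\<not> V.tor_vanishes (*) V.VA (\<lambda>p. V.VA p \<inter> J) i p"
    using V.betti_eq_0_iff_tor_vanishes[OF J] b by simp
  \<comment> \<open>If \<open>J\<close> is the unit ideal, then \<open>R\<^sub>\<Delta> = 0\<close> has no nonzero Betti number; otherwise the resolution can be chosen minimal.\<close>
  have u: "1 \<notin> T.VA 0 \<inter> J"
  proof
    assume "1 \<in> T.VA 0 \<inter> J"
    then have "1 \<in> J" by blast
    have "f \<in> J" if "f \<in> V.VA q" for f :: "'k polynomial" and q
    proof -
      have "f \<in> poly_carrier n m" using that by (auto simp: V.mon_def poly_carrier_def split: if_splits)
      from ideal_closed(4)[OF J this \<open>1 \<in> J\<close>] show ?thesis by simp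
    qed
    then have "V.tor_vanishes (*) V.VA (\<lambda>p. V.VA p \<inter> J) i p" by (intro V.tor_vanishes_trivial[OF V.graded_module_A]) blast
    with nt show False by simp
  qed
  obtain B \<delta> and D :: "nat \<Rightarrow> nat \<Rightarrow> nat \<Rightarrow> 'k polynomial" where R: "T.resolution (\<lambda>p. T.VA p \<inter> J) B \<delta> (\<lambda>_. 1) D"
    and nonnegB: "\<forall>i. \<forall>j\<in>B i. nonneg (\<delta> i j)"
    and min: "1 \<notin> T.VA 0 \<inter> J \<longrightarrow> (\<forall>i p. T.syz (\<lambda>p. T.VA p \<inter> J) B \<delta> (\<lambda>_. 1) D i p \<subseteq> T.irr_part (B i) (\<delta> i) p)"
    using T.minimal_resolution[OF M.I_graded_module M.I_sub] by (elim exE conjE) (rule that)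
  have ver_fam: "(\<lambda>p. V.VA p \<inter> J) = V.ver_fam (\<lambda>p. T.VA p \<inter> J)"
    using ideal_closed(1)[OF J] by (auto simp: V.VA_eq_ver_fam V.ver_fam_def fun_eq_iff)
  obtain l j where l: "l \<le> i" "j \<in> B l" "\<not> V.excess (i - l) (\<delta> l j) p"
    using V.tor_vanishes_veronese[OF R M.I_graded_module M.I_sub nonnegB] nt unfolding ver_fam by blast
  have "\<not> T.tor_zero_via B \<delta> D l (\<delta> l j)" by (rule T.minimal_tor_nonzero[OF R min[rule_format, OF u] l(2)])
  then have "\<not> T.tor_vanishes (*) T.VA (\<lambda>p. T.VA p \<inter> J) l (\<delta> l j)"
    using T.tor_vanishes_iff_tor_zero_via[OF R M.I_graded_module M.I_sub] by simp
  then have "betti (S_alg n m) (module_via (coset n m J) (quotient_algebra (S_alg n m) J)) l (\<delta> l j) \<noteq> 0"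
    using T.betti_eq_0_iff_tor_vanishes[OF J, of l "\<delta> l j"] by (simp add: veronese_one_one[OF J])
  with l nonnegB show ?thesis by blast
qed

lemma ceiling_eq: "s > 0 \<Longrightarrow> \<lceil>real_of_int a / real s\<rceil> = - (- a div int s)"
  using ceiling_divide_eq_div[of a "int s"] by simp

theorem theorem6p3:
  fixes n m s t :: nat
    and J :: "'k::field polynomial set"
    and S :: "'k polynomial bigraded_algebra"
    and R :: "'k polynomial set bigraded_algebra"
    and \<pi> :: "'k polynomial \<Rightarrow> 'k polynomial set"
  assumes "infinite (UNIV :: 'k set)"
    and "S = S_alg n m"
    and "bigraded_ideal n m J"
    and "R = quotient_algebra S J"
    and "\<pi> = (\<lambda>f. J +>\<^bsub>S\<^esub> f)"
    and "(s, t) \<noteq> (0, 0)"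
  shows "(s > 0 \<longrightarrow>
           reg_x (veronese s t S) (module_via \<pi> (veronese s t R))
           \<le> Sup {ereal (of_int c) | c (i :: nat) (a :: int) (b :: nat).
                 c = \<lceil>real_of_int a / real s\<rceil> - int i \<and>
                 betti S (module_via \<pi> R) i (a, int b) \<noteq> 0})
       \<and> (t > 0 \<longrightarrow>
           reg_y (veronese s t S) (module_via \<pi> (veronese s t R))
           \<le> Sup {ereal (of_int c) | c (i :: nat) (b :: int) (a :: nat).
                 c = \<lceil>real_of_int b / real t\<rceil> - int i \<and>
                 betti S (module_via \<pi> R) i (int a, b) \<noteq> 0})"
proof (intro conjI impI)
  have J: "ideal J (S_alg n m)" using assms(3) by (simp add: bigraded_ideal_def)
  note key = betti_veronese_nonzero[OF J, of s t, folded assms(2), folded assms(4,5)]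
  let ?X = "{ereal (of_int c) | c (i :: nat) (a :: int) (b :: nat).
                 c = \<lceil>real_of_int a / real s\<rceil> - int i \<and>
                 betti S (module_via \<pi> R) i (a, int b) \<noteq> 0}"
  let ?Y = "{ereal (of_int c) | c (i :: nat) (b :: int) (a :: nat).
                 c = \<lceil>real_of_int b / real t\<rceil> - int i \<and>
                 betti S (module_via \<pi> R) i (int a, b) \<noteq> 0}"
  show "reg_x (veronese s t S) (module_via \<pi> (veronese s t R)) \<le> Sup ?X" if s: "s > 0"
    unfolding reg_x_def
  proof (rule SUP_least)
    fix a assume "a \<in> {a. \<exists>(i :: nat) b. betti (veronese s t S) (module_via \<pi> (veronese s t R)) i (a + int i, b) \<noteq> 0}"
    then obtain i b where "betti (veronese s t S) (module_via \<pi> (veronese s t R)) i (a + int i, b) \<noteq> 0" by blast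
    from key[OF this] obtain l c where l: "l \<le> i" "nonneg c" "betti S (module_via \<pi> R) l c \<noteq> 0"
      "\<not> veronese_setup.excess s t (i - l) c (a + int i, b)" by blast
    have "a + int i \<le> int (i - l) - (- fst c div int s)"
      using l(4) s by (auto simp: veronese_setup.excess_def)
    then have "a \<le> \<lceil>real_of_int (fst c) / real s\<rceil> - int l"
      using l(1) by (simp add: ceiling_eq[OF s] of_nat_diff)
    then have "ereal (of_int a) \<le> ereal (of_int (\<lceil>real_of_int (fst c) / real s\<rceil> - int l))" by simp
    also have "\<dots> \<le> Sup ?X"
    proof (rule Sup_upper)
      have "betti S (module_via \<pi> R) l (fst c, int (nat (snd c))) \<noteq> 0" using l(2,3) by simp
      then show "ereal (of_int (\<lceil>real_of_int (fst c) / real s\<rceil> - int l)) \<in> ?X" by blast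
    qed
    finally show "ereal (of_int a) \<le> Sup ?X" .
  qed
  show "reg_y (veronese s t S) (module_via \<pi> (veronese s t R)) \<le> Sup ?Y" if t: "t > 0"
    unfolding reg_y_def
  proof (rule SUP_least)
    fix b assume "b \<in> {b. \<exists>(i :: nat) a. betti (veronese s t S) (module_via \<pi> (veronese s t R)) i (a, b + int i) \<noteq> 0}"
    then obtain i a where "betti (veronese s t S) (module_via \<pi> (veronese s t R)) i (a, b + int i) \<noteq> 0" by blast
    from key[OF this] obtain l c where l: "l \<le> i" "nonneg c" "betti S (module_via \<pi> R) l c \<noteq> 0"
      "\<not> veronese_setup.excess s t (i - l) c (a, b + int i)" by blast
    have "b + int i \<le> int (i - l) - (- snd c div int t)"
      using l(4) t by (auto simp: veronese_setup.excess_def)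
    then have "b \<le> \<lceil>real_of_int (snd c) / real t\<rceil> - int l"
      using l(1) by (simp add: ceiling_eq[OF t] of_nat_diff)
    then have "ereal (of_int b) \<le> ereal (of_int (\<lceil>real_of_int (snd c) / real t\<rceil> - int l))" by simp
    also have "\<dots> \<le> Sup ?Y"
    proof (rule Sup_upper)
      have "betti S (module_via \<pi> R) l (int (nat (fst c)), snd c) \<noteq> 0" using l(2,3) by simp
      then show "ereal (of_int (\<lceil>real_of_int (snd c) / real t\<rceil> - int l)) \<in> ?Y" by blast
    qed
    finally show "ereal (of_int b) \<le> Sup ?Y" .
  qed
qed

end
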